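(* Let $d\ge 1$, let $R\subset\mathbb{R}^d$ be a reduced (not necessarily crystallographic) root system with finite reflection group $G$ and positive system $R_+$, and let $\kappa:R\to\mathbb{R}_{\ge 0}$ be a $G$-invariant multiplicity function. Let $\Delta_\kappa$ be the Dunkl Laplacian, $E_\kappa$ the Dunkl kernel, $h_\kappa$ the weight function and $b_\kappa$ the normalizing constant. Let $m\ge0$ be an integer. For every polynomial $p\in\mathscr{P}_m$ on $\mathbb{R}^d$ homogeneous of degree $m$ and every $y\in\mathbb{R}^d$, $$b_\kappa\int_{\mathbb{R}^d}p(x)\,e^{-\|x\|^2/2}\,E_\kappa(x,-iy)\,h_\kappa^2(x)\,dx=(-i)^m\,e^{-\|y\|^2/2}\sum_{j=0}^{[m/2]}\frac{(-1)^j}{2^j j!}\,\Delta_\kappa^j\,p(y),$$ where $[m/2]$ is the integer part of $m/2$. In particular, if in addition $\Delta_\kappa p=0$, then for every $y\in\mathbb{R}^d$, $$b_\kappa\int_{\mathbb{R}^d}p(x)\,e^{-\|x\|^2/2}\,E_\kappa(x,-iy)\,h_\kappa^2(x)\,dx=(-i)^m\,p(y)\,e^{-\|y\|^2/2}.$$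
   Context: $i=\sqrt{-1}$; $\langle\cdot,\cdot\rangle$ is the standard inner product on $\mathbb{R}^d$ and $\|x\|=\langle x,x\rangle^{1/2}$. A reduced root system $R$ is a finite set of nonzero vectors in $\mathbb{R}^d$ with $R\cap\mathbb{R}\alpha=\{\pm\alpha\}$ and $r_\alpha(R)=R$ for every $\alpha\in R$, where $r_\alpha$ is the orthogonal reflection in the hyperplane $\alpha^\perp$; no integrality condition is imposed. $G$ is the (finite) group generated by $\{r_\alpha:\alpha\in R\}$, and $R_+\subset R$ is a fixed positive system. A multiplicity function is a $G$-invariant function $\kappa:R\to\mathbb{R}_{\ge0}$, $\alpha\mapsto\kappa_\alpha$. For $\xi\in\mathbb{R}^d$, with $\partial_\xi=\langle\xi,\nabla\rangle$, the Dunkl operator is $$\mathcal{D}_\xi f(x)=\partial_\xi f(x)+\sum_{\alpha\in R_+}\kappa_\alpha\langle\alpha,\xi\rangle\frac{f(x)-f(r_\alpha x)}{\langle\alpha,x\rangle},$$ with the quotient extended smoothly across $\langle\alpha,x\rangle=0$. Write $\mathcal{D}_j=\mathcal{D}_{e_j}$ for the standard basis $e_1,\dots,e_d$. These operators commute. The Dunkl Laplacian is $\Delta_\kappa=\sum_{j=1}^d\mathcal{D}_j^2$. The Dunkl kernel $E_\kappa$: for each $y\in\mathbb{C}^d$, $x\mapsto E_\kappa(x,y)$ is the unique real analytic function on $\mathbb{R}^d$ with $\mathcal{D}_jE_\kappa(\cdot,y)=y_jE_\kappa(\cdot,y)$ for $1\le j\le d$ and $E_\kappa(0,y)=1$ (for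 $\kappa=0$ it is $e^{\sum_j x_jy_j}$). The weight function is $h_\kappa(x)=\prod_{\alpha\in R_+}|\langle\alpha,x\rangle|^{\kappa_\alpha}$, and $b_\kappa=\left(\int_{\mathbb{R}^d}h_\kappa^2(x)e^{-\|x\|^2/2}\,dx\right)^{-1}$. *)

theory Defs
  imports "HOL-Analysis.Analysis"
begin

definition refl_along :: "real ^ 'n \<Rightarrow> real ^ 'n \<Rightarrow> real ^ 'n" where
  "refl_along \<alpha> x = x - (2 * (\<alpha> \<bullet> x) / (\<alpha> \<bullet> \<alpha>)) *\<^sub>R \<alpha>"

definition reduced_root_system :: "(real ^ 'n) set \<Rightarrow> bool" where
  "reduced_root_system R \<longleftrightarrow>
     finite R \<and> 0 \<notin> R \<and>
     (\<forall>\<alpha>\<in>R. R \<inter> range (\<lambda>t. t *\<^sub>R \<alpha>) = {\<alpha>, - \<alpha>}) \<and>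
     (\<forall>\<alpha>\<in>R. refl_along \<alpha> ` R = R)"

inductive_set reflection_group :: "(real ^ 'n) set \<Rightarrow> (real ^ 'n \<Rightarrow> real ^ 'n) set"
  for R where
  ident: "id \<in> reflection_group R"
| gen: "\<alpha> \<in> R \<Longrightarrow> refl_along \<alpha> \<in> reflection_group R"
| mult: "g \<in> reflection_group R \<Longrightarrow> h \<in> reflection_group R \<Longrightarrow> g \<circ> h \<in> reflection_group R"
| inverse: "g \<in> reflection_group R \<Longrightarrow> inv g \<in> reflection_group R"

definition positive_system :: "(real ^ 'n) set \<Rightarrow> (real ^ 'n) set \<Rightarrow> bool" where
  "positive_system R P \<longleftrightarrow>
     (\<exists>u. (\<forall>\<alpha>\<in>R. \<alpha> \<bullet> u \<noteq> 0) \<and> P = {\<alpha> \<in> R. 0 < \<alpha> \<bullet> u})"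

definition multiplicity_function :: "(real ^ 'n) set \<Rightarrow> (real ^ 'n \<Rightarrow> real) \<Rightarrow> bool" where
  "multiplicity_function R \<kappa> \<longleftrightarrow>
     (\<forall>\<alpha>\<in>R. 0 \<le> \<kappa> \<alpha>) \<and> (\<forall>g\<in>reflection_group R. \<forall>\<alpha>\<in>R. \<kappa> (g \<alpha>) = \<kappa> \<alpha>)"

(* On the hyperplane orthogonal to \<alpha> the value is the limit from its complement,
   which is the continuous (for smooth f, smooth) extension of the quotient. *)
definition refl_quotient :: "real ^ 'n \<Rightarrow> (real ^ 'n \<Rightarrow> complex) \<Rightarrow> real ^ 'n \<Rightarrow> complex" where
  "refl_quotient \<alpha> f x =
     (if \<alpha> \<bullet> x \<noteq> 0 then (f x - f (refl_along \<alpha> x)) / of_real (\<alpha> \<bullet> x)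
      else Lim (at x within {z. \<alpha> \<bullet> z \<noteq> 0})
             (\<lambda>z. (f z - f (refl_along \<alpha> z)) / of_real (\<alpha> \<bullet> z)))"

(* In this and the following definitions P is the positive system. *)
definition dunkl_op ::
  "(real ^ 'n) set \<Rightarrow> (real ^ 'n \<Rightarrow> real) \<Rightarrow> real ^ 'n \<Rightarrow>
   (real ^ 'n \<Rightarrow> complex) \<Rightarrow> real ^ 'n \<Rightarrow> complex" where
  "dunkl_op P \<kappa> \<xi> f x =
     frechet_derivative f (at x) \<xi> +
     (\<Sum>\<alpha>\<in>P. of_real (\<kappa> \<alpha> * (\<alpha> \<bullet> \<xi>)) * refl_quotient \<alpha> f x)"

definition dunkl_laplacian ::
  "(real ^ 'n) set \<Rightarrow> (real ^ 'n \<Rightarrow> real) \<Rightarrow>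
   (real ^ 'n \<Rightarrow> complex) \<Rightarrow> real ^ 'n \<Rightarrow> complex" where
  "dunkl_laplacian P \<kappa> f x =
     (\<Sum>j\<in>UNIV. dunkl_op P \<kappa> (axis j 1) (dunkl_op P \<kappa> (axis j 1) f) x)"

(* Near every point, f is the sum of an (unconditionally, hence absolutely) convergent
   power series; the multi-indices are the functions \<nu> of type 'n \<Rightarrow> nat. *)
definition real_analytic :: "(real ^ 'n \<Rightarrow> complex) \<Rightarrow> bool" where
  "real_analytic f \<longleftrightarrow>
     (\<forall>a. \<exists>c. \<exists>r>0. \<forall>x\<in>ball a r.
        ((\<lambda>\<nu> :: 'n \<Rightarrow> nat. c \<nu> * of_real (\<Prod>i\<in>UNIV. (x $ i - a $ i) ^ \<nu> i)) has_sum f x) UNIV)"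

definition dunkl_kernel ::
  "(real ^ 'n) set \<Rightarrow> (real ^ 'n \<Rightarrow> real) \<Rightarrow> real ^ 'n \<Rightarrow> complex ^ 'n \<Rightarrow> complex" where
  "dunkl_kernel P \<kappa> x y =
     (THE f. real_analytic f \<and>
             (\<forall>j x. dunkl_op P \<kappa> (axis j 1) f x = y $ j * f x) \<and>
             f 0 = 1) x"

(* The case distinction gives the factor 1 for \<kappa> \<alpha> = 0 also where \<alpha> \<bullet> x = 0,
   since 0 powr 0 = 0. *)
definition dunkl_weight ::
  "(real ^ 'n) set \<Rightarrow> (real ^ 'n \<Rightarrow> real) \<Rightarrow> real ^ 'n \<Rightarrow> real" where
  "dunkl_weight P \<kappa> x = (\<Prod>\<alpha>\<in>P. if \<kappa> \<alpha> = 0 then 1 else \<bar>\<alpha> \<bullet> x\<bar> powr \<kappa> \<alpha>)"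

definition dunkl_const :: "(real ^ 'n) set \<Rightarrow> (real ^ 'n \<Rightarrow> real) \<Rightarrow> real" where
  "dunkl_const P \<kappa> =
     inverse (\<integral>x. (dunkl_weight P \<kappa> x)\<^sup>2 * exp (- (norm x)\<^sup>2 / 2) \<partial>lborel)"

definition homogeneous_polynomial :: "nat \<Rightarrow> (real ^ 'n \<Rightarrow> complex) \<Rightarrow> bool" where
  "homogeneous_polynomial m p \<longleftrightarrow>
     polynomial_function p \<and> (\<forall>t x. p (t *\<^sub>R x) = of_real (t ^ m) * p x)"

definition dunkl_gauss_integrand ::
  "(real ^ 'n) set \<Rightarrow> (real ^ 'n \<Rightarrow> real) \<Rightarrow> (real ^ 'n \<Rightarrow> complex) \<Rightarrow>
   real ^ 'n \<Rightarrow> real ^ 'n \<Rightarrow> complex" where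
  "dunkl_gauss_integrand P \<kappa> p y x =
     p x * of_real (exp (- (norm x)\<^sup>2 / 2)) *
     dunkl_kernel P \<kappa> x (\<chi> j. - \<i> * of_real (y $ j)) *
     of_real ((dunkl_weight P \<kappa> x)\<^sup>2)"

end

theory Submission
  imports Defs
begin

text \<open>Dunkl operators commute because \<open>[T\<^sub>\<eta>, T\<^sub>\<xi>]\<close> commutes with multiplication by linear forms and kills
  constants. The homogeneous part \<open>e\<^sub>n\<close> of the kernel in \<open>x\<close> must satisfy the Euler equation
  \<open>(n + \<Sum>\<kappa>\<^sub>\<alpha>(1 - r\<^sub>\<alpha>)) e\<^sub>n = \<langle>x, y\<rangle> e\<^sub>n\<^sub>-\<^sub>1\<close>. Since \<open>\<kappa> \<ge> 0\<close>, the operator on the left has an inverse of norm \<open>1/n\<close>, so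
  that \<open>e\<^sub>n\<close> exists with \<open>\<bar>e\<^sub>n(x)\<bar> \<le> (\<parallel>x\<parallel>\<parallel>y\<parallel>)\<^sup>n/n!\<close>; the same equation gives uniqueness.
  Write \<open>I(q)\<close> for the integral of \<open>q\<close> against \<open>exp (-\<parallel>x\<parallel>\<^sup>2/2) E(x, -iy) h\<^sup>2(x)\<close>. Skew-adjointness of \<open>T\<^sub>\<xi>\<close> gives
  \<open>I(\<langle>\<xi>, x\<rangle> q) = I(T\<^sub>\<xi> q) - i\<langle>\<xi>, y\<rangle> I(q)\<close>, and \<open>exp (-\<Delta>/2)\<close> turns this into multiplication by \<open>-i\<langle>\<xi>, y\<rangle>\<close>, because
  \<open>[\<Delta>, \<langle>\<xi>, x\<rangle>] = 2 T\<^sub>\<xi>\<close>; the formula follows by induction on the degree. The remaining value \<open>I(1)\<close> is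
  found term by term from the Euler equation.\<close>

section \<open>Reflections\<close>

text \<open>The kernel in the theorem is a definite description over all real analytic functions, so
  a convergent construction does not yet identify it: every competitor has to be excluded, and of a
  competitor, besides its equations, only differentiability is exploited. Hence uniqueness goes
  through the Euler equation, in which the difference quotients have lost their denominators.
  Estimates need a norm on homogeneous polynomials that is invariant under orthogonal maps, costs
  \<open>norm u\<close> for a linear factor, and costs a factor linear in the degree for a
  derivative or a difference quotient. The projective tensor norm has these properties by induction
  over the polynomial; it also bounds the Taylor coefficients at any centre, which makes the sum
  real analytic. The kernel carries a free complex scale \<open>c\<close>. At \<open>c = 0\<close>
  it is 1 and reflections do not change the Gaussian integral, which makes the moments of the
  homogeneous parts computable; \<open>c = - \<i>\<close> is the case of the theorem.\<close>

lemma linear_refl_along: "linear (refl_along \<alpha>)"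
  unfolding refl_along_def
  by (rule linearI) (auto simp: algebra_simps inner_add_right add_divide_distrib scaleR_add_left)

lemma refl_along_inner: "refl_along \<alpha> x \<bullet> y = x \<bullet> refl_along \<alpha> y"
  by (simp add: refl_along_def inner_diff_left inner_diff_right inner_commute algebra_simps)

lemma refl_along_self [simp]: "refl_along \<alpha> \<alpha> = - \<alpha>"
  by (cases "\<alpha> = 0") (auto simp: refl_along_def scaleR_2)

lemma inner_refl_along_self [simp]: "\<alpha> \<bullet> refl_along \<alpha> x = - (\<alpha> \<bullet> x)"
  using refl_along_inner[of \<alpha> \<alpha> x] by simp

lemma refl_along_involution [simp]: "refl_along \<alpha> (refl_along \<alpha> x) = x"
  using inner_refl_along_self[of \<alpha> x] by (simp add: refl_along_def algebra_simps)

lemma inner_refl_along_refl_along [simp]: "refl_along \<alpha> x \<bullet> refl_along \<alpha> y = x \<bullet> y"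
  by (simp add: refl_along_inner)

lemma norm_refl_along [simp]: "norm (refl_along \<alpha> x) = norm x"
  by (simp add: norm_eq_sqrt_inner)

lemma refl_along_hyperplane: "\<alpha> \<bullet> x = 0 \<Longrightarrow> refl_along \<alpha> x = x"
  by (simp add: refl_along_def)

lemma refl_along_uminus [simp]: "refl_along (- \<alpha>) = refl_along \<alpha>"
  by (auto simp: refl_along_def)

lemma refl_along_minus: "refl_along \<alpha> (- x) = - refl_along \<alpha> x"
  by (rule linear_neg[OF linear_refl_along])

lemma refl_along_scaleR: "refl_along \<alpha> (t *\<^sub>R x) = t *\<^sub>R refl_along \<alpha> x"
  by (rule linear_cmul[OF linear_refl_along])

lemma refl_along_comp_self [simp]: "refl_along \<alpha> \<circ> refl_along \<alpha> = id"
  by (auto simp: fun_eq_iff)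

text \<open>Reflections are isometries, so conjugating one by another gives the reflection in the
  moved vector; this transports difference quotients along
  \<open>refl_along \<beta>\<close>.\<close>

lemma refl_along_conj:
  "refl_along (refl_along \<beta> \<alpha>) (refl_along \<beta> x) = refl_along \<beta> (refl_along \<alpha> x)"
proof -
  have "refl_along (refl_along \<beta> \<alpha>) (refl_along \<beta> x)
    = refl_along \<beta> x - (2 * (\<alpha> \<bullet> x) / (\<alpha> \<bullet> \<alpha>)) *\<^sub>R refl_along \<beta> \<alpha>"
    by (subst refl_along_def) simp
  also have "\<dots> = refl_along \<beta> (refl_along \<alpha> x)"
    by (simp add: refl_along_def[of \<alpha>] linear_diff[OF linear_refl_along] refl_along_scaleR)
  finally show ?thesis .
qed

lemma bounded_linear_refl_along: "bounded_linear (refl_along \<alpha>)"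
  by (simp add: linear_refl_along flip: linear_conv_bounded_linear)

lemma has_derivative_refl_along [derivative_intros]:
  "(refl_along \<alpha> has_derivative refl_along \<alpha>) F"
  by (rule bounded_linear_imp_has_derivative[OF bounded_linear_refl_along])

lemma continuous_on_refl_along [continuous_intros]: "continuous_on S (refl_along \<alpha>)"
  by (rule linear_continuous_on[OF bounded_linear_refl_along])

lemma orthogonal_transformation_refl_along: "orthogonal_transformation (refl_along \<alpha>)"
  by (simp add: orthogonal_transformation_def linear_refl_along)

section \<open>Difference quotients and Dunkl operators\<close>

text \<open>Division-free form of the quotient: for nonzero \<alpha>, continuity and the product
  identity together determine \<open>Q\<close> also on the hyperplane, whose complement is dense, so
  no limit has to be computed.\<close>

definition has_refl_quotient ::
  "real ^ 'n \<Rightarrow> (real ^ 'n \<Rightarrow> complex) \<Rightarrow> (real ^ 'n \<Rightarrow> complex) \<Rightarrow> bool" where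
  "has_refl_quotient \<alpha> f Q \<longleftrightarrow>
     continuous_on UNIV Q \<and> (\<forall>x. f x - f (refl_along \<alpha> x) = of_real (\<alpha> \<bullet> x) * Q x)"

lemma has_refl_quotientD: "has_refl_quotient \<alpha> f Q \<Longrightarrow> f x - f (refl_along \<alpha> x) = of_real (\<alpha> \<bullet> x) * Q x"
  by (simp add: has_refl_quotient_def)

text \<open>The limit in \<open>refl_quotient\<close> has a determined value only along a nontrivial
  filter; a small step along \<alpha> leaves the hyperplane.\<close>

lemma hyperplane_complement_nontrivial:
  fixes \<alpha> x :: "real ^ 'n"
  assumes "\<alpha> \<noteq> 0" "\<alpha> \<bullet> x = 0"
  shows "at x within {z. \<alpha> \<bullet> z \<noteq> 0} \<noteq> bot"
proof -
  have "x islimpt {z. \<alpha> \<bullet> z \<noteq> 0}"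
    unfolding islimpt_approachable
  proof (intro allI impI)
    fix e :: real assume e: "e > 0"
    let ?z = "x + (e / (2 * norm \<alpha>)) *\<^sub>R \<alpha>"
    have "?z \<in> {z. \<alpha> \<bullet> z \<noteq> 0}" "?z \<noteq> x" "dist ?z x < e"
      using e assms by (auto simp: inner_add_right dist_norm)
    thus "\<exists>x'\<in>{z. \<alpha> \<bullet> z \<noteq> 0}. x' \<noteq> x \<and> dist x' x < e" by blast
  qed
  thus ?thesis by (simp add: trivial_limit_within)
qed

lemma refl_quotient_eq:
  assumes "\<alpha> \<noteq> 0" "has_refl_quotient \<alpha> f Q"
  shows "refl_quotient \<alpha> f = Q"
proof
  fix x
  have ev: "(f z - f (refl_along \<alpha> z)) / of_real (\<alpha> \<bullet> z) = Q z" if "\<alpha> \<bullet> z \<noteq> 0" for z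
    using has_refl_quotientD[OF assms(2), of z] that by (simp add: field_simps)
  show "refl_quotient \<alpha> f x = Q x"
  proof (cases "\<alpha> \<bullet> x = 0")
    case True
    have "(Q \<longlongrightarrow> Q x) (at x within {z. \<alpha> \<bullet> z \<noteq> 0})"
      using assms(2) by (meson UNIV_I continuous_on_def continuous_on_subset has_refl_quotient_def subset_UNIV tendsto_within_subset)
    hence "((\<lambda>z. (f z - f (refl_along \<alpha> z)) / of_real (\<alpha> \<bullet> z)) \<longlongrightarrow> Q x) (at x within {z. \<alpha> \<bullet> z \<noteq> 0})"
      by (rule Lim_transform_eventually) (auto simp: eventually_at_filter ev)
    hence "Lim (at x within {z. \<alpha> \<bullet> z \<noteq> 0}) (\<lambda>z. (f z - f (refl_along \<alpha> z)) / of_real (\<alpha> \<bullet> z)) = Q x"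
      by (rule tendsto_Lim[OF hyperplane_complement_nontrivial[OF assms(1) True]])
    thus ?thesis using True by (simp add: refl_quotient_def)
  next
    case False
    thus ?thesis using ev by (simp add: refl_quotient_def)
  qed
qed

text \<open>On the hyperplane both sides vanish because the reflection fixes the point, whatever
  value \<open>Lim\<close> returns there. The identity is therefore available for every
  \<open>f\<close>.\<close>

lemma inner_mult_refl_quotient: "of_real (\<alpha> \<bullet> x) * refl_quotient \<alpha> f x = f x - f (refl_along \<alpha> x)"
  by (cases "\<alpha> \<bullet> x = 0") (auto simp: refl_quotient_def refl_along_hyperplane)

lemma has_refl_quotient_refl_quotient:
  "\<alpha> \<noteq> 0 \<Longrightarrow> has_refl_quotient \<alpha> f Q \<Longrightarrow> has_refl_quotient \<alpha> f (refl_quotient \<alpha> f)"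
  using refl_quotient_eq by metis

definition dunkl_regular :: "(real ^ 'n \<Rightarrow> complex) \<Rightarrow> bool" where
  "dunkl_regular f \<longleftrightarrow> (\<forall>x. f differentiable at x) \<and>
     (\<forall>\<alpha>. \<alpha> \<noteq> 0 \<longrightarrow> has_refl_quotient \<alpha> f (refl_quotient \<alpha> f))"

lemma dunkl_regularI:
  assumes "\<And>x. f differentiable at x" "\<And>\<alpha>. \<alpha> \<noteq> 0 \<Longrightarrow> \<exists>Q. has_refl_quotient \<alpha> f Q"
  shows "dunkl_regular f"
  using assms has_refl_quotient_refl_quotient unfolding dunkl_regular_def by blast

lemma dunkl_regular_derivative:
  "dunkl_regular f \<Longrightarrow> (f has_derivative frechet_derivative f (at x)) (at x)"
  by (simp add: dunkl_regular_def frechet_derivative_works)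

lemma dunkl_regular_differentiable: "dunkl_regular f \<Longrightarrow> f differentiable at x"
  by (simp add: dunkl_regular_def)

lemma dunkl_regular_quotient:
  "dunkl_regular f \<Longrightarrow> \<alpha> \<noteq> 0 \<Longrightarrow> has_refl_quotient \<alpha> f (refl_quotient \<alpha> f)"
  by (simp add: dunkl_regular_def)

lemma has_refl_quotient_const: "has_refl_quotient \<alpha> (\<lambda>x. c) (\<lambda>x. 0)"
  by (simp add: has_refl_quotient_def)

lemma has_refl_quotient_add:
  "has_refl_quotient \<alpha> f Q \<Longrightarrow> has_refl_quotient \<alpha> g Q' \<Longrightarrow>
   has_refl_quotient \<alpha> (\<lambda>x. f x + g x) (\<lambda>x. Q x + Q' x)"
  unfolding has_refl_quotient_def
  by (auto intro: continuous_on_add simp: distrib_left add_diff_add)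

text \<open>Leibniz rule twisted by the reflection: inserting the mixed product
  \<open>f (refl_along \<alpha> x) * g x\<close> leaves one factor evaluated at the reflected
  point.\<close>

lemma has_refl_quotient_mult:
  assumes "has_refl_quotient \<alpha> f Q" "has_refl_quotient \<alpha> g Q'"
    "continuous_on UNIV f" "continuous_on UNIV g"
  shows "has_refl_quotient \<alpha> (\<lambda>x. f x * g x) (\<lambda>x. Q x * g x + f (refl_along \<alpha> x) * Q' x)"
  unfolding has_refl_quotient_def
proof (intro conjI allI)
  show "continuous_on UNIV (\<lambda>x. Q x * g x + f (refl_along \<alpha> x) * Q' x)"
    using assms unfolding has_refl_quotient_def
    by (intro continuous_on_add continuous_on_mult assms
        continuous_on_compose2[OF assms(3) continuous_on_refl_along]) auto
  fix x
  have "f x * g x - f (refl_along \<alpha> x) * g (refl_along \<alpha> x)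
     = (f x - f (refl_along \<alpha> x)) * g x + f (refl_along \<alpha> x) * (g x - g (refl_along \<alpha> x))"
    by (simp add: algebra_simps)
  thus "f x * g x - f (refl_along \<alpha> x) * g (refl_along \<alpha> x)
     = of_real (\<alpha> \<bullet> x) * (Q x * g x + f (refl_along \<alpha> x) * Q' x)"
    using assms(1,2) by (simp add: has_refl_quotientD algebra_simps)
qed

lemma has_refl_quotient_inner:
  "has_refl_quotient \<alpha> (\<lambda>x. of_real (u \<bullet> x)) (\<lambda>x. of_real (2 * (\<alpha> \<bullet> u) / (\<alpha> \<bullet> \<alpha>)))"
  by (auto simp: has_refl_quotient_def refl_along_def inner_diff_right inner_commute algebra_simps
      simp flip: of_real_mult of_real_diff)

lemma dunkl_regular_const: "dunkl_regular (\<lambda>x. c)"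
  by (rule dunkl_regularI) (auto intro: has_refl_quotient_const)

lemma dunkl_regular_inner: "dunkl_regular (\<lambda>x. of_real (u \<bullet> x))"
proof (rule dunkl_regularI)
  fix x
  have "((\<lambda>x. of_real (u \<bullet> x) :: complex) has_derivative (\<lambda>h. of_real (u \<bullet> h))) (at x)"
    by (auto intro!: derivative_eq_intros)
  thus "(\<lambda>x. of_real (u \<bullet> x) :: complex) differentiable at x"
    using differentiableI by blast
qed (auto intro: has_refl_quotient_inner)

lemma dunkl_regular_add:
  assumes "dunkl_regular f" "dunkl_regular g"
  shows "dunkl_regular (\<lambda>x. f x + g x)"
proof (rule dunkl_regularI)
  fix x show "(\<lambda>x. f x + g x) differentiable at x"
    by (intro derivative_intros assms[THEN dunkl_regular_differentiable])
next
  fix \<alpha> :: "real ^ 'a" assume a: "\<alpha> \<noteq> 0"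
  show "\<exists>Q. has_refl_quotient \<alpha> (\<lambda>x. f x + g x) Q"
    by (rule exI, rule has_refl_quotient_add[OF assms[THEN dunkl_regular_quotient, OF a]])
qed

lemma dunkl_regular_continuous: "dunkl_regular f \<Longrightarrow> continuous_on UNIV f"
  unfolding dunkl_regular_def
  by (simp add: continuous_at_imp_continuous_on differentiable_imp_continuous_within)

lemma dunkl_regular_mult:
  assumes "dunkl_regular f" "dunkl_regular g"
  shows "dunkl_regular (\<lambda>x. f x * g x)"
proof (rule dunkl_regularI)
  fix x show "(\<lambda>x. f x * g x) differentiable at x"
    by (intro derivative_intros assms[THEN dunkl_regular_differentiable])
next
  fix \<alpha> :: "real ^ 'a" assume a: "\<alpha> \<noteq> 0"
  show "\<exists>Q. has_refl_quotient \<alpha> (\<lambda>x. f x * g x) Q"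
    by (rule exI, rule has_refl_quotient_mult[OF assms[THEN dunkl_regular_quotient, OF a]
            assms[THEN dunkl_regular_continuous]])
qed

lemma dunkl_regular_cmult: "dunkl_regular f \<Longrightarrow> dunkl_regular (\<lambda>x. c * f x)"
  by (rule dunkl_regular_mult[OF dunkl_regular_const])

lemma dunkl_regular_sum: "(\<And>i. i \<in> I \<Longrightarrow> dunkl_regular (f i)) \<Longrightarrow> dunkl_regular (\<lambda>x. \<Sum>i\<in>I. f i x)"
  by (induction I rule: infinite_finite_induct) (auto intro: dunkl_regular_const dunkl_regular_add)

lemma refl_along_eq_0_iff [simp]: "refl_along \<beta> \<alpha> = 0 \<longleftrightarrow> \<alpha> = 0"
  using norm_refl_along[of \<beta> \<alpha>] by (metis norm_eq_zero)

lemma has_refl_quotient_refl: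
  assumes "has_refl_quotient (refl_along \<beta> \<alpha>) f Q"
  shows "has_refl_quotient \<alpha> (\<lambda>x. f (refl_along \<beta> x)) (\<lambda>x. Q (refl_along \<beta> x))"
  unfolding has_refl_quotient_def
proof (intro conjI allI)
  show "continuous_on UNIV (\<lambda>x. Q (refl_along \<beta> x))"
    using assms unfolding has_refl_quotient_def
    by (auto intro: continuous_on_compose2[OF _ continuous_on_refl_along])
  fix x
  show "f (refl_along \<beta> x) - f (refl_along \<beta> (refl_along \<alpha> x)) =
          of_real (\<alpha> \<bullet> x) * Q (refl_along \<beta> x)"
    using has_refl_quotientD[OF assms, of "refl_along \<beta> x"] by (simp add: refl_along_conj)
qed

lemma dunkl_regular_refl:
  assumes "dunkl_regular f"
  shows "dunkl_regular (\<lambda>x. f (refl_along \<beta> x))"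
proof (rule dunkl_regularI)
  fix x
  have "((\<lambda>x. f (refl_along \<beta> x)) has_derivative
      (\<lambda>h. frechet_derivative f (at (refl_along \<beta> x)) (refl_along \<beta> h))) (at x)"
    by (rule has_derivative_compose[OF has_derivative_refl_along dunkl_regular_derivative[OF assms]])
  thus "(\<lambda>x. f (refl_along \<beta> x)) differentiable at x"
    using differentiableI by blast
next
  fix \<alpha> :: "real ^ 'a" assume "\<alpha> \<noteq> 0"
  thus "\<exists>Q. has_refl_quotient \<alpha> (\<lambda>x. f (refl_along \<beta> x)) Q"
    using has_refl_quotient_refl[of \<beta> \<alpha> f] assms unfolding dunkl_regular_def
    by (metis refl_along_eq_0_iff)
qed

lemma dunkl_op_eq:
  assumes "(f has_derivative f') (at x)" "\<And>\<alpha>. \<alpha> \<in> P \<Longrightarrow> \<alpha> \<noteq> 0"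
    "\<And>\<alpha>. \<alpha> \<in> P \<Longrightarrow> has_refl_quotient \<alpha> f (Q \<alpha>)"
  shows "dunkl_op P \<kappa> \<xi> f x = f' \<xi> + (\<Sum>\<alpha>\<in>P. of_real (\<kappa> \<alpha> * (\<alpha> \<bullet> \<xi>)) * Q \<alpha> x)"
proof -
  have "refl_quotient \<alpha> f = Q \<alpha>" if "\<alpha> \<in> P" for \<alpha>
    using that assms(2,3) by (intro refl_quotient_eq)
  thus ?thesis
    by (simp add: dunkl_op_def frechet_derivative_at[OF assms(1), symmetric])
qed

section \<open>Calculus of the Dunkl operators of a fixed root system\<close>

locale dunkl =
  fixes R P :: "(real ^ 'n) set" and \<kappa> :: "real ^ 'n \<Rightarrow> real"
  assumes root: "reduced_root_system R"
    and pos: "positive_system R P"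
    and mult: "multiplicity_function R \<kappa>"
begin

abbreviation T :: "real ^ 'n \<Rightarrow> (real ^ 'n \<Rightarrow> complex) \<Rightarrow> real ^ 'n \<Rightarrow> complex" where
  "T \<equiv> dunkl_op P \<kappa>"

definition \<gamma> :: real where "\<gamma> = (\<Sum>\<alpha>\<in>P. \<kappa> \<alpha>)"

lemma finite_R: "finite R" and root_nonzero: "\<alpha> \<in> R \<Longrightarrow> \<alpha> \<noteq> 0"
  and uminus_root: "\<alpha> \<in> R \<Longrightarrow> - \<alpha> \<in> R"
  and refl_root: "\<alpha> \<in> R \<Longrightarrow> \<beta> \<in> R \<Longrightarrow> refl_along \<beta> \<alpha> \<in> R"
  using root unfolding reduced_root_system_def by blast+

lemma P_subset_R: "P \<subseteq> R"
  using pos unfolding positive_system_def by auto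

lemma finite_P: "finite P"
  using finite_R P_subset_R finite_subset by blast

lemma P_nonzero: "\<alpha> \<in> P \<Longrightarrow> \<alpha> \<noteq> 0"
  using root_nonzero P_subset_R by blast

lemma P_in_R: "\<alpha> \<in> P \<Longrightarrow> \<alpha> \<in> R"
  using P_subset_R by blast

lemma uminus_in_P_iff: "\<alpha> \<in> R \<Longrightarrow> - \<alpha> \<in> P \<longleftrightarrow> \<alpha> \<notin> P"
  using pos uminus_root[of \<alpha>] unfolding positive_system_def by fastforce

lemma \<kappa>_nonneg: "\<alpha> \<in> R \<Longrightarrow> 0 \<le> \<kappa> \<alpha>"
  using mult unfolding multiplicity_function_def by blast

lemma \<kappa>_refl: "\<alpha> \<in> R \<Longrightarrow> \<beta> \<in> R \<Longrightarrow> \<kappa> (refl_along \<beta> \<alpha>) = \<kappa> \<alpha>"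
  using mult reflection_group.gen unfolding multiplicity_function_def by blast

lemma \<kappa>_uminus: "\<alpha> \<in> R \<Longrightarrow> \<kappa> (- \<alpha>) = \<kappa> \<alpha>"
  using \<kappa>_refl[of \<alpha> \<alpha>] by simp

lemma \<gamma>_nonneg: "0 \<le> \<gamma>"
  unfolding \<gamma>_def by (intro sum_nonneg \<kappa>_nonneg P_in_R)

text \<open>A reflection need not map \<open>P\<close> to itself; with the sign corrected it
  permutes \<open>P\<close>.\<close>

definition pos_refl :: "real ^ 'n \<Rightarrow> real ^ 'n \<Rightarrow> real ^ 'n" where
  "pos_refl \<beta> \<alpha> = (if refl_along \<beta> \<alpha> \<in> P then refl_along \<beta> \<alpha> else - refl_along \<beta> \<alpha>)"

lemma bij_betw_pos_refl:
  assumes "\<beta> \<in> R"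
  shows "bij_betw (pos_refl \<beta>) P P"
proof -
  have into: "pos_refl \<beta> ` P \<subseteq> P"
    using uminus_in_P_iff refl_root assms P_in_R by (auto simp: pos_refl_def)
  have "inj_on (pos_refl \<beta>) P"
  proof (rule inj_onI)
    fix a b assume ab: "a \<in> P" "b \<in> P" "pos_refl \<beta> a = pos_refl \<beta> b"
    have "refl_along \<beta> a = refl_along \<beta> b \<or> refl_along \<beta> a = refl_along \<beta> (- b)"
      using ab(3) by (simp add: pos_refl_def refl_along_minus split: if_splits)
        (metis minus_minus)
    hence "a = b \<or> a = - b" by (metis refl_along_involution)
    thus "a = b" using ab uminus_in_P_iff P_in_R by blast
  qed
  thus ?thesis using into finite_P by (simp add: bij_betw_def endo_inj_surj)
qed

text \<open>An even summand does not notice the sign correction in \<open>pos_refl\<close>. This is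
  how sums over positive roots inherit invariance under reflections.\<close>

lemma sum_P_refl:
  assumes "\<beta> \<in> R" "\<And>\<alpha>. \<alpha> \<in> R \<Longrightarrow> \<phi> (- \<alpha>) = \<phi> \<alpha>"
  shows "(\<Sum>\<alpha>\<in>P. \<phi> (refl_along \<beta> \<alpha>)) = (\<Sum>\<alpha>\<in>P. \<phi> \<alpha>)"
proof -
  have "(\<Sum>\<alpha>\<in>P. \<phi> (refl_along \<beta> \<alpha>)) = (\<Sum>\<alpha>\<in>P. \<phi> (pos_refl \<beta> \<alpha>))"
    using assms by (intro sum.cong) (auto simp: pos_refl_def refl_root P_in_R)
  also have "\<dots> = (\<Sum>\<alpha>\<in>P. \<phi> \<alpha>)"
    by (rule sum.reindex_bij_betw[OF bij_betw_pos_refl[OF assms(1)]])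
  finally show ?thesis .
qed

lemma prod_P_refl:
  assumes "\<beta> \<in> R" "\<And>\<alpha>. \<alpha> \<in> R \<Longrightarrow> \<phi> (- \<alpha>) = \<phi> \<alpha>"
  shows "(\<Prod>\<alpha>\<in>P. \<phi> (refl_along \<beta> \<alpha>)) = (\<Prod>\<alpha>\<in>P. \<phi> \<alpha>)"
proof -
  have "(\<Prod>\<alpha>\<in>P. \<phi> (refl_along \<beta> \<alpha>)) = (\<Prod>\<alpha>\<in>P. \<phi> (pos_refl \<beta> \<alpha>))"
    using assms by (intro prod.cong) (auto simp: pos_refl_def refl_root P_in_R)
  also have "\<dots> = (\<Prod>\<alpha>\<in>P. \<phi> \<alpha>)"
    by (rule prod.reindex_bij_betw[OF bij_betw_pos_refl[OF assms(1)]])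
  finally show ?thesis .
qed

lemma T_eq:
  assumes "(f has_derivative f') (at x)" "\<And>\<alpha>. \<alpha> \<noteq> 0 \<Longrightarrow> has_refl_quotient \<alpha> f (Q \<alpha>)"
  shows "T \<xi> f x = f' \<xi> + (\<Sum>\<alpha>\<in>P. of_real (\<kappa> \<alpha> * (\<alpha> \<bullet> \<xi>)) * Q \<alpha> x)"
  using assms P_nonzero by (intro dunkl_op_eq) auto

lemma T_add_dir:
  assumes "dunkl_regular f"
  shows "T (\<xi> + \<eta>) f x = T \<xi> f x + T \<eta> f x"
  using has_derivative_linear[OF dunkl_regular_derivative[OF assms], THEN linear_add]
  by (simp add: dunkl_op_def inner_add_right algebra_simps sum.distrib)

lemma T_scaleR_dir:
  assumes "dunkl_regular f"
  shows "T (t *\<^sub>R \<xi>) f x = of_real t * T \<xi> f x"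
  using has_derivative_linear[OF dunkl_regular_derivative[OF assms], THEN linear_cmul]
  by (simp add: dunkl_op_def algebra_simps sum_distrib_left scaleR_conv_of_real[of _ "_ :: complex"])

lemma T_zero_dir: "dunkl_regular f \<Longrightarrow> T 0 f x = 0"
  using T_scaleR_dir[of f 0 0 x] by simp

lemma T_sum_dir:
  assumes "dunkl_regular f"
  shows "T (\<Sum>i\<in>I. t i *\<^sub>R \<xi> i) f x = (\<Sum>i\<in>I. of_real (t i) * T (\<xi> i) f x)"
  by (induction I rule: infinite_finite_induct)
     (auto simp: T_zero_dir[OF assms] T_add_dir[OF assms] T_scaleR_dir[OF assms])

lemma T_refl_dir:
  assumes "dunkl_regular f"
  shows "T (refl_along \<alpha> \<xi>) f x = T \<xi> f x - of_real (2 * (\<alpha> \<bullet> \<xi>) / (\<alpha> \<bullet> \<alpha>)) * T \<alpha> f x"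
  using T_add_dir[OF assms, of \<xi> "(- (2 * (\<alpha> \<bullet> \<xi>) / (\<alpha> \<bullet> \<alpha>))) *\<^sub>R \<alpha>"]
  by (simp add: refl_along_def T_scaleR_dir[OF assms] del: scaleR_minus_left)
     (simp add: scaleR_left.minus)

lemma T_const [simp]: "T \<xi> (\<lambda>x. c) = (\<lambda>x. 0)"
  using T_eq[of "\<lambda>x. c" "\<lambda>h. 0" _ "\<lambda>\<alpha> x. 0" \<xi>] by (auto simp: has_refl_quotient_const)

lemma T_add:
  assumes "dunkl_regular f" "dunkl_regular g"
  shows "T \<xi> (\<lambda>x. f x + g x) = (\<lambda>x. T \<xi> f x + T \<xi> g x)"
proof
  fix x
  show "T \<xi> (\<lambda>x. f x + g x) x = T \<xi> f x + T \<xi> g x"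
    by (subst T_eq[OF has_derivative_add[OF assms[THEN dunkl_regular_derivative]]
         has_refl_quotient_add[OF assms[THEN dunkl_regular_quotient]]])
       (auto simp: dunkl_op_def algebra_simps sum.distrib)
qed

lemma T_mult:
  assumes "dunkl_regular f" "dunkl_regular g"
  shows "T \<xi> (\<lambda>x. f x * g x) x = T \<xi> f x * g x + f x * frechet_derivative g (at x) \<xi>
     + (\<Sum>\<alpha>\<in>P. of_real (\<kappa> \<alpha> * (\<alpha> \<bullet> \<xi>)) * (f (refl_along \<alpha> x) * refl_quotient \<alpha> g x))"
  by (subst T_eq[OF has_derivative_mult[OF assms[THEN dunkl_regular_derivative]]
       has_refl_quotient_mult[OF assms[THEN dunkl_regular_quotient] assms[THEN dunkl_regular_continuous]]])
     (auto simp: dunkl_op_def algebra_simps sum.distrib sum_distrib_left sum_distrib_right)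

lemma T_cmult:
  assumes "dunkl_regular f"
  shows "T \<xi> (\<lambda>x. c * f x) = (\<lambda>x. c * T \<xi> f x)"
  using T_mult[OF dunkl_regular_const assms, of \<xi> c] 
  by (auto simp: fun_eq_iff dunkl_op_def algebra_simps sum_distrib_left)

lemma T_sum:
  assumes "\<And>i. i \<in> I \<Longrightarrow> dunkl_regular (f i)"
  shows "T \<xi> (\<lambda>x. \<Sum>i\<in>I. f i x) = (\<lambda>x. \<Sum>i\<in>I. T \<xi> (f i) x)"
  using assms
  by (induction I rule: infinite_finite_induct) (auto simp: T_add dunkl_regular_sum)

text \<open>The difference quotient of a linear form is constant, so the commutator of
  \<open>T \<xi>\<close> with multiplication by a linear form contains reflections of
  \<open>f\<close> but no quotients of it. Identities on polynomials are proved by induction along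
  this rule.\<close>

lemma T_inner_mult:
  assumes "dunkl_regular f"
  shows "T \<xi> (\<lambda>x. of_real (u \<bullet> x) * f x) = (\<lambda>x. of_real (u \<bullet> x) * T \<xi> f x + of_real (u \<bullet> \<xi>) * f x
     + (\<Sum>\<alpha>\<in>P. of_real (2 * \<kappa> \<alpha> / (\<alpha> \<bullet> \<alpha>) * (\<alpha> \<bullet> \<xi>) * (\<alpha> \<bullet> u)) * f (refl_along \<alpha> x)))"
proof
  fix x
  have 1: "frechet_derivative (\<lambda>x. of_real (u \<bullet> x) :: complex) (at x) = (\<lambda>h. of_real (u \<bullet> h))"
    by (rule frechet_derivative_at[symmetric]) (auto intro!: derivative_eq_intros)
  have 2: "refl_quotient \<alpha> (\<lambda>x. of_real (u \<bullet> x)) x = of_real (2 * (\<alpha> \<bullet> u) / (\<alpha> \<bullet> \<alpha>))"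
    if "\<alpha> \<in> P" for \<alpha>
    using refl_quotient_eq[OF P_nonzero[OF that] has_refl_quotient_inner[of \<alpha> u]] by simp
  have "T \<xi> (\<lambda>x. f x * of_real (u \<bullet> x)) x = T \<xi> f x * of_real (u \<bullet> x) + f x * of_real (u \<bullet> \<xi>)
     + (\<Sum>\<alpha>\<in>P. of_real (\<kappa> \<alpha> * (\<alpha> \<bullet> \<xi>)) * (f (refl_along \<alpha> x) * of_real (2 * (\<alpha> \<bullet> u) / (\<alpha> \<bullet> \<alpha>))))"
    by (subst T_mult[OF assms dunkl_regular_inner]) (simp add: 1 2)
  also have "(\<lambda>x. f x * of_real (u \<bullet> x)) = (\<lambda>x. of_real (u \<bullet> x) * f x)" by (simp add: mult.commute)
  finally show "T \<xi> (\<lambda>x. of_real (u \<bullet> x) * f x) x = of_real (u \<bullet> x) * T \<xi> f x + of_real (u \<bullet> \<xi>) * f x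
     + (\<Sum>\<alpha>\<in>P. of_real (2 * \<kappa> \<alpha> / (\<alpha> \<bullet> \<alpha>) * (\<alpha> \<bullet> \<xi>) * (\<alpha> \<bullet> u)) * f (refl_along \<alpha> x))"
    by (simp add: algebra_simps)
qed

lemma T_refl:
  assumes "dunkl_regular f" "\<beta> \<in> R"
  shows "T \<xi> (\<lambda>x. f (refl_along \<beta> x)) = (\<lambda>x. T (refl_along \<beta> \<xi>) f (refl_along \<beta> x))"
proof
  fix x
  define \<phi> where "\<phi> \<alpha> = of_real (\<kappa> \<alpha> * (\<alpha> \<bullet> refl_along \<beta> \<xi>)) * refl_quotient \<alpha> f (refl_along \<beta> x)" for \<alpha>
  \<comment> \<open>The inner product with \<alpha> and the difference quotient are both odd in
    \<alpha>, so each summand is even and \<open>sum_P_refl\<close> applies.\<close>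
  have neg: "\<phi> (- \<alpha>) = \<phi> \<alpha>" if "\<alpha> \<in> R" for \<alpha>
  proof -
    have "has_refl_quotient (- \<alpha>) f (\<lambda>x. - refl_quotient \<alpha> f x)"
      using dunkl_regular_quotient[OF assms(1) root_nonzero[OF that]]
      by (auto simp: has_refl_quotient_def intro: continuous_intros)
    thus ?thesis using refl_quotient_eq[of "- \<alpha>" f] root_nonzero[OF that]
      by (auto simp: \<phi>_def \<kappa>_uminus that)
  qed
  have q: "refl_quotient \<alpha> (\<lambda>x. f (refl_along \<beta> x)) = (\<lambda>x. refl_quotient (refl_along \<beta> \<alpha>) f (refl_along \<beta> x))"
    if "\<alpha> \<in> P" for \<alpha>
    using P_nonzero[OF that] by (intro refl_quotient_eq has_refl_quotient_refl dunkl_regular_quotient assms) auto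
  have d: "((\<lambda>x. f (refl_along \<beta> x)) has_derivative
      (\<lambda>h. frechet_derivative f (at (refl_along \<beta> x)) (refl_along \<beta> h))) (at x)"
    by (rule has_derivative_compose[OF has_derivative_refl_along dunkl_regular_derivative[OF assms(1)]])
  have "(\<Sum>\<alpha>\<in>P. of_real (\<kappa> \<alpha> * (\<alpha> \<bullet> \<xi>)) * refl_quotient \<alpha> (\<lambda>x. f (refl_along \<beta> x)) x)
     = (\<Sum>\<alpha>\<in>P. \<phi> (refl_along \<beta> \<alpha>))"
    using q assms(2) by (intro sum.cong) (auto simp: \<phi>_def \<kappa>_refl P_in_R)
  also have "\<dots> = (\<Sum>\<alpha>\<in>P. \<phi> \<alpha>)"
    using neg by (intro sum_P_refl assms(2))
  finally show "T \<xi> (\<lambda>x. f (refl_along \<beta> x)) x = T (refl_along \<beta> \<xi>) f (refl_along \<beta> x)"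
    by (simp add: dunkl_op_def frechet_derivative_at[OF d, symmetric] \<phi>_def)
qed

end

section \<open>Homogeneous polynomials\<close>

text \<open>The number \<open>B\<close> bounds the projective tensor norm of \<open>f\<close>, the least \<open>\<Sum>\<bar>c\<^sub>k\<bar>\<close> over all
  ways to write \<open>f\<close> as a combination of products of \<open>n\<close> linear forms of norm at most 1.\<close>

inductive bpoly :: "nat \<Rightarrow> real \<Rightarrow> (real ^ 'n \<Rightarrow> complex) \<Rightarrow> bool" where
  const: "norm c \<le> B \<Longrightarrow> bpoly 0 B (\<lambda>x. c)"
| inner_mult: "bpoly n B f \<Longrightarrow> norm u * B \<le> B' \<Longrightarrow> bpoly (Suc n) B' (\<lambda>x. of_real (u \<bullet> x) * f x)"
| add: "bpoly n B f \<Longrightarrow> bpoly n B' g \<Longrightarrow> bpoly n (B + B') (\<lambda>x. f x + g x)"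
| cmult: "bpoly n B f \<Longrightarrow> norm c * B \<le> B' \<Longrightarrow> bpoly n B' (\<lambda>x. c * f x)"

lemma bpoly_nonneg: "bpoly n B f \<Longrightarrow> 0 \<le> B"
proof (induction rule: bpoly.induct)
  case (const c B) thus ?case using norm_ge_zero order_trans by blast
next
  case (inner_mult n B f u B')
  hence "0 \<le> norm u * B" by simp
  thus ?case using inner_mult by linarith
next
  case (cmult n B f c B')
  hence "0 \<le> norm c * B" by simp
  thus ?case using cmult by linarith
qed auto

lemma bpoly_mono:
  assumes "bpoly n B f" "B \<le> B'"
  shows "bpoly n B' f"
  using bpoly.cmult[OF assms(1), of 1 B'] assms(2) by simp

text \<open>The zero function counts as homogeneous of every degree: multiply by the linear form
  with u = 0.\<close>

lemma bpoly_zero: "0 \<le> B \<Longrightarrow> bpoly n B (\<lambda>x. 0)"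
proof (induction n arbitrary: B)
  case 0 thus ?case using bpoly.const[of 0 B] by simp
next
  case (Suc n)
  show ?case using bpoly.inner_mult[OF Suc.IH[OF Suc.prems], of 0 B] Suc.prems by simp
qed

lemma bpoly_sum:
  assumes "\<And>i. i \<in> I \<Longrightarrow> bpoly n (B i) (f i)"
  shows "bpoly n (\<Sum>i\<in>I. B i) (\<lambda>x. \<Sum>i\<in>I. f i x)"
  using assms by (induction I rule: infinite_finite_induct) (auto simp: bpoly_zero bpoly.add)

lemma bpoly_norm: "bpoly n B f \<Longrightarrow> norm (f x) \<le> B * norm x ^ n"
proof (induction rule: bpoly.induct)
  case (inner_mult n B f u B')
  have "norm (of_real (u \<bullet> x) * f x) \<le> (norm u * norm x) * (B * norm x ^ n)"
    unfolding norm_mult using inner_mult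
    by (intro mult_mono) (auto simp: Cauchy_Schwarz_ineq2)
  also have "\<dots> = (norm u * B) * norm x ^ Suc n" by simp
  also have "\<dots> \<le> B' * norm x ^ Suc n"
    using inner_mult by (intro mult_right_mono) auto
  finally show ?case .
next
  case (add n B f B' g)
  thus ?case using norm_triangle_ineq[of "f x" "g x"] by (simp add: algebra_simps)
next
  case (cmult n B f c B')
  have "norm (c * f x) \<le> norm c * (B * norm x ^ n)"
    unfolding norm_mult using cmult by (intro mult_left_mono) auto
  also have "\<dots> = (norm c * B) * norm x ^ n" by simp
  also have "\<dots> \<le> B' * norm x ^ n"
    using cmult by (intro mult_right_mono) auto
  finally show ?case .
qed auto

lemma bpoly_bound_zero:
  assumes "bpoly n 0 f" shows "f = (\<lambda>x. 0)"
  using bpoly_norm[OF assms] by (auto simp: fun_eq_iff)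

text \<open>Composition with \<open>g\<close> replaces the vector of each linear factor by its image
  under the adjoint, whose norm is not larger.\<close>

lemma bpoly_orthogonal:
  assumes "orthogonal_transformation g"
  shows "bpoly n B f \<Longrightarrow> bpoly n B (\<lambda>x. f (g x))"
proof (induction rule: bpoly.induct)
  case (inner_mult n B f u B')
  have lin: "linear g" using assms by (rule orthogonal_transformation_linear)
  have ii: "v \<bullet> g x = adjoint g v \<bullet> x" for v x
    using adjoint_works[OF lin, of x v] by (simp add: inner_commute)
  have "norm (adjoint g u) * norm (adjoint g u) = u \<bullet> g (adjoint g u)"
    by (metis ii power2_norm_eq_inner power2_eq_square)
  also have "\<dots> \<le> norm u * norm (adjoint g u)"
    using norm_cauchy_schwarz[of u "g (adjoint g u)"] orthogonal_transformation_norm[OF assms] by simp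
  finally have "norm (adjoint g u) \<le> norm u"
    by (cases "adjoint g u = 0") auto
  hence "norm (adjoint g u) * B \<le> B'"
    using inner_mult bpoly_nonneg by (meson mult_right_mono order_trans)
  thus ?case using bpoly.inner_mult[OF inner_mult.IH, of "adjoint g u" B'] by (simp add: ii)
qed (auto intro: bpoly.intros)

text \<open>By the product rule each of the n linear factors is differentiated once, which accounts
  for \<open>real n\<close>. Euler's identity is carried along because the same induction proves
  it.\<close>

lemma bpoly_derivative:
  assumes "bpoly n B f"
  shows "\<exists>f'. (\<forall>x. (f has_derivative f' x) (at x)) \<and> (\<forall>\<xi>. bpoly (n - 1) (real n * B * norm \<xi>) (\<lambda>x. f' x \<xi>))
     \<and> (\<forall>x. f' x x = of_nat n * f x)"
  using assms
proof (induction rule: bpoly.induct)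
  case (const c B)
  show ?case by (rule exI[of _ "\<lambda>x h. 0"]) (auto intro: bpoly_zero)
next
  case (inner_mult n B f u B')
  then obtain f' where f': "\<And>x. (f has_derivative f' x) (at x)" 
    "\<And>\<xi>. bpoly (n - 1) (real n * B * norm \<xi>) (\<lambda>x. f' x \<xi>)" "\<And>x. f' x x = of_nat n * f x" by blast
  have B: "0 \<le> B" using inner_mult.hyps(1) by (rule bpoly_nonneg)
  show ?case
  proof (intro exI[of _ "\<lambda>x h. of_real (u \<bullet> h) * f x + of_real (u \<bullet> x) * f' x h"] conjI allI)
    fix x
    show "((\<lambda>x. of_real (u \<bullet> x) * f x) has_derivative (\<lambda>h. of_real (u \<bullet> h) * f x + of_real (u \<bullet> x) * f' x h)) (at x)"
      by (auto intro!: derivative_eq_intros f')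
    show "of_real (u \<bullet> x) * f x + of_real (u \<bullet> x) * f' x x = of_nat (Suc n) * (of_real (u \<bullet> x) * f x)"
      by (simp add: f' algebra_simps)
  next
    fix \<xi> :: "real ^ 'a"
    have 1: "bpoly n (norm (u \<bullet> \<xi>) * B) (\<lambda>x. of_real (u \<bullet> \<xi>) * f x)"
      using inner_mult.hyps(1) by (rule bpoly.cmult) simp
    have 2: "bpoly n (norm u * (real n * B * norm \<xi>)) (\<lambda>x. of_real (u \<bullet> x) * f' x \<xi>)"
    proof (cases n)
      \<comment> \<open>Truncated subtraction gives the derivative degree 0 here, so a linear factor
        would raise the degree beyond n; but the bound 0 forces the derivative to vanish.\<close>
      case 0
      have "(\<lambda>x. f' x \<xi>) = (\<lambda>x. 0)"
        using f'(2)[of \<xi>] by (intro bpoly_bound_zero) (auto simp: 0)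
      hence "f' x \<xi> = 0" for x by meson
      thus ?thesis using 0 bpoly_zero[of 0 0] by simp
    next
      case (Suc k)
      thus ?thesis using bpoly.inner_mult[OF f'(2)[of \<xi>] order_refl, of u] by simp
    qed
    have "norm (u \<bullet> \<xi>) * B + norm u * (real n * B * norm \<xi>) \<le> (norm u * norm \<xi>) * B + norm u * (real n * B * norm \<xi>)"
      using B by (intro add_mono mult_right_mono) (auto simp: Cauchy_Schwarz_ineq2)
    also have "\<dots> = (real (Suc n) * norm \<xi>) * (norm u * B)" by (simp add: algebra_simps)
    also have "\<dots> \<le> (real (Suc n) * norm \<xi>) * B'" by (intro mult_left_mono inner_mult.hyps(2)) auto
    also have "\<dots> = real (Suc n) * B' * norm \<xi>" by simp
    finally show "bpoly (Suc n - 1) (real (Suc n) * B' * norm \<xi>) (\<lambda>x. of_real (u \<bullet> \<xi>) * f x + of_real (u \<bullet> x) * f' x \<xi>)"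
      using bpoly_mono[OF bpoly.add[OF 1 2]] by simp
  qed
next
  case (add n B f B' g)
  then obtain f' g' where f': "\<And>x. (f has_derivative f' x) (at x)" 
    "\<And>\<xi>. bpoly (n - 1) (real n * B * norm \<xi>) (\<lambda>x. f' x \<xi>)" "\<And>x. f' x x = of_nat n * f x"
   and g': "\<And>x. (g has_derivative g' x) (at x)" 
    "\<And>\<xi>. bpoly (n - 1) (real n * B' * norm \<xi>) (\<lambda>x. g' x \<xi>)" "\<And>x. g' x x = of_nat n * g x" by blast
  show ?case
  proof (intro exI[of _ "\<lambda>x h. f' x h + g' x h"] conjI allI)
    fix \<xi> :: "real ^ 'a"
    show "bpoly (n - 1) (real n * (B + B') * norm \<xi>) (\<lambda>x. f' x \<xi> + g' x \<xi>)"
      using bpoly.add[OF f'(2) g'(2), of \<xi> \<xi>] by (simp add: algebra_simps)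
  qed (auto intro!: derivative_eq_intros f' g' simp: f'(3) g'(3) algebra_simps)
next
  case (cmult n B f c B')
  then obtain f' where f': "\<And>x. (f has_derivative f' x) (at x)" 
    "\<And>\<xi>. bpoly (n - 1) (real n * B * norm \<xi>) (\<lambda>x. f' x \<xi>)" "\<And>x. f' x x = of_nat n * f x" by blast
  show ?case
  proof (intro exI[of _ "\<lambda>x h. c * f' x h"] conjI allI)
    fix \<xi> :: "real ^ 'a"
    have "norm c * (real n * B * norm \<xi>) = (real n * norm \<xi>) * (norm c * B)" by simp
    also have "\<dots> \<le> (real n * norm \<xi>) * B'" by (intro mult_left_mono cmult.hyps(2)) auto
    also have "\<dots> = real n * B' * norm \<xi>" by simp
    finally show "bpoly (n - 1) (real n * B' * norm \<xi>) (\<lambda>x. c * f' x \<xi>)"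
      by (rule bpoly.cmult[OF f'(2)])
  qed (auto intro!: derivative_eq_intros f' simp: f'(3) algebra_simps)
qed

lemma bpoly_continuous: "bpoly n B f \<Longrightarrow> continuous_on UNIV f"
  using bpoly_derivative by (metis has_derivative_continuous_on has_derivative_at_withinI)

text \<open>Same counting as for the derivative: the quotient of a linear form is the constant
  \<open>2 * (\<alpha> \<bullet> u) / (\<alpha> \<bullet> \<alpha>)\<close>, of modulus at most
  \<open>2 / norm \<alpha> * norm u\<close>, and it replaces one linear factor at a time.\<close>

lemma bpoly_quotient:
  assumes "\<alpha> \<noteq> 0" "bpoly n B f"
  shows "\<exists>Q. has_refl_quotient \<alpha> f Q \<and> bpoly (n - 1) (2 / norm \<alpha> * real n * B) Q"
  using assms(2)
proof (induction rule: bpoly.induct)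
  case (const c B)
  show ?case by (rule exI[of _ "\<lambda>x. 0"]) (auto intro: bpoly_zero has_refl_quotient_const)
next
  case (inner_mult n B f u B')
  then obtain Q where Q: "has_refl_quotient \<alpha> f Q" "bpoly (n - 1) (2 / norm \<alpha> * real n * B) Q" by blast
  have B: "0 \<le> B" using inner_mult.hyps(1) by (rule bpoly_nonneg)
  let ?a = "2 * (\<alpha> \<bullet> u) / (\<alpha> \<bullet> \<alpha>)"
  define Q' where "Q' x = of_real ?a * f (refl_along \<alpha> x) + of_real (u \<bullet> x) * Q x" for x
  have 1: "bpoly n (\<bar>?a\<bar> * B) (\<lambda>x. of_real ?a * f (refl_along \<alpha> x))"
    using bpoly_orthogonal[OF orthogonal_transformation_refl_along inner_mult.hyps(1)]
    by (rule bpoly.cmult) (simp only: norm_of_real order_refl)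
  have 2: "bpoly n (norm u * (2 / norm \<alpha> * real n * B)) (\<lambda>x. of_real (u \<bullet> x) * Q x)"
  proof (cases n)
    case 0
    have "Q = (\<lambda>x. 0)"
      using Q(2) by (intro bpoly_bound_zero) (auto simp: 0)
    thus ?thesis using 0 bpoly_zero[of 0 0] by simp
  next
    case (Suc k)
    thus ?thesis using bpoly.inner_mult[OF Q(2) order_refl, of u] by simp
  qed
  have "\<bar>\<alpha> \<bullet> u\<bar> \<le> norm \<alpha> * norm u" by (rule Cauchy_Schwarz_ineq2)
  hence "\<bar>?a\<bar> \<le> 2 / norm \<alpha> * norm u"
    using assms(1) by (simp add: field_simps abs_mult power2_eq_square flip: power2_norm_eq_inner)
  hence "\<bar>?a\<bar> * B + norm u * (2 / norm \<alpha> * real n * B) \<le> (2 / norm \<alpha> * norm u) * B + norm u * (2 / norm \<alpha> * real n * B)"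
    using B by (intro add_mono mult_right_mono) auto
  also have "\<dots> = (2 / norm \<alpha> * real (Suc n)) * (norm u * B)"
    by (simp add: algebra_simps add_divide_distrib)
  also have "\<dots> \<le> (2 / norm \<alpha> * real (Suc n)) * B'" by (intro mult_left_mono inner_mult.hyps(2)) auto
  finally have b: "bpoly n (2 / norm \<alpha> * real (Suc n) * B') Q'"
    unfolding Q'_def using bpoly_mono[OF bpoly.add[OF 1 2]] by simp
  have "of_real (u \<bullet> x) * f x - of_real (u \<bullet> refl_along \<alpha> x) * f (refl_along \<alpha> x) = of_real (\<alpha> \<bullet> x) * Q' x" for x
  proof -
    have "of_real (u \<bullet> x) * f x - of_real (u \<bullet> refl_along \<alpha> x) * f (refl_along \<alpha> x)
       = of_real (u \<bullet> x) * (f x - f (refl_along \<alpha> x)) + of_real (u \<bullet> x - u \<bullet> refl_along \<alpha> x) * f (refl_along \<alpha> x)"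
      by (simp add: algebra_simps)
    also have "u \<bullet> x - u \<bullet> refl_along \<alpha> x = ?a * (\<alpha> \<bullet> x)"
      by (simp add: refl_along_def inner_diff_right inner_commute)
    finally show ?thesis by (simp add: Q'_def has_refl_quotientD[OF Q(1)] algebra_simps)
  qed
  hence "has_refl_quotient \<alpha> (\<lambda>x. of_real (u \<bullet> x) * f x) Q'"
    unfolding has_refl_quotient_def using bpoly_continuous[OF b] by simp
  thus ?case using b by auto
next
  case (add n B f B' g)
  then obtain Q Q' where Q: "has_refl_quotient \<alpha> f Q" "bpoly (n - 1) (2 / norm \<alpha> * real n * B) Q"
   and Q': "has_refl_quotient \<alpha> g Q'" "bpoly (n - 1) (2 / norm \<alpha> * real n * B') Q'" by blast
  show ?case
    using has_refl_quotient_add[OF Q(1) Q'(1)] bpoly.add[OF Q(2) Q'(2)]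
    by (intro exI[of _ "\<lambda>x. Q x + Q' x"]) (simp add: ring_distribs)
next
  case (cmult n B f c B')
  then obtain Q where Q: "has_refl_quotient \<alpha> f Q" "bpoly (n - 1) (2 / norm \<alpha> * real n * B) Q" by blast
  have "norm c * (2 / norm \<alpha> * real n * B) = (2 / norm \<alpha> * real n) * (norm c * B)" by simp
  also have "\<dots> \<le> (2 / norm \<alpha> * real n) * B'" by (intro mult_left_mono cmult.hyps(2)) auto
  finally have "bpoly (n - 1) (2 / norm \<alpha> * real n * B') (\<lambda>x. c * Q x)"
    by (rule bpoly.cmult[OF Q(2)])
  moreover have "has_refl_quotient \<alpha> (\<lambda>x. c * f x) (\<lambda>x. c * Q x)"
    using Q(1) unfolding has_refl_quotient_def
    by (auto intro!: continuous_intros simp flip: right_diff_distrib)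
  ultimately show ?case by blast
qed

definition hpoly :: "nat \<Rightarrow> (real ^ 'n \<Rightarrow> complex) \<Rightarrow> bool" where
  "hpoly n f \<longleftrightarrow> (\<exists>B. bpoly n B f)"

lemma hpoly_const: "hpoly 0 (\<lambda>x. c)"
  and hpoly_inner_mult: "hpoly n f \<Longrightarrow> hpoly (Suc n) (\<lambda>x. of_real (u \<bullet> x) * f x)"
  and hpoly_add: "hpoly n f \<Longrightarrow> hpoly n g \<Longrightarrow> hpoly n (\<lambda>x. f x + g x)"
  and hpoly_cmult: "hpoly n f \<Longrightarrow> hpoly n (\<lambda>x. c * f x)"
  and hpoly_zero: "hpoly n (\<lambda>x. 0)"
  and hpoly_refl: "hpoly n f \<Longrightarrow> hpoly n (\<lambda>x. f (refl_along \<alpha> x))"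
  unfolding hpoly_def
  by (blast intro: bpoly.intros bpoly_zero bpoly_orthogonal[OF orthogonal_transformation_refl_along])+

lemma hpoly_sum: "(\<And>i. i \<in> I \<Longrightarrow> hpoly n (f i)) \<Longrightarrow> hpoly n (\<lambda>x. \<Sum>i\<in>I. f i x)"
  by (induction I rule: infinite_finite_induct) (auto intro: hpoly_zero hpoly_add)

lemma hpoly_diff: "hpoly n f \<Longrightarrow> hpoly n g \<Longrightarrow> hpoly n (\<lambda>x. f x - g x)"
  using hpoly_add[OF _ hpoly_cmult, of n f g "-1"] by simp

lemma hpoly_induct [consumes 1, case_names const inner_mult add cmult]:
  assumes "hpoly n f" "\<And>c. Q 0 (\<lambda>x. c)"
    "\<And>n f u. hpoly n f \<Longrightarrow> Q n f \<Longrightarrow> Q (Suc n) (\<lambda>x. of_real (u \<bullet> x) * f x)"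
    "\<And>n f g. hpoly n f \<Longrightarrow> hpoly n g \<Longrightarrow> Q n f \<Longrightarrow> Q n g \<Longrightarrow> Q n (\<lambda>x. f x + g x)"
    "\<And>n f c. hpoly n f \<Longrightarrow> Q n f \<Longrightarrow> Q n (\<lambda>x. c * f x)"
  shows "Q n f"
proof -
  obtain B where "bpoly n B f" using assms(1) hpoly_def by blast
  thus ?thesis
    by (induction rule: bpoly.induct) (auto intro!: assms(2-) simp: hpoly_def)
qed

lemma hpoly_regular:
  assumes "hpoly n f" shows "dunkl_regular f"
proof -
  obtain B where B: "bpoly n B f" using assms hpoly_def by blast
  have "f differentiable at x" for x
    using bpoly_derivative[OF B] by (auto simp: differentiable_def)
  moreover have "\<exists>Q. has_refl_quotient \<alpha> f Q" if "\<alpha> \<noteq> 0" for \<alpha>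
    using bpoly_quotient[OF that B] by blast
  ultimately show ?thesis by (rule dunkl_regularI)
qed

lemma hpoly_euler:
  assumes "hpoly n f" shows "frechet_derivative f (at x) x = of_nat n * f x"
proof -
  obtain B where B: "bpoly n B f" using assms hpoly_def by blast
  thus ?thesis using bpoly_derivative[OF B] frechet_derivative_at by metis
qed

lemma hpoly_frechet_derivative:
  assumes "hpoly n f" shows "hpoly (n - 1) (\<lambda>x. frechet_derivative f (at x) \<xi>)"
proof -
  obtain B where B: "bpoly n B f" using assms hpoly_def by blast
  obtain f' where f': "\<And>x. (f has_derivative f' x) (at x)" "\<And>\<xi>. bpoly (n - 1) (real n * B * norm \<xi>) (\<lambda>x. f' x \<xi>)"
    using bpoly_derivative[OF B] by blast
  have "(\<lambda>x. frechet_derivative f (at x) \<xi>) = (\<lambda>x. f' x \<xi>)"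
    by (rule ext) (simp add: frechet_derivative_at[OF f'(1), symmetric])
  thus ?thesis using f'(2) unfolding hpoly_def by metis
qed

lemma hpoly_refl_quotient:
  assumes "hpoly n f" "\<alpha> \<noteq> 0" shows "hpoly (n - 1) (refl_quotient \<alpha> f)"
  using assms bpoly_quotient refl_quotient_eq unfolding hpoly_def by metis

section \<open>Dunkl operators on homogeneous polynomials\<close>

context dunkl begin

lemma hpoly_T: "hpoly n f \<Longrightarrow> hpoly (n - 1) (T \<xi> f)"
  unfolding dunkl_op_def
  by (intro hpoly_add hpoly_frechet_derivative hpoly_sum hpoly_cmult hpoly_refl_quotient P_nonzero)

text \<open>With the direction equal to the base point, the factor
  \<open>\<alpha> \<bullet> x\<close> cancels the denominator of the quotient.\<close>

lemma T_euler: "T x f x = frechet_derivative f (at x) x + (\<Sum>\<alpha>\<in>P. of_real (\<kappa> \<alpha>) * (f x - f (refl_along \<alpha> x)))"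
  unfolding dunkl_op_def
  by (simp add: mult.assoc inner_mult_refl_quotient)

lemma T_hpoly_euler:
  assumes "hpoly n f"
  shows "T x f x = of_nat n * f x + (\<Sum>\<alpha>\<in>P. of_real (\<kappa> \<alpha>) * (f x - f (refl_along \<alpha> x)))"
  by (simp add: T_euler hpoly_euler[OF assms])

lemma T_hpoly_0: "hpoly 0 f \<Longrightarrow> T \<xi> f = (\<lambda>x. 0)"
proof -
  assume "hpoly 0 f"
  then obtain c where "f = (\<lambda>x. c)"
  proof -
    have "\<exists>c. f = (\<lambda>x. c)" if "hpoly n f" "n = 0" for n f
      using that by (induction rule: hpoly_induct) auto
    thus thesis using that \<open>hpoly 0 f\<close> by blast
  qed
  thus ?thesis by simp
qed

text \<open>All terms on the right but the first are symmetric in \<open>\<xi>\<close> and \<open>\<eta>\<close> when taken together.\<close>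

lemma T_T_inner_mult:
  assumes "hpoly n f"
  shows "T \<eta> (T \<xi> (\<lambda>x. of_real (u \<bullet> x) * f x)) x = of_real (u \<bullet> x) * T \<eta> (T \<xi> f) x
    + of_real (u \<bullet> \<eta>) * T \<xi> f x + of_real (u \<bullet> \<xi>) * T \<eta> f x
    + (\<Sum>\<alpha>\<in>P. of_real (2 * \<kappa> \<alpha> / (\<alpha> \<bullet> \<alpha>) * (\<alpha> \<bullet> u)) *
        (of_real (\<alpha> \<bullet> \<eta>) * T \<xi> f (refl_along \<alpha> x) + of_real (\<alpha> \<bullet> \<xi>) * T \<eta> f (refl_along \<alpha> x)
         - of_real (2 * (\<alpha> \<bullet> \<xi>) * (\<alpha> \<bullet> \<eta>) / (\<alpha> \<bullet> \<alpha>)) * T \<alpha> f (refl_along \<alpha> x)))"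
proof -
  note reg = hpoly_regular[OF assms] and regT = hpoly_regular[OF hpoly_T[OF assms]]
  define c :: "real ^ 'n \<Rightarrow> complex"
    where "c \<alpha> = of_real (2 * \<kappa> \<alpha> / (\<alpha> \<bullet> \<alpha>) * (\<alpha> \<bullet> \<xi>) * (\<alpha> \<bullet> u))" for \<alpha>
  have "T \<eta> (T \<xi> (\<lambda>x. of_real (u \<bullet> x) * f x)) x
    = T \<eta> (\<lambda>x. of_real (u \<bullet> x) * T \<xi> f x + of_real (u \<bullet> \<xi>) * f x
        + (\<Sum>\<alpha>\<in>P. c \<alpha> * f (refl_along \<alpha> x))) x"
    by (simp only: T_inner_mult[OF reg] c_def)
  also have "\<dots> = T \<eta> (\<lambda>x. of_real (u \<bullet> x) * T \<xi> f x) x + of_real (u \<bullet> \<xi>) * T \<eta> f x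
      + (\<Sum>\<alpha>\<in>P. c \<alpha> * T \<eta> (\<lambda>x. f (refl_along \<alpha> x)) x)"
    by (simp add: T_add T_sum T_cmult dunkl_regular_add dunkl_regular_sum
        dunkl_regular_cmult dunkl_regular_refl dunkl_regular_mult dunkl_regular_inner reg regT)
  also have "(\<Sum>\<alpha>\<in>P. c \<alpha> * T \<eta> (\<lambda>x. f (refl_along \<alpha> x)) x)
     = (\<Sum>\<alpha>\<in>P. c \<alpha> * (T \<eta> f (refl_along \<alpha> x) - of_real (2 * (\<alpha> \<bullet> \<eta>) / (\<alpha> \<bullet> \<alpha>)) * T \<alpha> f (refl_along \<alpha> x)))"
    by (intro sum.cong refl) (simp add: T_refl P_in_R reg T_refl_dir)
  finally show ?thesis
    by (simp add: T_inner_mult regT algebra_simps sum.distrib sum_subtractf c_def)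
qed

lemma T_commute:
  assumes "hpoly n f" shows "T \<eta> (T \<xi> f) = T \<xi> (T \<eta> f)"
  using assms
proof (induction rule: hpoly_induct)
  case (inner_mult n f u)
  show ?case
  proof
    fix x
    show "T \<eta> (T \<xi> (\<lambda>x. of_real (u \<bullet> x) * f x)) x = T \<xi> (T \<eta> (\<lambda>x. of_real (u \<bullet> x) * f x)) x"
      unfolding T_T_inner_mult[OF inner_mult.hyps] inner_mult.IH
      by (simp add: algebra_simps)
  qed
qed (auto simp: T_add T_cmult hpoly_regular hpoly_T[THEN hpoly_regular])

section \<open>Homogeneous parts of the Dunkl kernel\<close>

text \<open>A finite group that contains all products of reflections in roots. By the last condition
  its elements act trivially on the orthogonal complement of \<open>span R\<close>, which keeps the
  group finite when the roots do not span the space.\<close>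

definition sym_group :: "(real ^ 'n \<Rightarrow> real ^ 'n) set" where
  "sym_group = {g. orthogonal_transformation g \<and> g ` R = R \<and> (\<forall>x. g x - x \<in> span R)}"

lemma sym_groupD:
  assumes "g \<in> sym_group"
  shows "orthogonal_transformation g" "g ` R = R" "g x - x \<in> span R"
  using assms by (simp_all add: sym_group_def)

text \<open>An element is determined by the permutation of \<open>R\<close> that it induces.\<close>

lemma finite_sym_group: "finite sym_group"
proof -
  have "inj_on (\<lambda>g. restrict g R) sym_group"
  proof (rule inj_onI)
    fix g h assume gh: "g \<in> sym_group" "h \<in> sym_group" and eq: "restrict g R = restrict h R"
    note g = sym_groupD[OF gh(1)] and h = sym_groupD[OF gh(2)]
    have og: "g x \<bullet> g y = x \<bullet> y" and oh: "h x \<bullet> h y = x \<bullet> y" for x y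
      using g(1) h(1) by (simp_all add: orthogonal_transformation_def)
    show "g = h"
    proof
      fix x
      \<comment> \<open>The difference lies in \<open>span R\<close> and is orthogonal to every
        root, hence to itself.\<close>
      have sp: "g x - h x \<in> span R"
        using span_diff[OF g(3)[of x] h(3)[of x]] by simp
      have "orthogonal (g x - h x) \<beta>" if "\<beta> \<in> R" for \<beta>
      proof -
        have "\<beta> \<in> g ` R" using that by (simp only: g(2))
        then obtain b where b: "\<beta> = g b" "b \<in> R" by (rule imageE)
        have "g b = h b" using fun_cong[OF eq, of b] b(2) by simp
        thus ?thesis using og[of x b] oh[of x b] b(1) by (simp add: orthogonal_def inner_diff_left)
      qed
      hence "orthogonal (g x - h x) (g x - h x)"
        using orthogonal_to_span[OF sp] by blast
      thus "g x = h x" by (simp add: orthogonal_def)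
    qed
  qed
  moreover have "(\<lambda>g. restrict g R) ` sym_group \<subseteq> R \<rightarrow>\<^sub>E R"
    using sym_groupD(2) by fastforce
  moreover have "finite (R \<rightarrow>\<^sub>E R)" using finite_R by (intro finite_PiE)
  ultimately show ?thesis by (rule inj_on_finite)
qed

lemma id_sym_group: "id \<in> sym_group"
  using orthogonal_transformation_id by (simp add: sym_group_def span_zero id_def)

lemma sym_group_refl:
  assumes "g \<in> sym_group" "\<alpha> \<in> R" shows "g \<circ> refl_along \<alpha> \<in> sym_group"
  unfolding sym_group_def mem_Collect_eq
proof (intro conjI allI)
  have g: "orthogonal_transformation g" "g ` R = R" "\<And>x. g x - x \<in> span R"
    using assms(1) by (auto simp: sym_group_def)
  show "orthogonal_transformation (g \<circ> refl_along \<alpha>)"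
    by (intro orthogonal_transformation_compose g orthogonal_transformation_refl_along)
  have "refl_along \<alpha> ` R = R" using root assms(2) by (simp add: reduced_root_system_def)
  thus "(g \<circ> refl_along \<alpha>) ` R = R" using g(2) by (metis image_comp)
  fix x
  have "refl_along \<alpha> x - x \<in> span R"
    using span_neg[OF span_scale[OF span_base[OF assms(2)]]] by (simp add: refl_along_def)
  hence "(g (refl_along \<alpha> x) - refl_along \<alpha> x) + (refl_along \<alpha> x - x) \<in> span R"
    by (intro span_add g)
  thus "(g \<circ> refl_along \<alpha>) x - x \<in> span R" by simp
qed

lemma sum_sym_group_refl:
  assumes "\<alpha> \<in> R" shows "(\<Sum>g\<in>sym_group. \<phi> (g \<circ> refl_along \<alpha>)) = (\<Sum>g\<in>sym_group. \<phi> g)"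
  by (rule sum.reindex_bij_witness[where i = "\<lambda>g. g \<circ> refl_along \<alpha>" and j = "\<lambda>g. g \<circ> refl_along \<alpha>"])
     (auto simp: sym_group_refl assms comp_assoc)

text \<open>The operator \<open>s + \<Sum>\<kappa>\<^sub>\<alpha>(1 - r\<^sub>\<alpha>)\<close> is inverted by the Neumann series of \<open>\<Sum>\<kappa>\<^sub>\<alpha>r\<^sub>\<alpha>\<close>; collecting
  its terms by group elements gives nonnegative weights.\<close>

primrec walk :: "nat \<Rightarrow> (real ^ 'n \<Rightarrow> real ^ 'n) \<Rightarrow> real" where
  "walk 0 g = of_bool (g = id)"
| "walk (Suc k) g = (\<Sum>\<alpha>\<in>P. \<kappa> \<alpha> * walk k (g \<circ> refl_along \<alpha>))"

definition weight :: "real \<Rightarrow> (real ^ 'n \<Rightarrow> real ^ 'n) \<Rightarrow> real" where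
  "weight s g = (\<Sum>k. walk k g / (s + \<gamma>) ^ Suc k)"

definition resolvent :: "real \<Rightarrow> (real ^ 'n \<Rightarrow> complex) \<Rightarrow> real ^ 'n \<Rightarrow> complex" where
  "resolvent s q x = (\<Sum>g\<in>sym_group. of_real (weight s g) * q (g x))"

lemma walk_bounds: "0 \<le> walk k g \<and> walk k g \<le> \<gamma> ^ k"
proof (induction k arbitrary: g)
  case (Suc k)
  have "walk (Suc k) g \<le> (\<Sum>\<alpha>\<in>P. \<kappa> \<alpha> * \<gamma> ^ k)"
    using Suc by (auto intro!: sum_mono mult_left_mono \<kappa>_nonneg P_in_R)
  also have "\<dots> = \<gamma> ^ Suc k" by (simp add: \<gamma>_def sum_distrib_right)
  finally show ?case using Suc by (auto intro!: sum_nonneg mult_nonneg_nonneg \<kappa>_nonneg P_in_R)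
qed auto

section \<open>The inverse of the Euler operator and its norm\<close>

context
  fixes s :: real assumes s: "s > 0"
begin

text \<open>\<open>walk k g\<close> is at most \<open>\<gamma> ^ k\<close>, and the ratio
  \<open>\<gamma> / (s + \<gamma>)\<close> is below 1 because s is positive.\<close>

lemma summable_walk: "summable (\<lambda>k. walk k g / (s + \<gamma>) ^ Suc k)"
proof (rule summable_comparison_test')
  have "\<bar>\<gamma> / (s + \<gamma>)\<bar> < 1" using s \<gamma>_nonneg by simp
  thus "summable (\<lambda>k. (\<gamma> / (s + \<gamma>)) ^ k * (1 / (s + \<gamma>)))"
    by (intro summable_mult2 summable_geometric) simp
  fix k
  show "norm (walk k g / (s + \<gamma>) ^ Suc k) \<le> (\<gamma> / (s + \<gamma>)) ^ k * (1 / (s + \<gamma>))"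
    using walk_bounds[of k g] s \<gamma>_nonneg
    by (simp add: power_divide mult.commute frac_le)
qed

text \<open>Splitting off the term k = 0 of the Neumann series leaves series whose walks take one
  more step.\<close>

lemma weight_eq: "(s + \<gamma>) * weight s g = of_bool (g = id) + (\<Sum>\<alpha>\<in>P. \<kappa> \<alpha> * weight s (g \<circ> refl_along \<alpha>))"
proof -
  have pos: "s + \<gamma> > 0" using s \<gamma>_nonneg by simp
  have "weight s g = walk 0 g / (s + \<gamma>) ^ Suc 0 + (\<Sum>k. walk (Suc k) g / (s + \<gamma>) ^ Suc (Suc k))"
    unfolding weight_def by (subst suminf_split_head[OF summable_walk]) simp
  also have "(\<Sum>k. walk (Suc k) g / (s + \<gamma>) ^ Suc (Suc k))
     = (\<Sum>k. \<Sum>\<alpha>\<in>P. \<kappa> \<alpha> / (s + \<gamma>) * (walk k (g \<circ> refl_along \<alpha>) / (s + \<gamma>) ^ Suc k))"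
    by (simp add: sum_divide_distrib)
  also have "\<dots> = (\<Sum>\<alpha>\<in>P. \<Sum>k. \<kappa> \<alpha> / (s + \<gamma>) * (walk k (g \<circ> refl_along \<alpha>) / (s + \<gamma>) ^ Suc k))"
    by (intro suminf_sum summable_mult summable_walk)
  also have "\<dots> = (\<Sum>\<alpha>\<in>P. \<kappa> \<alpha> / (s + \<gamma>) * weight s (g \<circ> refl_along \<alpha>))"
    unfolding weight_def by (intro sum.cong refl suminf_mult summable_walk)
  finally show ?thesis
    using pos by (simp add: distrib_left sum_distrib_left)
qed

lemma weight_nonneg: "0 \<le> weight s g"
  unfolding weight_def using walk_bounds s \<gamma>_nonneg
  by (intro suminf_nonneg summable_walk divide_nonneg_nonneg zero_le_power) auto

text \<open>Sum \<open>weight_eq\<close> over the group: right multiplication by a reflection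
  permutes the group, so the total W satisfies (s + \<gamma>) W = 1 + \<gamma> W.\<close>

lemma sum_weight: "(\<Sum>g\<in>sym_group. weight s g) = 1 / s"
proof -
  let ?W = "\<Sum>g\<in>sym_group. weight s g"
  have "(s + \<gamma>) * ?W = (\<Sum>g\<in>sym_group. of_bool (g = id)) + (\<Sum>g\<in>sym_group. \<Sum>\<alpha>\<in>P. \<kappa> \<alpha> * weight s (g \<circ> refl_along \<alpha>))"
    by (simp add: sum_distrib_left weight_eq sum.distrib)
  also have "(\<Sum>g\<in>sym_group. of_bool (g = id)) = (1 :: real)"
    using id_sym_group finite_sym_group by (simp add: of_bool_def sum.delta)
  also have "(\<Sum>g\<in>sym_group. \<Sum>\<alpha>\<in>P. \<kappa> \<alpha> * weight s (g \<circ> refl_along \<alpha>)) = (\<Sum>\<alpha>\<in>P. \<kappa> \<alpha> * ?W)"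
  proof (subst sum.swap, rule sum.cong[OF refl])
    fix \<alpha> assume "\<alpha> \<in> P"
    show "(\<Sum>g\<in>sym_group. \<kappa> \<alpha> * weight s (g \<circ> refl_along \<alpha>)) = \<kappa> \<alpha> * ?W"
      unfolding sum_distrib_left[symmetric] sum_sym_group_refl[OF P_in_R[OF \<open>\<alpha> \<in> P\<close>]] ..
  qed
  also have "\<dots> = \<gamma> * ?W" by (simp add: \<gamma>_def sum_distrib_right)
  finally show ?thesis using s by (simp add: field_simps)
qed

lemma resolvent_eq:
  "of_real (s + \<gamma>) * resolvent s q x - (\<Sum>\<alpha>\<in>P. of_real (\<kappa> \<alpha>) * resolvent s q (refl_along \<alpha> x)) = q x"
proof -
  have "of_real (s + \<gamma>) * resolvent s q x = (\<Sum>g\<in>sym_group. of_real ((s + \<gamma>) * weight s g) * q (g x))"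
    by (simp add: resolvent_def sum_distrib_left mult.assoc)
  also have "\<dots> = (\<Sum>g\<in>sym_group. of_bool (g = id) * q (g x))
      + (\<Sum>g\<in>sym_group. \<Sum>\<alpha>\<in>P. of_real (\<kappa> \<alpha>) * (of_real (weight s (g \<circ> refl_along \<alpha>)) * q (g x)))"
  proof -
    have "complex_of_real (of_bool b) = of_bool b" for b by (cases b) auto
    thus ?thesis
      unfolding weight_eq by (simp add: distrib_right sum.distrib sum_distrib_right mult.assoc)
  qed
  also have "(\<Sum>g\<in>sym_group. of_bool (g = id) * q (g x)) = q x"
  proof -
    have "(\<Sum>g\<in>sym_group. of_bool (g = id) * q (g x)) = (\<Sum>g\<in>sym_group. if g = id then q (g x) else 0)"
      by (intro sum.cong) auto
    thus ?thesis using id_sym_group finite_sym_group by (simp add: sum.delta)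
  qed
  also have "(\<Sum>g\<in>sym_group. \<Sum>\<alpha>\<in>P. of_real (\<kappa> \<alpha>) * (of_real (weight s (g \<circ> refl_along \<alpha>)) * q (g x)))
     = (\<Sum>\<alpha>\<in>P. of_real (\<kappa> \<alpha>) * resolvent s q (refl_along \<alpha> x))"
  proof (subst sum.swap, rule sum.cong[OF refl])
    fix \<alpha> assume "\<alpha> \<in> P"
    have "(\<Sum>g\<in>sym_group. of_real (weight s (g \<circ> refl_along \<alpha>)) * q (g x)) = resolvent s q (refl_along \<alpha> x)"
      unfolding resolvent_def
      using sum_sym_group_refl[OF P_in_R[OF \<open>\<alpha> \<in> P\<close>], of "\<lambda>g. of_real (weight s g) * q (g (refl_along \<alpha> x))"]
      by simp
    thus "(\<Sum>g\<in>sym_group. of_real (\<kappa> \<alpha>) * (of_real (weight s (g \<circ> refl_along \<alpha>)) * q (g x)))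
       = of_real (\<kappa> \<alpha>) * resolvent s q (refl_along \<alpha> x)"
      by (simp flip: sum_distrib_left)
  qed
  finally show ?thesis by simp
qed

text \<open>The resolvent is a nonnegative combination of the functions \<open>q (g x)\<close> of
  total weight 1/s, and orthogonal maps preserve the bound.\<close>

lemma bpoly_resolvent:
  assumes "bpoly n B q" shows "bpoly n (B / s) (resolvent s q)"
proof -
  have "bpoly n (\<Sum>g\<in>sym_group. weight s g * B) (\<lambda>x. \<Sum>g\<in>sym_group. of_real (weight s g) * q (g x))"
  proof (rule bpoly_sum)
    fix g assume "g \<in> sym_group"
    hence "bpoly n B (\<lambda>x. q (g x))" using assms by (auto simp: sym_group_def intro: bpoly_orthogonal)
    thus "bpoly n (weight s g * B) (\<lambda>x. of_real (weight s g) * q (g x))"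
      by (rule bpoly.cmult) (simp add: weight_nonneg)
  qed
  also have "(\<Sum>g\<in>sym_group. weight s g * B) = B / s"
    by (simp add: sum_weight flip: sum_distrib_right)
  finally show ?thesis by (simp add: resolvent_def[abs_def])
qed

end

text \<open>Solves the Euler equation degree by degree, with s equal to the degree under
  construction. Here \<open>y\<close> is real; the factor -i of the theorem enters later as a power
  of a scalar.\<close>

primrec kernel_part :: "real ^ 'n \<Rightarrow> nat \<Rightarrow> real ^ 'n \<Rightarrow> complex" where
  "kernel_part y 0 = (\<lambda>x. 1)"
| "kernel_part y (Suc n) = resolvent (real (Suc n)) (\<lambda>x. of_real (y \<bullet> x) * kernel_part y n x)"

lemma bpoly_kernel_part: "bpoly n (norm y ^ n / fact n) (kernel_part y n)"
proof (induction n)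
  case 0 thus ?case using bpoly.const[of 1 1] by simp
next
  case (Suc n)
  have "bpoly (Suc n) (norm y * (norm y ^ n / fact n) / real (Suc n)) (kernel_part y (Suc n))"
    unfolding kernel_part.simps by (intro bpoly_resolvent bpoly.inner_mult[OF Suc]) auto
  thus ?case by (simp add: field_simps)
qed

lemma hpoly_kernel_part: "hpoly n (kernel_part y n)"
  using bpoly_kernel_part hpoly_def by blast

lemma kernel_part_Suc:
  "of_nat (Suc n) * kernel_part y (Suc n) x
     + (\<Sum>\<alpha>\<in>P. of_real (\<kappa> \<alpha>) * (kernel_part y (Suc n) x - kernel_part y (Suc n) (refl_along \<alpha> x)))
   = of_real (y \<bullet> x) * kernel_part y n x"
  using resolvent_eq[of "real (Suc n)" "\<lambda>x. of_real (y \<bullet> x) * kernel_part y n x" x]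
  by (simp add: \<gamma>_def algebra_simps sum_subtractf sum_distrib_left sum_distrib_right)

text \<open>For the defect \<open>F\<^sub>\<xi> = T\<^sub>\<xi> e\<^sub>n\<^sub>+\<^sub>1 - \<langle>y, \<xi>\<rangle> e\<^sub>n\<close>, the Euler equation says \<open>\<Sum>x\<^sub>j F\<^sub>j = 0\<close>. Applying \<open>T\<^sub>\<xi>\<close> to it
  and commuting gives \<open>(n + 1 + \<gamma>) F\<^sub>\<xi>(x) = \<Sum>\<kappa>\<^sub>\<alpha> F\<^bsub>r\<^sub>\<alpha>\<xi>\<^esub>(r\<^sub>\<alpha>x)\<close>, which forces \<open>F = 0\<close> by comparing suprema.\<close>

lemma T_kernel_part:
  "T \<xi> (kernel_part y n) = (\<lambda>x. if n = 0 then 0 else of_real (y \<bullet> \<xi>) * kernel_part y (n - 1) x)"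
proof (induction n arbitrary: \<xi>)
  case (Suc n)
  let ?e = "kernel_part y (Suc n)" and ?b = "\<lambda>j. axis j 1 :: real ^ 'n"
  note h = hpoly_kernel_part[of "Suc n" y] and h' = hpoly_kernel_part[of n y]
  define F where "F \<xi> x = T \<xi> ?e x - of_real (y \<bullet> \<xi>) * kernel_part y n x" for \<xi> x
  have hF: "hpoly n (F \<xi>)" for \<xi>
    unfolding F_def using hpoly_T[OF h] by (intro hpoly_diff hpoly_cmult h') simp
  note rF = hpoly_regular[OF hF]
  have F_lin: "F (\<Sum>j\<in>J. t j *\<^sub>R v j) x = (\<Sum>j\<in>J. of_real (t j) * F (v j) x)" for J :: "'n set" and t v x
    unfolding F_def T_sum_dir[OF hpoly_regular[OF h]]
    by (simp add: inner_sum_right right_diff_distrib sum_subtractf sum_distrib_right mult.assoc)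
  have F_expand: "F \<xi> x = (\<Sum>j\<in>UNIV. of_real (\<xi> $ j) * F (?b j) x)" for \<xi> x
    using F_lin[of "\<lambda>j. \<xi> $ j" ?b UNIV x] basis_expansion[of \<xi>] by (simp add: scalar_mult_eq_scaleR)
  have F_refl_dir: "F (refl_along \<alpha> \<xi>) x = F \<xi> x - of_real (2 * (\<alpha> \<bullet> \<xi>) / (\<alpha> \<bullet> \<alpha>)) * F \<alpha> x" for \<alpha> \<xi> x
    unfolding F_def T_refl_dir[OF hpoly_regular[OF h]]
    by (simp add: refl_along_def inner_diff_right algebra_simps)
  have F_self: "F x x = 0" for x
    unfolding F_def T_hpoly_euler[OF h] kernel_part_Suc by (simp add: inner_commute)
  \<comment> \<open>By the induction hypothesis the correction term is
    \<open>(y \<bullet> \<eta>) * (y \<bullet> \<xi>)\<close> times the part of degree n - 1, or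
    zero; the second-order term is symmetric because the operators commute.\<close>
  have sym: "T \<xi> (F \<eta>) = T \<eta> (F \<xi>)" for \<xi> \<eta>
  proof -
    have "T \<xi> (F \<eta>) x = T \<xi> (T \<eta> ?e) x - of_real (y \<bullet> \<eta>) * T \<xi> (kernel_part y n) x" for \<xi> \<eta> x
    proof -
      have "F \<eta> = (\<lambda>x. T \<eta> ?e x + (- of_real (y \<bullet> \<eta>)) * kernel_part y n x)"
        by (simp add: F_def fun_eq_iff)
      thus ?thesis
        by (simp only: T_add[OF hpoly_regular[OF hpoly_T[OF h]] dunkl_regular_cmult[OF hpoly_regular[OF h']]]
            T_cmult[OF hpoly_regular[OF h']]) simp
    qed
    note expand = this
    show ?thesis
    proof
      fix x
      show "T \<xi> (F \<eta>) x = T \<eta> (F \<xi>) x"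
        unfolding expand Suc.IH T_commute[OF h, of \<xi> \<eta>] by simp
    qed
  qed
  have key: "(of_nat (Suc n) + of_real \<gamma>) * F \<xi> x = (\<Sum>\<alpha>\<in>P. of_real (\<kappa> \<alpha>) * F (refl_along \<alpha> \<xi>) (refl_along \<alpha> x))" for \<xi> x
  proof -
    have coord: "?b j \<bullet> z = z $ j" for j and z :: "real ^ 'n"
      by (simp add: inner_axis' )
    have "(\<lambda>x. 0) = (\<lambda>x. \<Sum>j\<in>UNIV. of_real (?b j \<bullet> x) * F (?b j) x)"
    proof
      fix x
      show "0 = (\<Sum>j\<in>UNIV. of_real (?b j \<bullet> x) * F (?b j) x)"
        unfolding coord F_expand[symmetric] F_self ..
    qed
    hence "0 = T \<xi> (\<lambda>x. \<Sum>j\<in>UNIV. of_real (?b j \<bullet> x) * F (?b j) x) x"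
      using T_const[of \<xi> 0] by metis
    also have "\<dots> = (\<Sum>j\<in>UNIV. T \<xi> (\<lambda>x. of_real (?b j \<bullet> x) * F (?b j) x) x)"
      by (simp add: T_sum dunkl_regular_mult dunkl_regular_inner rF)
    also have "\<dots> = (\<Sum>j\<in>UNIV. of_real (x $ j) * T (?b j) (F \<xi>) x) + (\<Sum>j\<in>UNIV. of_real (\<xi> $ j) * F (?b j) x)
        + (\<Sum>\<alpha>\<in>P. of_real (2 * \<kappa> \<alpha> / (\<alpha> \<bullet> \<alpha>) * (\<alpha> \<bullet> \<xi>)) * (\<Sum>j\<in>UNIV. of_real (\<alpha> $ j) * F (?b j) (refl_along \<alpha> x)))"
    proof -
      have "T \<xi> (\<lambda>x. of_real (?b j \<bullet> x) * F (?b j) x) x = of_real (x $ j) * T (?b j) (F \<xi>) x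
          + of_real (\<xi> $ j) * F (?b j) x
          + (\<Sum>\<alpha>\<in>P. of_real (2 * \<kappa> \<alpha> / (\<alpha> \<bullet> \<alpha>) * (\<alpha> \<bullet> \<xi>)) * (of_real (\<alpha> $ j) * F (?b j) (refl_along \<alpha> x)))" for j
        unfolding T_inner_mult[OF rF] sym[of \<xi>] by (simp add: coord inner_commute[of _ "?b j"] mult.assoc)
      thus ?thesis
        by (simp add: sum.distrib sum_distrib_left sum.swap[where A = UNIV and B = P])
    qed
    also have "(\<Sum>j\<in>UNIV. of_real (x $ j) * T (?b j) (F \<xi>) x) = T x (F \<xi>) x"
      using T_sum_dir[OF rF, of "\<lambda>j. x $ j" ?b UNIV \<xi> x] basis_expansion[of x] by (simp add: scalar_mult_eq_scaleR)
    finally have "0 = T x (F \<xi>) x + F \<xi> x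
        + (\<Sum>\<alpha>\<in>P. of_real (2 * \<kappa> \<alpha> / (\<alpha> \<bullet> \<alpha>) * (\<alpha> \<bullet> \<xi>)) * F \<alpha> (refl_along \<alpha> x))"
      unfolding F_expand[symmetric] .
    \<comment> \<open>Euler's identity evaluates \<open>T x (F \<xi>) x\<close>; the terms in
      \<open>F \<alpha>\<close> then turn \<open>F \<xi>\<close> at the reflected points into
      \<open>F (refl_along \<alpha> \<xi>)\<close>.\<close>
    thus ?thesis
      by (simp add: T_hpoly_euler[OF hF] F_refl_dir \<gamma>_def algebra_simps sum.distrib sum_subtractf sum_distrib_left)
  qed
  have "F \<xi> x = 0" for \<xi> x
  proof -
    \<comment> \<open>One radius for both arguments: \<open>key\<close> reflects \<xi> and x
      simultaneously, and \<open>S\<close> is stable under this.\<close>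
    define r where "r = max (norm \<xi>) (norm x)"
    define S where "S = {p :: (real ^ 'n) \<times> (real ^ 'n). norm (fst p) \<le> r \<and> norm (snd p) \<le> r}"
    define \<Phi> where "\<Phi> p = norm (F (fst p) (snd p))" for p
    have "bdd_above (\<Phi> ` S)"
    proof -
      have "\<exists>B. \<forall>j. bpoly n (B j) (F (?b j))"
        using hF unfolding hpoly_def by (intro choice allI)
      then obtain B where B: "\<And>j. bpoly n (B j) (F (?b j))" by blast
      have "\<Phi> p \<le> (\<Sum>j\<in>UNIV. r * (B j * r ^ n))" if "p \<in> S" for p
        unfolding \<Phi>_def F_expand[of "fst p"]
      proof (rule sum_norm_le)
        fix j
        have "norm (of_real (fst p $ j) :: complex) \<le> r"
          using component_le_norm_cart[of "fst p" j] that by (auto simp: S_def)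
        moreover have "norm (F (?b j) (snd p)) \<le> B j * r ^ n"
          using bpoly_norm[OF B, of j "snd p"] that bpoly_nonneg[OF B, of j]
          by (auto simp: S_def intro!: mult_left_mono power_mono order_trans[OF bpoly_norm[OF B]])
        ultimately show "norm (of_real (fst p $ j) * F (?b j) (snd p)) \<le> r * (B j * r ^ n)"
          unfolding norm_mult by (intro mult_mono) (auto intro: order_trans[OF norm_ge_zero])
      qed
      thus ?thesis by (auto intro!: bdd_aboveI2)
    qed
    note up = cSUP_upper[OF _ this]
    define M where "M = (SUP p\<in>S. \<Phi> p)"
    have ne: "(\<xi>, x) \<in> S" by (auto simp: S_def r_def)
    have step: "(real (Suc n) + \<gamma>) * \<Phi> p \<le> \<gamma> * M" if "p \<in> S" for p
    proof -
      have "(real (Suc n) + \<gamma>) * \<Phi> p = norm ((of_nat (Suc n) + of_real \<gamma>) * F (fst p) (snd p))"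
      proof -
        have "norm (of_nat (Suc n) + of_real \<gamma> :: complex) = real (Suc n) + \<gamma>"
          using \<gamma>_nonneg by (metis abs_of_nonneg add_nonneg_nonneg norm_of_real of_nat_0_le_iff of_real_add of_real_of_nat_eq)
        thus ?thesis by (simp only: norm_mult \<Phi>_def)
      qed
      also have "\<dots> \<le> (\<Sum>\<alpha>\<in>P. \<kappa> \<alpha> * M)"
        unfolding key
      proof (rule sum_norm_le)
        fix \<alpha> assume a: "\<alpha> \<in> P"
        have "norm (F (refl_along \<alpha> (fst p)) (refl_along \<alpha> (snd p))) \<le> M"
          using up[of "(refl_along \<alpha> (fst p), refl_along \<alpha> (snd p))"] that by (simp add: S_def \<Phi>_def M_def)
        thus "norm (of_real (\<kappa> \<alpha>) * F (refl_along \<alpha> (fst p)) (refl_along \<alpha> (snd p))) \<le> \<kappa> \<alpha> * M"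
          using \<kappa>_nonneg[OF P_in_R[OF a]] by (simp add: norm_mult mult_left_mono)
      qed
      also have "\<dots> = \<gamma> * M" by (simp add: \<gamma>_def sum_distrib_right)
      finally show ?thesis .
    qed
    have s: "real (Suc n) + \<gamma> > 0" using \<gamma>_nonneg by simp
    \<comment> \<open>A supremum M with (n + 1 + \<gamma>) M \<le> \<gamma> M cannot be
      positive.\<close>
    have "M \<le> \<gamma> * M / (real (Suc n) + \<gamma>)"
      unfolding M_def
      using step[unfolded M_def] ne s by (intro cSUP_least) (auto simp: pos_le_divide_eq mult.commute)
    hence "(1 + real n) * M \<le> 0" using s by (simp add: pos_le_divide_eq algebra_simps)
    hence "M \<le> 0" by (simp add: mult_le_0_iff)
    hence "\<Phi> (\<xi>, x) \<le> 0" using up[OF ne] by (simp add: M_def)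
    thus ?thesis by (simp add: \<Phi>_def)
  qed
  thus ?case by (auto simp: F_def fun_eq_iff)
qed simp

end

section \<open>Real analytic functions\<close>

text \<open>The terms of degree at least 2 are quadratically small, so the linear part of the local
  series is the derivative. Uniqueness of the kernel draws on analyticity through this
  consequence.\<close>

lemma real_analytic_differentiable:
  fixes f :: "real ^ 'n \<Rightarrow> complex"
  assumes "real_analytic f"
  shows "f differentiable at a"
proof -
  define mon where "mon h \<nu> = (\<Prod>i\<in>UNIV. (h $ i) ^ \<nu> i)" for h :: "real ^ 'n" and \<nu> :: "'n \<Rightarrow> nat"
  obtain c r where r: "r > 0" and c: "\<And>x. x \<in> ball a r \<Longrightarrow>
      ((\<lambda>\<nu> :: 'n \<Rightarrow> nat. c \<nu> * of_real (\<Prod>i\<in>UNIV. (x $ i - a $ i) ^ \<nu> i)) has_sum f x) UNIV"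
    using assms unfolding real_analytic_def by blast
  have c: "((\<lambda>\<nu>. c \<nu> * of_real (mon h \<nu>)) has_sum f (a + h)) UNIV" if "norm h < r" for h
    using c[of "a + h"] that by (simp add: mon_def dist_norm)
  \<comment> \<open>So small that the vector with all entries \<rho> lies in the ball of radius r;
    its monomials are powers of \<rho>, and absolute convergence there makes the coefficients
    summable with these weights.\<close>
  define \<rho> where "\<rho> = r / (real CARD('n) + 1)"
  have \<rho>: "\<rho> > 0" using r by (simp add: \<rho>_def)
  have \<rho>_le: "\<rho> \<le> r" using r by (simp add: \<rho>_def field_simps)
  define K where "K = (\<Sum>\<^sub>\<infinity>\<nu>. norm (c \<nu>) * \<rho> ^ (\<Sum>i\<in>UNIV. \<nu> i))"
  have summ: "(\<lambda>\<nu>. norm (c \<nu>) * \<rho> ^ (\<Sum>i\<in>UNIV. \<nu> i)) summable_on UNIV"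
  proof -
    let ?z = "(\<chi> i. \<rho>) :: real ^ 'n"
    have "norm ?z \<le> (\<Sum>i\<in>UNIV. \<bar>?z $ i\<bar>)" by (rule norm_le_l1_cart)
    also have "\<dots> < r" using r by (simp add: \<rho>_def field_simps)
    finally have "(\<lambda>\<nu>. norm (c \<nu> * of_real (mon ?z \<nu>))) summable_on UNIV"
      by (rule iffD1[OF summable_on_iff_abs_summable_on_complex has_sum_imp_summable[OF c]])
    moreover have "mon ?z \<nu> = \<rho> ^ (\<Sum>i\<in>UNIV. \<nu> i)" for \<nu>
      by (simp add: mon_def power_sum)
    ultimately show ?thesis using \<rho> by (simp add: norm_mult del: of_real_prod of_real_power)
  qed
  \<comment> \<open>\<open>e i\<close> is the multi-index of the i-th coordinate; \<open>A\<close>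
    collects the multi-indices of total degree at most 1.\<close>
  define e where "e i = (\<lambda>j. if j = i then 1 else 0 :: nat)" for i :: 'n
  define A where "A = insert (\<lambda>_. 0) (range e)"
  have inj_e: "inj e" unfolding e_def inj_def by (metis one_neq_zero)
  have e0: "(\<lambda>_. 0) \<notin> range e" 
  proof
    assume "(\<lambda>_. 0) \<in> range e"
    then obtain i where "(\<lambda>_. 0) = e i" by blast
    from fun_cong[OF this, of i] show False by (simp add: e_def)
  qed
  have deg2: "2 \<le> (\<Sum>i\<in>UNIV. \<nu> i)" if "\<nu> \<notin> A" for \<nu> :: "'n \<Rightarrow> nat"
  proof (rule ccontr)
    assume "\<not> 2 \<le> (\<Sum>i\<in>UNIV. \<nu> i)"
    hence s: "(\<Sum>i\<in>UNIV. \<nu> i) \<le> 1" by simp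
    have "\<nu> \<noteq> (\<lambda>_. 0)" using that by (simp add: A_def)
    then obtain i where i: "\<nu> i \<noteq> 0" by (meson ext)
    have "(\<Sum>j\<in>UNIV. \<nu> j) = \<nu> i + (\<Sum>j\<in>UNIV - {i}. \<nu> j)" by (rule sum.remove) auto
    hence "\<nu> i = 1" "(\<Sum>j\<in>UNIV - {i}. \<nu> j) = 0" using s i by linarith+
    hence "\<nu> = e i" by (auto simp: e_def fun_eq_iff)
    thus False using that by (simp add: A_def)
  qed
  define L where "L h = (\<Sum>i\<in>UNIV. c (e i) * of_real (h $ i))" for h :: "real ^ 'n"
  have bd: "norm (f (a + h) - c (\<lambda>_. 0) - L h) \<le> K / \<rho>\<^sup>2 * norm h ^ 2" if h: "norm h < \<rho>" for h
  proof -
    have mon_e: "mon h (e i) = h $ i" for i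
      unfolding mon_def e_def by (simp add: if_distrib[of "\<lambda>n. _ ^ n"] cong: if_cong)
    have "(\<Sum>\<nu>\<in>A. c \<nu> * of_real (mon h \<nu>)) = c (\<lambda>_. 0) + L h"
      unfolding A_def L_def using e0 inj_e by (simp add: sum.reindex mon_e) (simp add: mon_def)
    hence "((\<lambda>\<nu>. c \<nu> * of_real (mon h \<nu>)) has_sum (c (\<lambda>_. 0) + L h)) A"
      using has_sum_finite[of A "\<lambda>\<nu>. c \<nu> * of_real (mon h \<nu>)"] by (simp add: A_def)
    moreover have "norm h < r" using h \<rho>_le by simp
    ultimately have "((\<lambda>\<nu>. c \<nu> * of_real (mon h \<nu>)) has_sum (f (a + h) - (c (\<lambda>_. 0) + L h))) (UNIV - A)"
      by (intro has_sum_Diff c subset_UNIV)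
    moreover have m: "norm (c \<nu> * of_real (mon h \<nu>)) \<le> (norm h / \<rho>)\<^sup>2 * (norm (c \<nu>) * \<rho> ^ (\<Sum>i\<in>UNIV. \<nu> i))"
      if "\<nu> \<in> UNIV - A" for \<nu>
    proof -
      let ?s = "\<Sum>i\<in>UNIV. \<nu> i"
      have "\<bar>mon h \<nu>\<bar> \<le> (\<Prod>i\<in>UNIV. norm h ^ \<nu> i)"
        unfolding mon_def abs_prod by (intro prod_mono) (auto simp: power_abs intro!: power_mono component_le_norm_cart)
      also have "\<dots> = (norm h / \<rho>) ^ ?s * \<rho> ^ ?s"
        unfolding power_sum[symmetric] power_mult_distrib[symmetric] using \<rho> by simp
      \<comment> \<open>The ratio is below 1 and the total degree at least 2, so the power may be
        lowered to the square.\<close>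
      also have "\<dots> \<le> (norm h / \<rho>)\<^sup>2 * \<rho> ^ ?s"
        using \<rho> h deg2[of \<nu>] that by (intro mult_right_mono power_decreasing) auto
      finally show ?thesis by (simp add: norm_mult mult_left_mono mult.left_commute)
    qed
    moreover have s2: "(\<lambda>\<nu>. (norm h / \<rho>)\<^sup>2 * (norm (c \<nu>) * \<rho> ^ (\<Sum>i\<in>UNIV. \<nu> i))) summable_on (UNIV - A)"
      by (rule summable_on_cmult_right) (rule summable_on_subset_banach[OF summ], simp)
    ultimately have "norm (f (a + h) - (c (\<lambda>_. 0) + L h))
       \<le> (\<Sum>\<^sub>\<infinity>\<nu>\<in>UNIV - A. (norm h / \<rho>)\<^sup>2 * (norm (c \<nu>) * \<rho> ^ (\<Sum>i\<in>UNIV. \<nu> i)))"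
    proof -
      assume hs: "((\<lambda>\<nu>. c \<nu> * of_real (mon h \<nu>)) has_sum (f (a + h) - (c (\<lambda>_. 0) + L h))) (UNIV - A)"
      have ab: "(\<lambda>\<nu>. norm (c \<nu> * of_real (mon h \<nu>))) summable_on (UNIV - A)"
        by (rule iffD1[OF summable_on_iff_abs_summable_on_complex has_sum_imp_summable[OF hs]])
      have "norm (f (a + h) - (c (\<lambda>_. 0) + L h)) \<le> (\<Sum>\<^sub>\<infinity>\<nu>\<in>UNIV - A. norm (c \<nu> * of_real (mon h \<nu>)))"
        using norm_infsum_bound[OF ab] infsumI[OF hs] by simp
      also have "\<dots> \<le> (\<Sum>\<^sub>\<infinity>\<nu>\<in>UNIV - A. (norm h / \<rho>)\<^sup>2 * (norm (c \<nu>) * \<rho> ^ (\<Sum>i\<in>UNIV. \<nu> i)))"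
        by (rule infsum_mono[OF ab s2 m])
      finally show ?thesis .
    qed
    also have "\<dots> = (norm h / \<rho>)\<^sup>2 * (\<Sum>\<^sub>\<infinity>\<nu>\<in>UNIV - A. norm (c \<nu>) * \<rho> ^ (\<Sum>i\<in>UNIV. \<nu> i))"
      by (rule infsum_cmult_right) (rule summable_on_subset_banach[OF summ], simp)
    also have "\<dots> \<le> (norm h / \<rho>)\<^sup>2 * K"
      unfolding K_def using \<rho>
      by (intro mult_left_mono infsum_mono_neutral summ summable_on_subset_banach[OF summ]) auto
    finally show ?thesis by (simp add: power_divide diff_diff_eq mult.commute)
  qed
  have fa: "f a = c (\<lambda>_. 0)" using bd[of 0] \<rho> by (simp add: L_def)
  have "(f has_derivative L) (at a)"
    unfolding has_derivative_at
  proof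
    show "bounded_linear L" unfolding L_def
      by (intro bounded_linear_sum bounded_linear_const_mult bounded_linear_compose[OF bounded_linear_of_real] bounded_linear_vec_nth)
    have lim: "((\<lambda>h :: real ^ 'n. K / \<rho>\<^sup>2 * norm h) \<longlongrightarrow> 0) (at 0)"
      by (intro tendsto_mult_right_zero tendsto_norm_zero tendsto_ident_at)
    show "((\<lambda>h. norm (f (a + h) - f a - L h) / norm h) \<longlongrightarrow> 0) (at 0)"
    proof (rule Lim_null_comparison[OF _ lim])
      have "norm (norm (f (a + h) - f a - L h) / norm h) \<le> K / \<rho>\<^sup>2 * norm h" if "h \<noteq> 0" "dist h 0 < \<rho>" for h
        using bd[of h] that by (simp add: fa pos_divide_le_eq power2_eq_square mult.assoc)
      thus "\<forall>\<^sub>F h in at 0. norm (norm (f (a + h) - f a - L h) / norm h) \<le> K / \<rho>\<^sup>2 * norm h"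
        unfolding eventually_at using \<rho> by blast
    qed
  qed
  thus ?thesis by (rule differentiableI)
qed

text \<open>An expansion about \<open>a\<close> whose coefficients have l1-norm at most
  \<open>M\<close>, tested on finite sets. On the polydisc \<open>\<bar>h $ i\<bar> \<le> 1\<close>
  every monomial has modulus at most 1, so this norm controls convergence.\<close>

definition majorized :: "real ^ 'n \<Rightarrow> real \<Rightarrow> (real ^ 'n \<Rightarrow> complex) \<Rightarrow> (('n \<Rightarrow> nat) \<Rightarrow> complex) \<Rightarrow> bool" where
  "majorized a M f c \<longleftrightarrow> (\<forall>F. finite F \<longrightarrow> (\<Sum>\<nu>\<in>F. norm (c \<nu>)) \<le> M) \<and>
     (\<forall>h. (\<forall>i. \<bar>h $ i\<bar> \<le> 1) \<longrightarrow>
        ((\<lambda>\<nu>. c \<nu> * of_real (\<Prod>i\<in>UNIV. (h $ i) ^ \<nu> i)) has_sum f (a + h)) UNIV)"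

lemma majorizedD:
  assumes "majorized a M f c"
  shows "finite F \<Longrightarrow> (\<Sum>\<nu>\<in>F. norm (c \<nu>)) \<le> M"
    and "(\<And>i. \<bar>h $ i\<bar> \<le> 1) \<Longrightarrow> ((\<lambda>\<nu>. c \<nu> * of_real (\<Prod>i\<in>UNIV. (h $ i) ^ \<nu> i)) has_sum f (a + h)) UNIV"
  using assms unfolding majorized_def by blast+

lemma majorized_const:
  fixes a :: "real ^ 'n"
  assumes "norm k \<le> M"
  shows "majorized a M (\<lambda>x. k) (\<lambda>\<nu>. if \<nu> = (\<lambda>_. 0) then k else 0)"
  unfolding majorized_def
proof (intro conjI allI impI)
  fix F :: "('n \<Rightarrow> nat) set" assume "finite F"
  thus "(\<Sum>\<nu>\<in>F. norm (if \<nu> = (\<lambda>_. 0) then k else 0)) \<le> M"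
    using assms order_trans[OF norm_ge_zero assms] by (simp add: if_distrib[of norm] sum.delta cong: if_cong)
next
  fix h :: "real ^ 'n"
  have "((\<lambda>\<nu>. (if \<nu> = (\<lambda>_. 0) then k else 0) * of_real (\<Prod>i\<in>UNIV. (h $ i) ^ \<nu> i)) has_sum k) {\<lambda>_. 0}"
    using has_sum_finite[of "{\<lambda>_::'n. 0::nat}" "\<lambda>\<nu>. (if \<nu> = (\<lambda>_. 0) then k else 0) * of_real (\<Prod>i\<in>UNIV. (h $ i) ^ \<nu> i)"] by simp
  thus "((\<lambda>\<nu>. (if \<nu> = (\<lambda>_. 0) then k else 0) * of_real (\<Prod>i\<in>UNIV. (h $ i) ^ \<nu> i)) has_sum k) UNIV"
    by (rule has_sum_cong_neutral[THEN iffD1, rotated -1]) auto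
qed

lemma majorized_add:
  assumes "majorized a M f c" "majorized a M' g c'"
  shows "majorized a (M + M') (\<lambda>x. f x + g x) (\<lambda>\<nu>. c \<nu> + c' \<nu>)"
  unfolding majorized_def
proof (intro conjI allI impI)
  fix F :: "('a \<Rightarrow> nat) set" assume F: "finite F"
  have "(\<Sum>\<nu>\<in>F. norm (c \<nu> + c' \<nu>)) \<le> (\<Sum>\<nu>\<in>F. norm (c \<nu>)) + (\<Sum>\<nu>\<in>F. norm (c' \<nu>))"
    unfolding sum.distrib[symmetric] by (intro sum_mono norm_triangle_ineq)
  also have "\<dots> \<le> M + M'" by (intro add_mono assms[THEN majorizedD(1)] F)
  finally show "(\<Sum>\<nu>\<in>F. norm (c \<nu> + c' \<nu>)) \<le> M + M'" .
next
  fix h :: "real ^ 'a" assume "\<forall>i. \<bar>h $ i\<bar> \<le> 1"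
  hence h: "\<bar>h $ i\<bar> \<le> 1" for i by blast
  show "((\<lambda>\<nu>. (c \<nu> + c' \<nu>) * of_real (\<Prod>i\<in>UNIV. (h $ i) ^ \<nu> i)) has_sum (f (a + h) + g (a + h))) UNIV"
    using has_sum_add[OF assms[THEN majorizedD(2), OF h]] by (simp add: distrib_right)
qed

lemma majorized_cmult:
  assumes "majorized a M f c" "norm k * M \<le> M'"
  shows "majorized a M' (\<lambda>x. k * f x) (\<lambda>\<nu>. k * c \<nu>)"
  unfolding majorized_def
proof (intro conjI allI impI)
  fix F :: "('a \<Rightarrow> nat) set" assume F: "finite F"
  have "(\<Sum>\<nu>\<in>F. norm (k * c \<nu>)) = norm k * (\<Sum>\<nu>\<in>F. norm (c \<nu>))"
    by (simp add: norm_mult sum_distrib_left)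
  also have "\<dots> \<le> norm k * M" by (intro mult_left_mono majorizedD(1)[OF assms(1)] F) simp
  finally show "(\<Sum>\<nu>\<in>F. norm (k * c \<nu>)) \<le> M'" using assms(2) by simp
next
  fix h :: "real ^ 'a" assume "\<forall>i. \<bar>h $ i\<bar> \<le> 1"
  hence h: "\<bar>h $ i\<bar> \<le> 1" for i by blast
  show "((\<lambda>\<nu>. k * c \<nu> * of_real (\<Prod>i\<in>UNIV. (h $ i) ^ \<nu> i)) has_sum (k * f (a + h))) UNIV"
    using has_sum_cmult_right[OF majorizedD(2)[OF assms(1) h], of k] by (simp add: mult.assoc)
qed

text \<open>Multiplication by a centred coordinate only shifts the coefficients, which leaves their
  l1-norm alone.\<close>

lemma majorized_coordinate:
  assumes "majorized a M f c"
  shows "majorized a M (\<lambda>x. of_real (x $ j - a $ j) * f x) (\<lambda>\<nu>. if \<nu> j = 0 then 0 else c (\<nu>(j := \<nu> j - 1)))"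
    (is "majorized a M ?g ?c")
  unfolding majorized_def
proof (intro conjI allI impI)
  define s where "s \<nu> = \<nu>(j := Suc (\<nu> j))" for \<nu> :: "'a \<Rightarrow> nat"
  have inj: "inj s"
  proof (rule injI)
    fix \<mu> \<nu> assume *: "s \<mu> = s \<nu>"
    show "\<mu> = \<nu>"
    proof
      fix i show "\<mu> i = \<nu> i" using fun_cong[OF *, of i] by (auto simp: s_def split: if_splits)
    qed
  qed
  have rng: "range s = {\<nu>. \<nu> j \<noteq> 0}"
  proof (intro equalityI subsetI)
    fix \<nu> :: "'a \<Rightarrow> nat" assume "\<nu> \<in> {\<nu>. \<nu> j \<noteq> 0}"
    hence "\<nu> = s (\<nu>(j := \<nu> j - 1))" by (auto simp: s_def fun_eq_iff)
    thus "\<nu> \<in> range s" by blast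
  qed (auto simp: s_def)
  have cs: "?c (s \<nu>) = c \<nu>" for \<nu> by (simp add: s_def)
  show "(\<Sum>\<nu>\<in>F. norm (?c \<nu>)) \<le> M" if F: "finite F" for F
  proof -
    have fin: "finite (s -` F)" by (rule finite_vimageI[OF F inj])
    have "(\<Sum>\<nu>\<in>F. norm (?c \<nu>)) = (\<Sum>\<nu>\<in>s ` (s -` F). norm (?c \<nu>))"
      using F rng by (intro sum.mono_neutral_right) auto
    also have "\<dots> = (\<Sum>\<nu>\<in>s -` F. norm (c \<nu>))"
      by (subst sum.reindex[OF inj_on_subset[OF inj]]) (auto simp only: o_def cs subset_UNIV)
    also have "\<dots> \<le> M" by (rule majorizedD(1)[OF assms fin])
    finally show ?thesis .
  qed
  fix h :: "real ^ 'a" assume "\<forall>i. \<bar>h $ i\<bar> \<le> 1"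
  hence h: "\<bar>h $ i\<bar> \<le> 1" for i by blast
  let ?m = "\<lambda>\<nu>. of_real (\<Prod>i\<in>UNIV. (h $ i) ^ \<nu> i) :: complex"
  have ms: "?m (s \<nu>) = of_real (h $ j) * ?m \<nu>" for \<nu>
    by (simp add: s_def prod.remove[of UNIV j] mult.assoc)
  have "((\<lambda>\<nu>. of_real (h $ j) * (c \<nu> * ?m \<nu>)) has_sum ?g (a + h)) UNIV"
    using has_sum_cmult_right[OF majorizedD(2)[OF assms h], of "of_real (h $ j)"] by simp
  hence "(((\<lambda>\<nu>. ?c \<nu> * ?m \<nu>) \<circ> s) has_sum ?g (a + h)) UNIV"
    unfolding o_def cs ms by (simp add: mult.left_commute)
  hence "((\<lambda>\<nu>. ?c \<nu> * ?m \<nu>) has_sum ?g (a + h)) (range s)"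
    by (simp only: has_sum_reindex[OF inj])
  thus "((\<lambda>\<nu>. ?c \<nu> * ?m \<nu>) has_sum ?g (a + h)) UNIV"
    by (rule has_sum_cong_neutral[THEN iffD1, rotated -1]) (auto simp: rng)
qed

lemma majorized_sum:
  assumes "finite I" "\<And>i. i \<in> I \<Longrightarrow> \<exists>c. majorized a (M i) (f i) c"
  shows "\<exists>c. majorized a (\<Sum>i\<in>I. M i) (\<lambda>x. \<Sum>i\<in>I. f i x) c"
  using assms
proof (induction I rule: finite_induct)
  case empty
  show ?case using majorized_const[of 0 0 a] by auto
next
  case (insert i I)
  then obtain c c' where "majorized a (M i) (f i) c" "majorized a (\<Sum>i\<in>I. M i) (\<lambda>x. \<Sum>i\<in>I. f i x) c'" by blast
  thus ?case using majorized_add insert by fastforce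
qed

text \<open>Centred at \<open>a\<close>, a linear form is the constant \<open>u \<bullet> a\<close>
  plus the multiples \<open>u $ j\<close> of the centred coordinates. Its l1-norm is at most
  \<open>norm u * (norm a + real CARD('n))\<close>, and this factor enters once per degree.\<close>

lemma bpoly_majorized:
  fixes a :: "real ^ 'n"
  shows "bpoly n B f \<Longrightarrow> \<exists>c. majorized a (B * (norm a + real CARD('n)) ^ n) f c"
proof (induction rule: bpoly.induct)
  case (const k B)
  thus ?case using majorized_const[of k B a] by auto
next
  case (inner_mult n B f u B')
  let ?M = "B * (norm a + real CARD('n)) ^ n"
  have B: "0 \<le> ?M" using bpoly_nonneg[OF inner_mult.hyps(1)] by simp
  obtain c where c: "majorized a ?M f c" using inner_mult.IH by blast
  have 1: "\<exists>c. majorized a (norm u * norm a * ?M) (\<lambda>x. of_real (u \<bullet> a) * f x) c"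
    using majorized_cmult[OF c, of "of_real (u \<bullet> a)" "norm u * norm a * ?M"] B Cauchy_Schwarz_ineq2[of u a]
    by (auto intro: mult_right_mono)
  have 2: "\<exists>c. majorized a (\<Sum>j\<in>(UNIV::'n set). norm u * ?M) (\<lambda>x. \<Sum>j\<in>UNIV. of_real (u $ j) * (of_real (x $ j - a $ j) * f x)) c"
  proof (rule majorized_sum)
    fix j :: 'n
    have "norm (of_real (u $ j) :: complex) * ?M \<le> norm u * ?M"
      using B component_le_norm_cart[of u j] by (intro mult_right_mono) auto
    thus "\<exists>c. majorized a (norm u * ?M) (\<lambda>x. of_real (u $ j) * (of_real (x $ j - a $ j) * f x)) c"
      using majorized_cmult[OF majorized_coordinate[OF c]] by blast
  qed simp
  have eq: "(\<lambda>x. of_real (u \<bullet> x) * f x) = (\<lambda>x. of_real (u \<bullet> a) * f x + (\<Sum>j\<in>UNIV. of_real (u $ j) * (of_real (x $ j - a $ j) * f x)))"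
    by (simp add: fun_eq_iff inner_vec_def sum_distrib_right sum_distrib_left algebra_simps sum_subtractf)
  obtain c' where c': "majorized a (norm u * norm a * ?M + (\<Sum>j\<in>(UNIV::'n set). norm u * ?M)) (\<lambda>x. of_real (u \<bullet> x) * f x) c'"
    unfolding eq using majorized_add 1 2 by blast
  have "norm u * norm a * ?M + (\<Sum>j\<in>(UNIV::'n set). norm u * ?M) = (norm u * B) * (norm a + real CARD('n)) ^ Suc n"
    by (simp add: algebra_simps)
  also have "\<dots> \<le> B' * (norm a + real CARD('n)) ^ Suc n"
    by (intro mult_right_mono inner_mult.hyps(2)) auto
  finally have "majorized a (B' * (norm a + real CARD('n)) ^ Suc n) (\<lambda>x. of_real (u \<bullet> x) * f x) c'"
    using c' unfolding majorized_def by (meson order_trans)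
  thus ?case by blast
next
  case (add n B f B' g)
  then obtain c c' where "majorized a (B * (norm a + real CARD('n)) ^ n) f c"
      "majorized a (B' * (norm a + real CARD('n)) ^ n) g c'" by blast
  from majorized_add[OF this] show ?case
    unfolding distrib_right by blast
next
  case (cmult n B f k B')
  then obtain c where c: "majorized a (B * (norm a + real CARD('n)) ^ n) f c" by blast
  have "norm k * (B * (norm a + real CARD('n)) ^ n) = (norm k * B) * (norm a + real CARD('n)) ^ n" by simp
  also have "\<dots> \<le> B' * (norm a + real CARD('n)) ^ n"
    by (intro mult_right_mono cmult.hyps(2)) auto
  finally show ?case using majorized_cmult[OF c] by blast
qed

text \<open>The majorants \<open>M n\<close> sum to an exponential for every centre, so the double
  series over degrees and multi-indices converges absolutely and can be reordered; radius 1 works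
  everywhere.\<close>

lemma real_analytic_series:
  fixes f :: "nat \<Rightarrow> real ^ 'n \<Rightarrow> complex"
  assumes "\<And>n. bpoly n (L ^ n / fact n) (f n)" "\<And>x. (\<lambda>n. f n x) sums F x"
  shows "real_analytic F"
  unfolding real_analytic_def
proof
  fix a :: "real ^ 'n"
  define M where "M n = L ^ n / fact n * (norm a + real CARD('n)) ^ n" for n
  have "(\<lambda>n. (L * (norm a + real CARD('n))) ^ n /\<^sub>R fact n) sums exp (L * (norm a + real CARD('n)))"
    by (rule exp_converges)
  moreover have "(\<lambda>n. (L * (norm a + real CARD('n))) ^ n /\<^sub>R fact n) = M"
    unfolding M_def power_mult_distrib by (simp add: fun_eq_iff divide_inverse mult_ac)
  ultimately have sM: "summable M" by (metis sums_summable)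
  have M0: "0 \<le> M n" for n unfolding M_def
    by (rule mult_nonneg_nonneg[OF bpoly_nonneg[OF assms(1)]]) simp
  have "\<forall>n. \<exists>c. majorized a (M n) (f n) c"
    unfolding M_def using bpoly_majorized[OF assms(1)] by blast
  then obtain c where c: "\<And>n. majorized a (M n) (f n) (c n)" by metis
  have cM: "norm (c n \<nu>) \<le> M n" for n \<nu>
    using majorizedD(1)[OF c, of "{\<nu>}"] by simp
  define C where "C \<nu> = (\<Sum>\<^sub>\<infinity>n. c n \<nu>)" for \<nu>
  have C: "((\<lambda>n. c n \<nu>) has_sum C \<nu>) UNIV" for \<nu>
  proof -
    have "(\<lambda>n. norm (c n \<nu>)) summable_on UNIV"
      using summable_comparison_test'[OF sM, of 0 "\<lambda>n. norm (c n \<nu>)"] cM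
      by (simp add: summable_on_UNIV_nonneg_real_iff)
    hence "(\<lambda>n. c n \<nu>) summable_on UNIV" by (rule abs_summable_summable)
    thus ?thesis unfolding C_def by (rule has_sum_infsum)
  qed
  have key: "((\<lambda>\<nu>. C \<nu> * of_real (\<Prod>i\<in>UNIV. (h $ i) ^ \<nu> i)) has_sum F (a + h)) UNIV"
    if h: "\<And>i. \<bar>h $ i\<bar> \<le> 1" for h
  proof -
    define m where "m \<nu> = (of_real (\<Prod>i\<in>UNIV. (h $ i) ^ \<nu> i) :: complex)" for \<nu>
    have m1: "norm (m \<nu>) \<le> 1" for \<nu>
      unfolding m_def norm_of_real abs_prod using h
      by (intro prod_le_1) (auto simp: power_abs power_le_one)
    define G where "G p = c (fst p) (snd p) * m (snd p)" for p
    have "(\<lambda>p. norm (G p)) summable_on (UNIV \<times> UNIV)"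
    proof (rule nonneg_bdd_above_summable_on)
      have "(\<Sum>p\<in>A. norm (G p)) \<le> suminf M" if A: "finite A" for A :: "(nat \<times> ('n \<Rightarrow> nat)) set"
      proof -
        have "(\<Sum>p\<in>A. norm (G p)) \<le> (\<Sum>p\<in>fst ` A \<times> snd ` A. norm (G p))"
          using A by (intro sum_mono2) (auto simp: subset_fst_snd)
        also have "\<dots> = (\<Sum>n\<in>fst ` A. \<Sum>\<nu>\<in>snd ` A. norm (G (n, \<nu>)))"
          by (simp add: sum.cartesian_product case_prod_unfold)
        also have "\<dots> \<le> (\<Sum>n\<in>fst ` A. M n)"
        proof (rule sum_mono)
          fix n
          have "(\<Sum>\<nu>\<in>snd ` A. norm (G (n, \<nu>))) \<le> (\<Sum>\<nu>\<in>snd ` A. norm (c n \<nu>))"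
            using m1 by (intro sum_mono) (auto simp: G_def norm_mult intro: mult_left_le)
          also have "\<dots> \<le> M n" using A by (intro majorizedD(1)[OF c]) auto
          finally show "(\<Sum>\<nu>\<in>snd ` A. norm (G (n, \<nu>))) \<le> M n" .
        qed
        also have "\<dots> \<le> suminf M" using sum_le_suminf[OF sM] A M0 by simp
        finally show ?thesis .
      qed
      thus "bdd_above (sum (\<lambda>p. norm (G p)) ` {A. A \<subseteq> UNIV \<times> UNIV \<and> finite A})"
        by (auto intro!: bdd_aboveI2)
    qed simp
    hence "G summable_on (UNIV \<times> UNIV)" by (rule abs_summable_summable)
    then obtain S where S: "(G has_sum S) (UNIV \<times> UNIV)" by (auto simp: summable_on_def)
    have "((\<lambda>n. f n (a + h)) has_sum S) UNIV"
      using majorizedD(2)[OF c h] by (intro has_sum_SigmaD[OF S]) (simp add: G_def m_def)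
    hence "S = F (a + h)" by (intro sums_unique2[OF has_sum_imp_sums assms(2)])
    moreover have "((\<lambda>\<nu>. C \<nu> * m \<nu>) has_sum S) UNIV"
      using C by (intro has_sum_SigmaD[OF iffD1[OF has_sum_swap S]]) (auto simp: G_def intro: has_sum_cmult_left)
    ultimately show ?thesis by (simp add: m_def)
  qed
  show "\<exists>c. \<exists>r>0. \<forall>x\<in>ball a r. ((\<lambda>\<nu>. c \<nu> * of_real (\<Prod>i\<in>UNIV. (x $ i - a $ i) ^ \<nu> i)) has_sum F x) UNIV"
  proof (rule exI[of _ C], rule exI[of _ 1], intro conjI ballI)
    fix x assume "x \<in> ball a 1"
    hence "\<bar>(x - a) $ i\<bar> \<le> 1" for i
      using component_le_norm_cart[of "x - a" i] by (simp add: dist_norm norm_minus_commute[of a x])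
    thus "((\<lambda>\<nu>. C \<nu> * of_real (\<Prod>i\<in>UNIV. (x $ i - a $ i) ^ \<nu> i)) has_sum F x) UNIV"
      using key[of "x - a"] by simp
  qed simp
qed

section \<open>Power series of homogeneous polynomials\<close>

lemma exp_real_sums: "(\<lambda>n. x ^ n / fact n) sums exp (x :: real)"
  using exp_converges[of x] by (simp add: divide_inverse mult.commute)

text \<open>The exponential series in r differentiated term by term; the vanishing term n = 0
  absorbs the index shift.\<close>

lemma exp_deriv_sums: "(\<lambda>n. real n * (L ^ n / fact n) * r ^ (n - 1)) sums (L * exp (L * r))"
proof -
  have "(\<lambda>n. L * ((L * r) ^ n / fact n)) sums (L * exp (L * r))"
    by (intro sums_mult exp_real_sums)
  moreover have "(\<lambda>n. L * ((L * r) ^ n / fact n))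
     = (\<lambda>n. real (Suc n) * (L ^ Suc n / fact (Suc n)) * r ^ (Suc n - 1))"
    unfolding power_mult_distrib by (simp add: fun_eq_iff del: of_nat_Suc)
  ultimately show ?thesis
    using sums_Suc_iff[of "\<lambda>n. real n * (L ^ n / fact n) * r ^ (n - 1)" "L * exp (L * r)"] by simp
qed

section \<open>Termwise derivatives and difference quotients of a series\<close>

context
  fixes q :: "nat \<Rightarrow> real ^ 'n \<Rightarrow> complex" and K L :: real
  assumes q: "\<And>n x. norm (q n x) \<le> K * (real n * (L ^ n / fact n) * norm x ^ (n - 1))"
    and K: "0 \<le> K" and L: "0 \<le> L"
begin

text \<open>The assumed bound on \<open>q\<close> treats directional derivatives, with
  \<open>K = norm \<xi>\<close>, and difference quotients, with
  \<open>K = 2 / norm \<alpha>\<close>, in one argument.\<close>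

lemma derived_summable: "summable (\<lambda>n. norm (q n x))"
  using q by (intro summable_comparison_test'[OF summable_mult[OF sums_summable[OF exp_deriv_sums]], of 0]) simp

lemma derived_norm: "norm (\<Sum>n. q n x) \<le> K * (L * exp (L * norm x))"
proof -
  have "norm (\<Sum>n. q n x) \<le> (\<Sum>n. norm (q n x))" by (rule summable_norm[OF derived_summable])
  also have "\<dots> \<le> (\<Sum>n. K * (real n * (L ^ n / fact n) * norm x ^ (n - 1)))"
    by (intro suminf_le q derived_summable summable_mult sums_summable[OF exp_deriv_sums])
  also have "\<dots> = K * (L * exp (L * norm x))"
    using sums_mult[OF exp_deriv_sums[of L "norm x"], of K] by (simp add: sums_iff)
  finally show ?thesis .
qed

lemma derived_continuous:
  assumes "\<And>n. continuous_on UNIV (q n)"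
  shows "continuous_on UNIV (\<lambda>x. \<Sum>n. q n x)"
proof (rule continuous_at_imp_continuous_on, rule ballI)
  fix x :: "real ^ 'n"
  let ?S = "ball 0 (norm x + 1) :: (real ^ 'n) set"
  have "uniform_limit ?S (\<lambda>n x. \<Sum>i<n. q i x) (\<lambda>x. \<Sum>i. q i x) sequentially"
  proof (rule Weierstrass_m_test)
    fix n z assume z: "z \<in> ?S"
    show "norm (q n z) \<le> K * (real n * (L ^ n / fact n) * (norm x + 1) ^ (n - 1))"
      using z K L by (intro order_trans[OF q] mult_left_mono power_mono mult_nonneg_nonneg) auto
  qed (intro summable_mult sums_summable[OF exp_deriv_sums])
  moreover have "\<forall>\<^sub>F n in sequentially. continuous_on ?S (\<lambda>x. \<Sum>i<n. q i x)"
    using assms by (intro always_eventually allI continuous_on_sum) (auto intro: continuous_on_subset)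
  ultimately have "continuous_on ?S (\<lambda>x. \<Sum>i. q i x)"
    by (intro uniform_limit_theorem) auto
  thus "isCont (\<lambda>x. \<Sum>i. q i x) x"
    by (rule continuous_on_interior) (simp add: interior_open)
qed

end

lemma bpoly_frechet_norm:
  assumes "bpoly n B f"
  shows "norm (frechet_derivative f (at x) \<xi>) \<le> norm \<xi> * (real n * B * norm x ^ (n - 1))"
proof -
  obtain f' where f': "\<And>x. (f has_derivative f' x) (at x)" "\<And>\<xi>. bpoly (n - 1) (real n * B * norm \<xi>) (\<lambda>x. f' x \<xi>)"
    using bpoly_derivative[OF assms] by blast
  show ?thesis
    using bpoly_norm[OF f'(2)[of \<xi>], of x] by (simp add: frechet_derivative_at[OF f'(1), symmetric] mult_ac)
qed

lemma bpoly_refl_quotient_norm: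
  assumes "bpoly n B f" "\<alpha> \<noteq> 0"
  shows "norm (refl_quotient \<alpha> f x) \<le> 2 / norm \<alpha> * (real n * B * norm x ^ (n - 1))"
proof -
  obtain Q where Q: "has_refl_quotient \<alpha> f Q" "bpoly (n - 1) (2 / norm \<alpha> * real n * B) Q"
    using bpoly_quotient[OF assms(2,1)] by blast
  show ?thesis
    using bpoly_norm[OF Q(2), of x] by (simp add: refl_quotient_eq[OF assms(2) Q(1)] mult_ac)
qed

lemma bpoly_hpoly: "bpoly n B f \<Longrightarrow> hpoly n f"
  unfolding hpoly_def by blast

context
  fixes f :: "nat \<Rightarrow> real ^ 'n \<Rightarrow> complex" and L :: real
  assumes f: "\<And>n. bpoly n (L ^ n / fact n) (f n)" and L: "0 \<le> L"
begin

lemma series_norm_bound: "norm (f n x) \<le> (L * norm x) ^ n / fact n"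
  using bpoly_norm[OF f[of n], of x] by (simp add: power_mult_distrib)

lemma series_summable: "summable (\<lambda>n. norm (f n x))"
  by (rule summable_comparison_test'[OF sums_summable[OF exp_real_sums]]) (auto intro: series_norm_bound)

lemma series_sums: "(\<lambda>n. f n x) sums (\<Sum>n. f n x)"
  by (rule summable_sums[OF summable_norm_cancel[OF series_summable]])

lemma series_norm: "norm (\<Sum>n. f n x) \<le> exp (L * norm x)"
proof -
  have "norm (\<Sum>n. f n x) \<le> (\<Sum>n. norm (f n x))" by (rule summable_norm[OF series_summable])
  also have "\<dots> \<le> (\<Sum>n. (L * norm x) ^ n / fact n)"
    by (intro suminf_le series_norm_bound series_summable sums_summable[OF exp_real_sums])
  also have "\<dots> = exp (L * norm x)"
    using exp_real_sums by (simp add: sums_iff)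
  finally show ?thesis .
qed

lemma series_derivative_bound:
  "norm (frechet_derivative (f n) (at x) \<xi>) \<le> norm \<xi> * (real n * (L ^ n / fact n) * norm x ^ (n - 1))"
  by (rule bpoly_frechet_norm[OF f])

text \<open>Differentiation under the sum needs uniformly small tails, which the majorant provides
  on bounded sets; hence the ball about the origin that contains x.\<close>

lemma series_has_derivative:
  "((\<lambda>x. \<Sum>n. f n x) has_derivative (\<lambda>\<xi>. \<Sum>n. frechet_derivative (f n) (at x) \<xi>)) (at x)"
proof -
  define r where "r = norm x + 1"
  let ?S = "ball 0 r :: (real ^ 'n) set"
  define M where "M n = real n * (L ^ n / fact n) * r ^ (n - 1)" for n
  have sM: "summable M" unfolding M_def by (rule sums_summable[OF exp_deriv_sums])
  have M: "norm (frechet_derivative (f n) (at z) h) \<le> M n * norm h" if "z \<in> ?S" for n z h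
  proof -
    have "norm z ^ (n - 1) \<le> r ^ (n - 1)" using that by (intro power_mono) auto
    hence "norm h * (real n * (L ^ n / fact n) * norm z ^ (n - 1)) \<le> norm h * M n"
      unfolding M_def using L by (intro mult_left_mono) auto
    thus ?thesis using series_derivative_bound[of n z h] by (simp add: mult.commute)
  qed
  have summ: "summable (\<lambda>n. frechet_derivative (f n) (at z) h)" if "z \<in> ?S" for z h
    using that by (intro summable_comparison_test'[OF summable_mult2[OF sM, of "norm h"], of 0] M)
  have "\<exists>g. \<forall>x\<in>?S. (\<lambda>n. f n x) sums g x \<and>
      (g has_derivative (\<lambda>\<xi>. \<Sum>n. frechet_derivative (f n) (at x) \<xi>)) (at x within ?S)"
  proof (rule has_derivative_series)
    show "(f n has_derivative frechet_derivative (f n) (at z)) (at z within ?S)" for n z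
      by (rule has_derivative_at_withinI[OF dunkl_regular_derivative[OF hpoly_regular[OF bpoly_hpoly[OF f]]]])
    fix e :: real assume "e > 0"
    then obtain N where N: "\<And>n. n \<ge> N \<Longrightarrow> norm (\<Sum>i. M (i + n)) < e"
      using suminf_exist_split[OF _ sM] by blast
    have "norm ((\<Sum>i<n. frechet_derivative (f i) (at z) h) - (\<Sum>i. frechet_derivative (f i) (at z) h)) \<le> e * norm h"
      if n: "n \<ge> N" and z: "z \<in> ?S" for n z h
    proof -
      have sMn: "summable (\<lambda>i. M (i + n))" using sM by (simp add: summable_iff_shift)
      have "norm ((\<Sum>i<n. frechet_derivative (f i) (at z) h) - (\<Sum>i. frechet_derivative (f i) (at z) h))
         = norm (\<Sum>i. frechet_derivative (f (i + n)) (at z) h)"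
        by (simp add: suminf_split_initial_segment[OF summ[OF z], of h n])
      also have "\<dots> \<le> (\<Sum>i. M (i + n) * norm h)"
        using z by (intro norm_suminf_le M summable_mult2 sMn)
      also have "\<dots> = (\<Sum>i. M (i + n)) * norm h" by (rule suminf_mult2[OF sMn, symmetric])
      also have "\<dots> \<le> e * norm h" using N[OF n] by (intro mult_right_mono) auto
      finally show ?thesis .
    qed
    thus "\<forall>\<^sub>F n in sequentially. \<forall>z\<in>?S. \<forall>h.
        norm ((\<Sum>i<n. frechet_derivative (f i) (at z) h) - (\<Sum>i. frechet_derivative (f i) (at z) h)) \<le> e * norm h"
      unfolding eventually_sequentially by blast
  next
    show "(\<lambda>n. f n 0) sums (\<Sum>n. f n 0)" by (rule series_sums)
    show "(0 :: real ^ 'n) \<in> ?S" by (simp add: r_def add_nonneg_pos)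
  qed simp
  then obtain g where gS: "\<forall>x\<in>?S. (\<lambda>n. f n x) sums g x \<and>
      (g has_derivative (\<lambda>\<xi>. \<Sum>n. frechet_derivative (f n) (at x) \<xi>)) (at x within ?S)" ..
  note g = conjunct1[OF bspec[OF gS]] conjunct2[OF bspec[OF gS]]
  have x: "x \<in> ?S" by (simp add: r_def)
  have "(g has_derivative (\<lambda>\<xi>. \<Sum>n. frechet_derivative (f n) (at x) \<xi>)) (at x)"
    by (rule g(2)[OF x, unfolded at_within_open[OF x open_ball]])
  thus ?thesis
    by (rule has_derivative_transform_within_open[of _ _ _ _ ?S])
       (rule open_ball x sums_unique[OF g(1)] | assumption)+
qed

lemma series_has_refl_quotient:
  assumes "\<alpha> \<noteq> 0"
  shows "has_refl_quotient \<alpha> (\<lambda>x. \<Sum>n. f n x) (\<lambda>x. \<Sum>n. refl_quotient \<alpha> (f n) x)"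
  unfolding has_refl_quotient_def
proof (intro conjI allI)
  have reg: "dunkl_regular (f n)" for n by (rule hpoly_regular[OF bpoly_hpoly[OF f]])
  note b = bpoly_refl_quotient_norm[OF f assms]
  have K: "0 \<le> 2 / norm \<alpha>" by simp
  show "continuous_on UNIV (\<lambda>x. \<Sum>n. refl_quotient \<alpha> (f n) x)"
    by (rule derived_continuous[OF b K L])
       (use dunkl_regular_quotient[OF reg assms] in \<open>auto simp: has_refl_quotient_def\<close>)
  fix x
  have s: "summable (\<lambda>n. refl_quotient \<alpha> (f n) x)"
    by (rule summable_norm_cancel[OF derived_summable[OF b K L]])
  show "(\<Sum>n. f n x) - (\<Sum>n. f n (refl_along \<alpha> x)) = of_real (\<alpha> \<bullet> x) * (\<Sum>n. refl_quotient \<alpha> (f n) x)"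
    by (simp add: suminf_diff sums_summable[OF series_sums] inner_mult_refl_quotient flip: suminf_mult[OF s])
qed

lemma series_regular: "dunkl_regular (\<lambda>x. \<Sum>n. f n x)"
  using series_has_derivative series_has_refl_quotient
  by (intro dunkl_regularI) (auto simp: differentiable_def)

lemma series_derivative_norm:
  "norm (frechet_derivative (\<lambda>x. \<Sum>n. f n x) (at x) \<xi>) \<le> norm \<xi> * (L * exp (L * norm x))"
  unfolding frechet_derivative_at[OF series_has_derivative, symmetric]
  by (rule derived_norm[OF series_derivative_bound _ L]) simp

lemma series_refl_quotient_norm:
  assumes "\<alpha> \<noteq> 0"
  shows "norm (refl_quotient \<alpha> (\<lambda>x. \<Sum>n. f n x) x) \<le> 2 / norm \<alpha> * (L * exp (L * norm x))"
  unfolding refl_quotient_eq[OF assms series_has_refl_quotient[OF assms]]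
  by (rule derived_norm[OF bpoly_refl_quotient_norm[OF f assms] _ L]) simp

end

section \<open>The Dunkl kernel\<close>

context dunkl begin

lemma T_series:
  assumes "\<And>n. bpoly n (L ^ n / fact n) (f n)" "0 \<le> L"
  shows "(\<lambda>n. T \<xi> (f n) x) sums T \<xi> (\<lambda>x. \<Sum>n. f n x) x"
proof -
  have 1: "(\<lambda>n. frechet_derivative (f n) (at x) \<xi>) sums (\<Sum>n. frechet_derivative (f n) (at x) \<xi>)"
    by (rule summable_sums[OF summable_norm_cancel[OF derived_summable[OF bpoly_frechet_norm[OF assms(1)] _ assms(2)]]]) simp
  have 2: "(\<lambda>n. refl_quotient \<alpha> (f n) x) sums (\<Sum>n. refl_quotient \<alpha> (f n) x)" if "\<alpha> \<noteq> 0" for \<alpha>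
    by (rule summable_sums[OF summable_norm_cancel[OF derived_summable[OF bpoly_refl_quotient_norm[OF assms(1) that] _ assms(2)]]]) simp
  have 3: "T \<xi> (\<lambda>x. \<Sum>n. f n x) x = (\<Sum>n. frechet_derivative (f n) (at x) \<xi>)
      + (\<Sum>\<alpha>\<in>P. of_real (\<kappa> \<alpha> * (\<alpha> \<bullet> \<xi>)) * (\<Sum>n. refl_quotient \<alpha> (f n) x))"
    by (rule T_eq[OF series_has_derivative[OF assms] series_has_refl_quotient[OF assms]])
  show ?thesis
    unfolding 3 unfolding dunkl_op_def by (intro sums_add sums_sum sums_mult 1 2 P_nonzero)
qed

text \<open>Represents E(x, c y) for real y. The scale is kept free: \<open>- \<i>\<close> gives the
  theorem, while 0 reduces the kernel to 1.\<close>

definition kernel :: "complex \<Rightarrow> real ^ 'n \<Rightarrow> real ^ 'n \<Rightarrow> complex" where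
  "kernel c y x = (\<Sum>n. c ^ n * kernel_part y n x)"

lemma bpoly_kernel_term: "bpoly n ((norm c * norm y) ^ n / fact n) (\<lambda>x. c ^ n * kernel_part y n x)"
  by (rule bpoly.cmult[OF bpoly_kernel_part]) (simp add: norm_power power_mult_distrib)

lemma kernel_scale_nonneg: "0 \<le> norm (c :: complex) * norm (y :: real ^ 'n)"
  by simp

lemma kernel_eq_series: "kernel c y = (\<lambda>x. \<Sum>n. c ^ n * kernel_part y n x)"
  by (simp add: kernel_def fun_eq_iff)

lemma kernel_sums: "(\<lambda>n. c ^ n * kernel_part y n x) sums kernel c y x"
  unfolding kernel_eq_series by (rule series_sums[OF bpoly_kernel_term kernel_scale_nonneg])

lemma kernel_real_analytic: "real_analytic (kernel c y)"
  by (rule real_analytic_series[OF bpoly_kernel_term kernel_sums])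

lemma kernel_regular: "dunkl_regular (kernel c y)"
  unfolding kernel_eq_series by (rule series_regular[OF bpoly_kernel_term kernel_scale_nonneg])

lemma kernel_norm: "norm (kernel c y x) \<le> exp (norm c * norm y * norm x)"
  unfolding kernel_eq_series by (rule series_norm[OF bpoly_kernel_term kernel_scale_nonneg])

lemma kernel_derivative_norm:
  "norm (frechet_derivative (kernel c y) (at x) \<xi>) \<le> norm \<xi> * (norm c * norm y * exp (norm c * norm y * norm x))"
  unfolding kernel_eq_series by (rule series_derivative_norm[OF bpoly_kernel_term kernel_scale_nonneg])

lemma kernel_refl_quotient_norm:
  "\<alpha> \<noteq> 0 \<Longrightarrow> norm (refl_quotient \<alpha> (kernel c y) x) \<le> 2 / norm \<alpha> * (norm c * norm y * exp (norm c * norm y * norm x))"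
  unfolding kernel_eq_series by (rule series_refl_quotient_norm[OF bpoly_kernel_term kernel_scale_nonneg])

lemma T_kernel: "T \<xi> (kernel c y) x = c * of_real (y \<bullet> \<xi>) * kernel c y x"
proof -
  have "(\<lambda>n. T \<xi> (\<lambda>x. c ^ n * kernel_part y n x) x) sums T \<xi> (kernel c y) x"
    unfolding kernel_eq_series by (rule T_series[OF bpoly_kernel_term kernel_scale_nonneg])
  hence "(\<lambda>n. c ^ n * T \<xi> (kernel_part y n) x) sums T \<xi> (kernel c y) x"
    by (simp only: T_cmult[OF hpoly_regular[OF hpoly_kernel_part]])
  \<comment> \<open>\<open>T_kernel_part\<close> lowers the degree by one and annihilates the term n
    = 0, so shifting the index gives back the series.\<close>
  moreover have "(\<lambda>n. c ^ Suc n * T \<xi> (kernel_part y (Suc n)) x) sums (c * of_real (y \<bullet> \<xi>) * kernel c y x)"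
    using sums_mult[OF kernel_sums, of "c * of_real (y \<bullet> \<xi>)" c y x]
    unfolding T_kernel_part by (simp add: mult_ac del: kernel_part.simps)
  hence "(\<lambda>n. c ^ n * T \<xi> (kernel_part y n) x) sums (c * of_real (y \<bullet> \<xi>) * kernel c y x)"
    using sums_Suc_iff[of "\<lambda>n. c ^ n * T \<xi> (kernel_part y n) x"] by (simp add: T_kernel_part)
  ultimately show ?thesis by (rule sums_unique2)
qed

lemma kernel_0: "kernel c y 0 = 1"
proof -
  have "c ^ n * kernel_part y n 0 = 0" if "n \<notin> {0}" for n
    using bpoly_norm[OF bpoly_kernel_part[of n y], of 0] that by (simp add: power_0_left del: kernel_part.simps)
  hence "(\<lambda>n. c ^ n * kernel_part y n 0) sums (\<Sum>n\<in>{0}. c ^ n * kernel_part y n 0)"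
    by (intro sums_finite) auto
  thus ?thesis using kernel_sums sums_unique2 by fastforce
qed

text \<open>Along a ray, \<open>t\<^sup>N h(tx)\<close> with \<open>N \<ge> \<gamma>\<close> has derivative
  \<open>t\<^sup>N\<^sup>-\<^sup>1 (\<lambda>(tx) h(tx) + (N - \<gamma>) h(tx) + \<Sum>\<kappa>\<^sub>\<alpha> h(r\<^sub>\<alpha> tx))\<close>. Integrating a bound
  \<open>\<bar>h(x)\<bar> \<le> M \<parallel>x\<parallel> exp (K\<parallel>x\<parallel>)\<close> improves the constant \<open>M\<close> by the factor \<open>N/(N+1) + L/K < 1\<close>.\<close>

lemma euler_equation_unique:
  fixes h l :: "real ^ 'n \<Rightarrow> complex"
  assumes diff: "\<And>x. h differentiable at x" and h0: "h 0 = 0" and L: "0 \<le> L"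
    and l: "\<And>x. norm (l x) \<le> L * norm x"
    and euler: "\<And>x. frechet_derivative h (at x) x = l x * h x - (\<Sum>\<alpha>\<in>P. of_real (\<kappa> \<alpha>) * (h x - h (refl_along \<alpha> x)))"
  shows "h x = 0"
proof -
  \<comment> \<open>A positive integer not below \<gamma>: the coefficient N - \<gamma> is
    nonnegative, and \<open>t ^ N\<close> vanishes at t = 0.\<close>
  define N where "N = Suc (nat \<lceil>\<gamma>\<rceil>)"
  have N: "\<gamma> \<le> real N" unfolding N_def by linarith
  \<comment> \<open>Makes L/K smaller than 1/(N + 1), so that q < 1.\<close>
  define K where "K = 2 * (L + 1) * (real N + 1)"
  define q where "q = real N / (real N + 1) + L / K"
  have K: "K > 0" using L by (simp add: K_def)
  have q0: "0 \<le> q" using L K by (simp add: q_def)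
  have q1: "q < 1"
  proof -
    have "L * (real N + 1) < K"
      unfolding K_def using L by (intro mult_strict_right_mono) auto
    hence "L / K < 1 / (real N + 1)" using K by (simp add: field_simps)
    thus ?thesis by (simp add: q_def field_simps)
  qed
  have hd: "(h has_derivative frechet_derivative h (at x)) (at x)" for x
    using diff by (simp add: frechet_derivative_works)
  have hc: "continuous_on UNIV h"
    using diff by (simp add: continuous_at_imp_continuous_on differentiable_imp_continuous_within)
  define \<tau> where "\<tau> = norm x"
  define bd where "bd M \<longleftrightarrow> (\<forall>z. norm z \<le> \<tau> \<longrightarrow> norm (h z) \<le> M * (norm z * exp (K * norm z)))" for M
  \<comment> \<open>Near 0 the bound comes from differentiability and \<open>h 0 = 0\<close>, on the
    rest of the ball from compactness.\<close>
  have start: "\<exists>M. bd M"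
  proof -
    have bl: "bounded_linear (frechet_derivative h (at 0))" by (rule has_derivative_bounded_linear[OF hd])
    obtain d where d: "d > 0" "\<And>z. norm z < d \<Longrightarrow> norm (h z - frechet_derivative h (at 0) z) \<le> norm z"
      using has_derivative_within_alt[of h "frechet_derivative h (at 0)" 0 UNIV] hd[of 0] h0
      by (metis UNIV_I diff_zero mult_1 zero_less_one)
    obtain B where B: "\<And>z. norm (frechet_derivative h (at 0) z) \<le> norm z * B" "B > 0"
      using bounded_linear.pos_bounded[OF bl] by blast
    have "compact (h ` cball 0 \<tau>)"
      using hc by (intro compact_continuous_image) (auto intro: continuous_on_subset)
    then obtain C where C: "\<And>z. norm z \<le> \<tau> \<Longrightarrow> norm (h z) \<le> C" 
      using compact_imp_bounded bounded_iff by (metis image_eqI mem_cball_0)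
    define M where "M = max (1 + B) (C / d)"
    have M: "norm (h z) \<le> M * norm z" if "norm z \<le> \<tau>" for z
    proof (cases "norm z < d")
      case True
      have "norm (h z) \<le> norm (h z - frechet_derivative h (at 0) z) + norm (frechet_derivative h (at 0) z)"
        by (rule norm_triangle_sub[of "h z" "frechet_derivative h (at 0) z", THEN order_trans]) simp
      also have "\<dots> \<le> norm z + norm z * B" using d(2)[OF True] B(1) by (intro add_mono)
      also have "\<dots> = (1 + B) * norm z" by (simp add: algebra_simps)
      also have "\<dots> \<le> M * norm z" by (intro mult_right_mono) (auto simp: M_def)
      finally show ?thesis .
    next
      case False
      have "0 \<le> C" using C[OF that] norm_ge_zero order_trans by blast
      have "norm (h z) \<le> C" by (rule C[OF that])
      also have "C = C / d * d" using d by simp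
      also have "\<dots> \<le> C / d * norm z" using False d \<open>0 \<le> C\<close> by (intro mult_left_mono) auto
      also have "\<dots> \<le> M * norm z" by (intro mult_right_mono) (auto simp: M_def)
      finally show ?thesis .
    qed
    have "0 \<le> M" using B by (simp add: M_def)
    have "bd M"
      unfolding bd_def
    proof (intro allI impI)
      fix z :: "real ^ 'n" assume z: "norm z \<le> \<tau>"
      have "norm z * 1 \<le> norm z * exp (K * norm z)" using K by (intro mult_left_mono) auto
      thus "norm (h z) \<le> M * (norm z * exp (K * norm z))"
        using M[OF z] mult_left_mono[OF _ \<open>0 \<le> M\<close>] by fastforce
    qed
    thus ?thesis by blast
  qed
  have step: "bd (M * q)" if M: "bd M" and M0: "0 \<le> M" for M
    unfolding bd_def
  proof (intro allI impI)
    fix z :: "real ^ 'n" assume z: "norm z \<le> \<tau>"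
    define \<phi> where "\<phi> t = of_real (t ^ N) * h (t *\<^sub>R z)" for t :: real
    define \<phi>' where "\<phi>' t = of_real (real N * t ^ (N - 1)) * h (t *\<^sub>R z) + of_real (t ^ N) * frechet_derivative h (at (t *\<^sub>R z)) z" for t :: real
    define E where "E t = exp (K * (t * norm z))" for t
    \<comment> \<open>Comparison function with the improved constant; its derivative dominates that
      of \<phi> because q (N + 1) \<ge> N and q K \<ge> L.\<close>
    define \<psi> where "\<psi> t = q * M * norm z * (t ^ Suc N * E t)" for t
    define \<psi>' where "\<psi>' t = q * M * norm z * (real (Suc N) * t ^ N * E t + t ^ Suc N * (K * norm z * E t))" for t
    have "norm (\<phi> 1 - \<phi> 0) \<le> \<psi> 1 - \<psi> 0"
    proof (rule differentiable_bound_general[where f' = \<phi>' and \<phi>' = \<psi>'])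
      have "((\<lambda>t. h (t *\<^sub>R z)) has_derivative (\<lambda>s. frechet_derivative h (at (t *\<^sub>R z)) (s *\<^sub>R z))) (at t)" for t
        by (rule has_derivative_compose[OF _ hd]) (auto intro!: derivative_eq_intros)
      hence hv: "((\<lambda>t. h (t *\<^sub>R z)) has_vector_derivative frechet_derivative h (at (t *\<^sub>R z)) z) (at t)" for t
        unfolding has_vector_derivative_def
        by (simp add: linear_cmul[OF has_derivative_linear[OF hd]])
      have tv: "((\<lambda>t. of_real (t ^ N) :: complex) has_vector_derivative of_real (real N * t ^ (N - 1))) (at t)" for t
        unfolding has_vector_derivative_def
        by (auto intro!: derivative_eq_intros simp: scaleR_conv_of_real)
      show v: "(\<phi> has_vector_derivative \<phi>' t) (at t)" for t
        unfolding \<phi>_def \<phi>'_def using has_vector_derivative_mult[OF tv[of t] hv[of t]] by (simp add: add.commute)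
      show "(\<psi> has_vector_derivative \<psi>' t) (at t)" for t
      proof -
        have dp: "((\<lambda>t. t ^ Suc N) has_real_derivative real (Suc N) * t ^ N) (at t)"
          using DERIV_pow[of "Suc N" t] by simp
        have dE: "(E has_real_derivative K * norm z * E t) (at t)"
          unfolding E_def[abs_def] by (auto intro!: derivative_eq_intros)
        show ?thesis
          unfolding \<psi>_def[abs_def] \<psi>'_def has_real_derivative_iff_has_vector_derivative[symmetric]
          using DERIV_cmult[OF DERIV_mult[OF dp dE], of "q * M * norm z"] by (simp add: algebra_simps)
      qed
      thus "continuous_on {0..1} \<psi>"
        by (meson continuous_at_imp_continuous_on has_vector_derivative_continuous)
      show "continuous_on {0..1} \<phi>"
        by (meson v continuous_at_imp_continuous_on has_vector_derivative_continuous)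
      fix t :: real assume t: "0 < t" "t < 1"
      let ?w = "t *\<^sub>R z"
      have w: "norm ?w \<le> \<tau>" using t z mult_left_le_one_le[of "norm z" t] by simp
      have bw: "norm (h u) \<le> M * (t * norm z * E t)" if "norm u = norm ?w" for u
        using M w that t unfolding bd_def E_def by (metis abs_of_pos norm_scaleR)
      have tN: "t ^ N = t ^ (N - 1) * t" unfolding N_def by simp
      have "\<phi>' t = of_real (t ^ (N - 1)) * (of_nat N * h ?w + frechet_derivative h (at ?w) ?w)"
        unfolding \<phi>'_def tN using linear_cmul[OF has_derivative_linear[OF hd], of ?w t z]
        by (simp add: algebra_simps scaleR_conv_of_real)
      also have "of_nat N * h ?w + frechet_derivative h (at ?w) ?w
         = l ?w * h ?w + of_real (real N - \<gamma>) * h ?w + (\<Sum>\<alpha>\<in>P. of_real (\<kappa> \<alpha>) * h (refl_along \<alpha> ?w))"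
        by (simp add: euler \<gamma>_def algebra_simps sum_subtractf sum_distrib_left)
      finally have "norm (\<phi>' t) = t ^ (N - 1) * norm (l ?w * h ?w + of_real (real N - \<gamma>) * h ?w + (\<Sum>\<alpha>\<in>P. of_real (\<kappa> \<alpha>) * h (refl_along \<alpha> ?w)))"
        using t by (simp add: norm_mult norm_power)
      also have "\<dots> \<le> t ^ (N - 1) * ((L * (t * norm z)) * (M * (t * norm z * E t)) + (real N - \<gamma>) * (M * (t * norm z * E t))
           + (\<Sum>\<alpha>\<in>P. \<kappa> \<alpha> * (M * (t * norm z * E t))))"
      proof (intro mult_left_mono order_trans[OF norm_triangle_ineq] add_mono)
        show "norm (l ?w * h ?w) \<le> (L * (t * norm z)) * (M * (t * norm z * E t))"
          unfolding norm_mult using l[of ?w] t L by (intro mult_mono bw) auto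
        show "norm (of_real (real N - \<gamma>) * h ?w) \<le> (real N - \<gamma>) * (M * (t * norm z * E t))"
          unfolding norm_mult norm_of_real using N bw[of ?w] by (intro mult_mono) auto
        show "norm (\<Sum>\<alpha>\<in>P. of_real (\<kappa> \<alpha>) * h (refl_along \<alpha> ?w)) \<le> (\<Sum>\<alpha>\<in>P. \<kappa> \<alpha> * (M * (t * norm z * E t)))"
        proof (rule sum_norm_le)
          fix \<alpha> assume "\<alpha> \<in> P"
          thus "norm (of_real (\<kappa> \<alpha>) * h (refl_along \<alpha> ?w)) \<le> \<kappa> \<alpha> * (M * (t * norm z * E t))"
            using \<kappa>_nonneg[OF P_in_R] bw[of "refl_along \<alpha> ?w"] by (simp add: norm_mult mult_left_mono)
        qed
      qed (use t in auto)
      also have "(\<Sum>\<alpha>\<in>P. \<kappa> \<alpha> * (M * (t * norm z * E t))) = \<gamma> * (M * (t * norm z * E t))"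
        by (simp add: \<gamma>_def sum_distrib_right)
      also have "t ^ (N - 1) * ((L * (t * norm z)) * (M * (t * norm z * E t)) + (real N - \<gamma>) * (M * (t * norm z * E t))
           + \<gamma> * (M * (t * norm z * E t))) = M * norm z * (real N * t ^ N * E t + t ^ Suc N * (L * norm z * E t))"
        by (simp add: tN algebra_simps)
      also have "\<dots> \<le> M * norm z * (q * real (Suc N) * t ^ N * E t + t ^ Suc N * (q * K * norm z * E t))"
      proof -
        have "q * real (Suc N) = real N + L / K * real (Suc N)"
          by (simp add: q_def distrib_right add.commute)
        moreover have "q * K = real N / (real N + 1) * K + L"
          using K by (simp add: q_def distrib_right)
        ultimately have "real N \<le> q * real (Suc N)" "L \<le> q * K"
          using K L by auto
        thus ?thesis using M0 t K unfolding E_def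
          by (intro mult_left_mono add_mono mult_right_mono) auto
      qed
      also have "\<dots> = \<psi>' t" by (simp add: \<psi>'_def algebra_simps)
      finally show "norm (\<phi>' t) \<le> \<psi>' t" .
    qed simp
    thus "norm (h z) \<le> M * q * (norm z * exp (K * norm z))"
      by (simp add: \<phi>_def \<psi>_def E_def N_def algebra_simps)
  qed
  obtain M where M: "bd M" using start by blast
  have M: "bd \<bar>M\<bar>" unfolding bd_def
  proof (intro allI impI)
    fix z :: "real ^ 'n" assume "norm z \<le> \<tau>"
    hence "norm (h z) \<le> M * (norm z * exp (K * norm z))" using M bd_def by blast
    also have "\<dots> \<le> \<bar>M\<bar> * (norm z * exp (K * norm z))" by (intro mult_right_mono) auto
    finally show "norm (h z) \<le> \<bar>M\<bar> * (norm z * exp (K * norm z))" .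
  qed
  have iter: "bd (\<bar>M\<bar> * q ^ n)" for n
  proof (induction n)
    case (Suc n)
    thus ?case using step[of "\<bar>M\<bar> * q ^ n"] q0 by (simp add: mult_ac)
  qed (use M in simp)
  have "(\<lambda>n. \<bar>M\<bar> * q ^ n * (norm x * exp (K * norm x))) \<longlonglongrightarrow> \<bar>M\<bar> * 0 * (norm x * exp (K * norm x))"
    using q0 q1 by (intro tendsto_intros LIMSEQ_power_zero) auto
  moreover have "norm (h x) \<le> \<bar>M\<bar> * q ^ n * (norm x * exp (K * norm x))" for n
    using iter[of n] unfolding bd_def \<tau>_def by blast
  ultimately have "norm (h x) \<le> \<bar>M\<bar> * 0 * (norm x * exp (K * norm x))"
    by (meson LIMSEQ_le_const)
  thus ?thesis by simp
qed

text \<open>The difference quotients do not depend on the direction, so linearity in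
  \<open>v\<close> rests on the derivative alone; the lemma thus applies to an arbitrary real
  analytic competitor of the kernel.\<close>

lemma T_expand:
  assumes "f differentiable at x"
  shows "T v f x = (\<Sum>j\<in>UNIV. of_real (v $ j) * T (axis j 1) f x)"
proof -
  have lin: "linear (frechet_derivative f (at x))"
    by (rule has_derivative_linear[OF assms[unfolded frechet_derivative_works]])
  have v: "v = (\<Sum>j\<in>UNIV. v $ j *\<^sub>R axis j 1)"
    using basis_expansion[of v] by (simp add: scalar_mult_eq_scaleR)
  have "frechet_derivative f (at x) v = (\<Sum>j\<in>UNIV. of_real (v $ j) * frechet_derivative f (at x) (axis j 1))"
    by (subst v) (simp add: linear_sum[OF lin] linear_cmul[OF lin] scaleR_conv_of_real[of _ "_ :: complex"])
  moreover have "of_real (\<alpha> \<bullet> v) = (\<Sum>j\<in>UNIV. of_real (v $ j) * complex_of_real (\<alpha> \<bullet> axis j 1))" for \<alpha>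
    by (subst v) (simp add: inner_sum_right)
  ultimately show ?thesis
    by (simp add: dunkl_op_def sum.distrib sum_distrib_left sum_distrib_right distrib_left
        sum.swap[where A = P and B = UNIV] mult_ac)
qed

lemma dunkl_kernel_eq: "dunkl_kernel P \<kappa> x (\<chi> j. c * of_real (y $ j)) = kernel c y x"
proof -
  define sol where "sol f \<longleftrightarrow> real_analytic f \<and>
      (\<forall>j x. T (axis j 1) f x = (\<chi> j. c * of_real (y $ j)) $ j * f x) \<and> f 0 = 1" for f
  have sk: "sol (kernel c y)"
    by (simp add: sol_def kernel_real_analytic T_kernel kernel_0 inner_axis)
  \<comment> \<open>The coordinate equations combine, with direction x at the point x, into the
    Euler equation; it is linear, so the difference of two solutions satisfies it as well and
    vanishes at 0.\<close>
  have euler: "frechet_derivative f (at x) x = c * of_real (y \<bullet> x) * f x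
      - (\<Sum>\<alpha>\<in>P. of_real (\<kappa> \<alpha>) * (f x - f (refl_along \<alpha> x)))" if "sol f" for f x
  proof -
    have "T x f x = c * of_real (y \<bullet> x) * f x"
      using that T_expand[OF real_analytic_differentiable, of f x x]
      by (simp add: sol_def inner_vec_def sum_distrib_left sum_distrib_right mult_ac)
    thus ?thesis by (simp add: T_euler algebra_simps)
  qed
  have "f = kernel c y" if sf: "sol f" for f
  proof
    fix x
    have d: "f differentiable at z" "kernel c y differentiable at z" for z
      using sf sk unfolding sol_def by (auto intro: real_analytic_differentiable)
    have "(\<lambda>x. f x - kernel c y x) x = 0"
    proof (rule euler_equation_unique[where L = "norm c * norm y" and l = "\<lambda>x. c * of_real (y \<bullet> x)"])
      show "(\<lambda>x. f x - kernel c y x) differentiable at z" for z using d by simp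
      show "f 0 - kernel c y 0 = 0" using sf sk by (simp add: sol_def)
      show "norm (c * of_real (y \<bullet> z)) \<le> norm c * norm y * norm z" for z
        using Cauchy_Schwarz_ineq2[of y z] by (simp add: norm_mult mult_left_mono mult.assoc)
      fix z
      have "((\<lambda>x. f x - kernel c y x) has_derivative
          (\<lambda>v. frechet_derivative f (at z) v - frechet_derivative (kernel c y) (at z) v)) (at z)"
        by (intro has_derivative_diff d[unfolded frechet_derivative_works])
      thus "frechet_derivative (\<lambda>x. f x - kernel c y x) (at z) z = c * of_real (y \<bullet> z) * (f z - kernel c y z)
         - (\<Sum>\<alpha>\<in>P. of_real (\<kappa> \<alpha>) * (f z - kernel c y z - (f (refl_along \<alpha> z) - kernel c y (refl_along \<alpha> z))))"
        by (simp add: frechet_derivative_at[symmetric] euler[OF sf] euler[OF sk] algebra_simps sum_subtractf sum.distrib)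
    qed simp
    thus "f x = kernel c y x" by simp
  qed
  hence "(THE f. sol f) = kernel c y" using sk by blast
  thus ?thesis unfolding dunkl_kernel_def sol_def by simp
qed

end

section \<open>Integration by parts\<close>

lemma borel_measurable_refl_along [measurable]: "refl_along \<alpha> \<in> borel_measurable borel"
  by (rule borel_measurable_continuous_onI[OF continuous_on_refl_along])

text \<open>Orthogonal invariance of Lebesgue measure is in the library for well-ordered index types only.
  Here it comes from Tonelli's theorem applied to \<open>1\<^bsub>B\<^esub>(x) g(x + r y)\<close>, with \<open>B\<close> the unit ball.\<close>

lemma nn_integral_refl_along:
  fixes g :: "real ^ 'n \<Rightarrow> ennreal"
  assumes [measurable]: "g \<in> borel_measurable borel"
  shows "(\<integral>\<^sup>+x. g (refl_along \<alpha> x) \<partial>lborel) = (\<integral>\<^sup>+x. g x \<partial>lborel)"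
proof -
  define B :: "(real ^ 'n) set" where "B = cball 0 1"
  have [measurable]: "B \<in> sets borel" by (simp add: B_def)
  define b where "b = emeasure lborel B"
  let ?r = "refl_along \<alpha>"
  have shift: "(\<integral>\<^sup>+x. f (x + c) \<partial>lborel) = (\<integral>\<^sup>+x. f x \<partial>lborel)"
    if [measurable]: "f \<in> borel_measurable borel" for f :: "real ^ 'n \<Rightarrow> ennreal" and c
    by (subst lborel_distr_plus[of c, symmetric], subst nn_integral_distr) (auto simp: add.commute)
  have r_add: "?r (x + y) = ?r x + ?r y" for x y by (rule linear_add[OF linear_refl_along])
  have "b * (\<integral>\<^sup>+x. g (?r x) \<partial>lborel) = (\<integral>\<^sup>+x. indicator B x * (\<integral>\<^sup>+y. g (?r y) \<partial>lborel) \<partial>lborel)"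
    by (simp add: nn_integral_multc b_def)
  also have "\<dots> = (\<integral>\<^sup>+x. indicator B x * (\<integral>\<^sup>+y. g (x + ?r y) \<partial>lborel) \<partial>lborel)"
  proof (rule nn_integral_cong)
    fix x
    have "(\<integral>\<^sup>+y. g (?r y) \<partial>lborel) = (\<integral>\<^sup>+y. g (?r (y + ?r x)) \<partial>lborel)"
      by (rule shift[symmetric]) simp
    thus "indicator B x * (\<integral>\<^sup>+y. g (?r y) \<partial>lborel) = indicator B x * (\<integral>\<^sup>+y. g (x + ?r y) \<partial>lborel)"
      by (simp add: r_add add.commute)
  qed
  also have "\<dots> = (\<integral>\<^sup>+x. (\<integral>\<^sup>+y. indicator B x * g (x + ?r y) \<partial>lborel) \<partial>lborel)"
    by (intro nn_integral_cong nn_integral_cmult[symmetric]) simp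
  also have "\<dots> = (\<integral>\<^sup>+y. (\<integral>\<^sup>+x. indicator B x * g (x + ?r y) \<partial>lborel) \<partial>lborel)"
    by (rule lborel_pair.Fubini') measurable
  also have "\<dots> = (\<integral>\<^sup>+y. (\<integral>\<^sup>+x. indicator B (x - ?r y) * g x \<partial>lborel) \<partial>lborel)"
  proof (rule nn_integral_cong)
    fix y
    show "(\<integral>\<^sup>+x. indicator B x * g (x + ?r y) \<partial>lborel) = (\<integral>\<^sup>+x. indicator B (x - ?r y) * g x \<partial>lborel)"
      by (subst shift[of "\<lambda>x. indicator B (x - ?r y) * g x" "?r y", symmetric]) auto
  qed
  also have "\<dots> = (\<integral>\<^sup>+x. (\<integral>\<^sup>+y. indicator B (x - ?r y) * g x \<partial>lborel) \<partial>lborel)"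
    by (rule lborel_pair.Fubini') measurable
  also have "\<dots> = (\<integral>\<^sup>+x. b * g x \<partial>lborel)"
  proof (rule nn_integral_cong)
    fix x
    have "(\<integral>\<^sup>+y. indicator B (x - ?r y) \<partial>lborel) = (\<integral>\<^sup>+y. indicator B (x - ?r (y + ?r x)) \<partial>lborel)"
      by (rule shift[symmetric]) simp
    \<comment> \<open>The argument \<open>x - ?r (y + ?r x)\<close> equals \<open>- ?r y\<close>,
      and the ball is invariant under the reflection and under sign.\<close>
    also have "\<dots> = (\<integral>\<^sup>+y. indicator B y \<partial>lborel)"
      by (intro nn_integral_cong) (simp add: r_add B_def indicator_def)
    finally show "(\<integral>\<^sup>+y. indicator B (x - ?r y) * g x \<partial>lborel) = b * g x"
      by (simp add: nn_integral_multc b_def)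
  qed
  also have "\<dots> = b * (\<integral>\<^sup>+x. g x \<partial>lborel)" by (simp add: nn_integral_cmult)
  finally have eq: "b * (\<integral>\<^sup>+x. g (?r x) \<partial>lborel) = b * (\<integral>\<^sup>+x. g x \<partial>lborel)" .
  have "b \<noteq> 0" "b \<noteq> top"
    unfolding b_def B_def using emeasure_lborel_cball_finite[of 0 1] content_cball_pos[of 1 "0 :: real ^ 'n"]
    by (auto simp: measure_def)
  thus ?thesis using eq by (simp add: ennreal_mult_cancel_left)
qed

lemma distr_refl_along: "distr lborel borel (refl_along \<alpha>) = lborel"
proof (rule measure_eqI)
  fix A assume "A \<in> sets (distr lborel borel (refl_along \<alpha>))"
  hence [measurable]: "A \<in> sets borel" by simp
  have "emeasure (distr lborel borel (refl_along \<alpha>)) A = (\<integral>\<^sup>+x. indicator A x \<partial>distr lborel borel (refl_along \<alpha>))"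
    by simp
  also have "\<dots> = (\<integral>\<^sup>+x. indicator A (refl_along \<alpha> x) \<partial>lborel)"
    by (rule nn_integral_distr) simp_all
  also have "\<dots> = (\<integral>\<^sup>+x. indicator A x \<partial>lborel)" by (rule nn_integral_refl_along) simp
  finally show "emeasure (distr lborel borel (refl_along \<alpha>)) A = emeasure lborel A" by simp
qed simp

lemma integral_refl_along:
  fixes f :: "real ^ 'n \<Rightarrow> complex"
  assumes "f \<in> borel_measurable borel"
  shows "(\<integral>x. f (refl_along \<alpha> x) \<partial>lborel) = (\<integral>x. f x \<partial>lborel)"
  using integral_distr[of "refl_along \<alpha>" lborel borel f] assms by (simp add: distr_refl_along)

lemma integrable_refl_along:
  fixes f :: "real ^ 'n \<Rightarrow> complex"
  assumes "integrable lborel f"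
  shows "integrable lborel (\<lambda>x. f (refl_along \<alpha> x))"
  using integrable_distr_eq[of "refl_along \<alpha>" lborel borel f] assms borel_measurable_integrable[OF assms]
  by (simp add: distr_refl_along)

lemma power_le_exp: "0 \<le> t \<Longrightarrow> t ^ n \<le> fact n * exp (t :: real)"
proof -
  assume t: "0 \<le> t"
  have "t ^ n / fact n \<le> (\<Sum>k. t ^ k / fact k)"
    using sum_le_suminf[OF sums_summable[OF exp_real_sums[of t]], of "{n}"] t by simp
  also have "\<dots> = exp t" using exp_real_sums by (simp add: sums_iff)
  finally show ?thesis by (simp add: field_simps)
qed

text \<open>At each x the function is dominated by the sum of \<open>exp (- real k)\<close> over the
  balls of radius k + 1 that contain x; the volumes of these balls grow polynomially in k.\<close>

lemma integrable_exp_minus_norm: "integrable lborel (\<lambda>x :: real ^ 'n. exp (- norm x))"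
proof (rule integrableI_bounded)
  define V where "V = unit_ball_vol (real DIM(real ^ 'n))"
  define d where "d = DIM(real ^ 'n)"
  define t where "t k = exp (- real k) * (V * (real k + 1) ^ d)" for k
  have V: "0 \<le> V" by (simp add: V_def)
  have "norm (t k) \<le> V * (2 ^ d * (fact d * exp 1)) * exp (- 1 / 2) ^ k" for k
  proof -
    have "((real k + 1) / 2) ^ d \<le> fact d * exp ((real k + 1) / 2)" by (rule power_le_exp) simp
    hence "(real k + 1) ^ d \<le> 2 ^ d * (fact d * exp ((real k + 1) / 2))" by (simp add: power_divide field_simps)
    also have "\<dots> \<le> 2 ^ d * (fact d * (exp 1 * exp (real k / 2)))"
      by (intro mult_left_mono) (auto simp flip: exp_add)
    finally have "t k \<le> exp (- real k) * (V * (2 ^ d * (fact d * (exp 1 * exp (real k / 2)))))"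
      unfolding t_def using V by (intro mult_left_mono) auto
    also have "\<dots> = V * (2 ^ d * (fact d * exp 1)) * (exp (- real k) * exp (real k / 2))" by simp
    also have "exp (- real k) * exp (real k / 2) = exp (- 1 / 2) ^ k"
      by (simp flip: exp_add exp_of_nat_mult)
    finally show ?thesis using V by (simp add: t_def)
  qed
  moreover have "summable (\<lambda>k. V * (2 ^ d * (fact d * exp 1)) * exp (- 1 / 2 :: real) ^ k)"
    by (intro summable_mult summable_geometric) simp
  ultimately have st: "summable t" using summable_comparison_test' by blast
  have "(\<integral>\<^sup>+x. ennreal (norm (exp (- norm (x :: real ^ 'n)))) \<partial>lborel)
     \<le> (\<integral>\<^sup>+x. (\<Sum>k. ennreal (exp (- real k)) * indicator (cball 0 (real k + 1)) (x :: real ^ 'n)) \<partial>lborel)"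
  proof (rule nn_integral_mono)
    fix x :: "real ^ 'n"
    define k where "k = nat \<lfloor>norm x\<rfloor>"
    have "real k \<le> norm x" unfolding k_def by simp
    moreover have "norm x \<le> real k + 1" unfolding k_def by linarith
    ultimately have k: "real k \<le> norm x" "norm x \<le> real k + 1" .
    let ?f = "\<lambda>k. ennreal (exp (- real k)) * indicator (cball 0 (real k + 1)) x"
    have "ennreal (norm (exp (- norm x))) \<le> ?f k"
      using k by (simp add: indicator_def)
    also have "\<dots> = sum ?f {k}" by (simp only: sum.insert sum.empty finite.emptyI empty_iff not_False_eq_True add_0_right)
    also have "\<dots> \<le> (\<Sum>k. ?f k)" by (rule sum_le_suminf) auto
    finally show "ennreal (norm (exp (- norm x))) \<le> (\<Sum>k. ?f k)" .
  qed
  also have "\<dots> = (\<Sum>k. \<integral>\<^sup>+x. ennreal (exp (- real k)) * indicator (cball 0 (real k + 1)) (x :: real ^ 'n) \<partial>lborel)"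
    by (intro nn_integral_suminf borel_measurable_times_ennreal borel_measurable_const borel_measurable_indicator) simp
  also have "\<dots> = (\<Sum>k. ennreal (t k))"
  proof (rule suminf_cong)
    fix k
    have "(\<integral>\<^sup>+x. ennreal (exp (- real k)) * indicator (cball 0 (real k + 1)) (x :: real ^ 'n) \<partial>lborel)
       = ennreal (exp (- real k)) * emeasure lborel (cball (0 :: real ^ 'n) (real k + 1))"
      by (rule nn_integral_cmult_indicator) simp
    also have "\<dots> = ennreal (t k)"
      using V by (subst emeasure_cball) (auto simp: t_def d_def V_def ennreal_mult'')
    finally show "(\<integral>\<^sup>+x. ennreal (exp (- real k)) * indicator (cball 0 (real k + 1)) (x :: real ^ 'n) \<partial>lborel) = ennreal (t k)" .
  qed
  also have "\<dots> < \<infinity>"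
  proof -
    have "0 \<le> t k" for k using V by (simp add: t_def)
    hence "(\<Sum>k. ennreal (t k)) \<noteq> top" by (rule ennreal_suminf_neq_top[OF st])
    thus ?thesis unfolding infinity_ennreal_def by (simp only: less_top)
  qed
  finally show "(\<integral>\<^sup>+x. ennreal (norm (exp (- norm (x :: real ^ 'n)))) \<partial>lborel) < \<infinity>" .
qed simp

text \<open>All integrands of the proof are products of a function of at most exponential growth and the
  Gaussian.\<close>

definition exp_growth :: "(real ^ 'n \<Rightarrow> complex) \<Rightarrow> bool" where
  "exp_growth f \<longleftrightarrow> (\<exists>C k. \<forall>x. norm (f x) \<le> C * exp (k * norm x))"

text \<open>Decay at every exponential rate, so that the class absorbs factors of exponential
  growth.\<close>

definition exp_decay :: "(real ^ 'n \<Rightarrow> complex) \<Rightarrow> bool" where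
  "exp_decay f \<longleftrightarrow> (\<forall>k. \<exists>C. \<forall>x. norm (f x) \<le> C * exp (- k * norm x))"

lemma exp_growthD:
  assumes "exp_growth f"
  shows "\<exists>C k. 0 \<le> C \<and> 0 \<le> k \<and> (\<forall>x. norm (f x) \<le> C * exp (k * norm x))"
proof -
  obtain C k where Ck: "\<And>x. norm (f x) \<le> C * exp (k * norm x)" using assms unfolding exp_growth_def by blast
  show ?thesis
  proof (intro exI conjI allI)
    fix x
    have "norm (f x) \<le> C * exp (k * norm x)" by (rule Ck)
    also have "\<dots> \<le> \<bar>C\<bar> * exp (\<bar>k\<bar> * norm x)"
      by (intro mult_mono) (auto intro!: mult_right_mono)
    finally show "norm (f x) \<le> \<bar>C\<bar> * exp (\<bar>k\<bar> * norm x)" .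
  qed auto
qed

lemma exp_growth_mono:
  assumes "exp_growth f" "\<And>x. norm (g x) \<le> norm (f x)"
  shows "exp_growth g"
  using assms unfolding exp_growth_def by (meson order_trans)

lemma exp_growth_mult:
  assumes "exp_growth f" "exp_growth g"
  shows "exp_growth (\<lambda>x. f x * g x)"
proof -
  obtain C k where 1: "0 \<le> C" "0 \<le> k" "\<And>x. norm (f x) \<le> C * exp (k * norm x)" using exp_growthD[OF assms(1)] by blast
  obtain C' k' where 2: "0 \<le> C'" "0 \<le> k'" "\<And>x. norm (g x) \<le> C' * exp (k' * norm x)" using exp_growthD[OF assms(2)] by blast
  have "norm (f x * g x) \<le> C * C' * exp ((k + k') * norm x)" for x
  proof -
    have "norm (f x * g x) \<le> (C * exp (k * norm x)) * (C' * exp (k' * norm x))"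
      unfolding norm_mult using 1 2 by (intro mult_mono) auto
    also have "\<dots> = C * C' * exp ((k + k') * norm x)"
      unfolding distrib_right exp_add by simp
    finally show ?thesis .
  qed
  thus ?thesis unfolding exp_growth_def by blast
qed

lemma exp_growth_const: "exp_growth (\<lambda>x. c)"
  unfolding exp_growth_def by (rule exI[of _ "norm c"], rule exI[of _ 0]) simp

lemma exp_growth_refl: "exp_growth f \<Longrightarrow> exp_growth (\<lambda>x. f (refl_along \<alpha> x))"
  unfolding exp_growth_def by (metis norm_refl_along)

lemma exp_growth_hpoly:
  assumes "hpoly n f" shows "exp_growth f"
proof -
  obtain B where B: "bpoly n B f" using assms hpoly_def by blast
  have "norm (f x) \<le> (B * fact n) * exp (1 * norm x)" for x
    using bpoly_norm[OF B, of x] mult_left_mono[OF power_le_exp[of "norm x" n] bpoly_nonneg[OF B]] by simp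
  thus ?thesis unfolding exp_growth_def by blast
qed

lemma exp_growth_inner: "exp_growth (\<lambda>x. of_real (u \<bullet> x))"
  using exp_growth_hpoly[OF hpoly_inner_mult[OF hpoly_const[of 1], of u]] by simp

lemma exp_decay_mult:
  assumes "exp_growth f" "exp_decay g"
  shows "exp_decay (\<lambda>x. f x * g x)"
  unfolding exp_decay_def
proof
  fix k
  obtain C c where 1: "0 \<le> C" "0 \<le> c" "\<And>x. norm (f x) \<le> C * exp (c * norm x)" using exp_growthD[OF assms(1)] by blast
  obtain D where 2: "\<And>x. norm (g x) \<le> D * exp (- (c + k) * norm x)" using assms(2) unfolding exp_decay_def by blast
  have "norm (f x * g x) \<le> (C * D) * exp (- k * norm x)" for x
  proof -
    have "norm (f x * g x) \<le> (C * exp (c * norm x)) * (D * exp (- (c + k) * norm x))"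
      unfolding norm_mult using 1 2 by (intro mult_mono) auto
    also have "\<dots> = (C * D) * (exp (c * norm x) * exp (- (c + k) * norm x))" by simp
    also have "exp (c * norm x) * exp (- (c + k) * norm x) = exp (- k * norm x)"
      by (simp add: algebra_simps flip: exp_add)
    finally show ?thesis .
  qed
  thus "\<exists>C. \<forall>x. norm (f x * g x) \<le> C * exp (- k * norm x)" by blast
qed

lemma exp_decay_add:
  assumes "exp_decay f" "exp_decay g"
  shows "exp_decay (\<lambda>x. f x + g x)"
  unfolding exp_decay_def
proof
  fix k
  obtain C where 1: "\<And>x. norm (f x) \<le> C * exp (- k * norm x)" using assms(1) unfolding exp_decay_def by blast
  obtain D where 2: "\<And>x. norm (g x) \<le> D * exp (- k * norm x)" using assms(2) unfolding exp_decay_def by blast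
  have "norm (f x + g x) \<le> (C + D) * exp (- k * norm x)" for x
    using norm_triangle_ineq[of "f x" "g x"] 1[of x] 2[of x] unfolding distrib_right by linarith
  thus "\<exists>C. \<forall>x. norm (f x + g x) \<le> C * exp (- k * norm x)" by blast
qed

lemma exp_decay_zero: "exp_decay (\<lambda>x. 0)"
  unfolding exp_decay_def by (intro allI exI[of _ 0]) simp

lemma exp_decay_sum: "(\<And>i. i \<in> I \<Longrightarrow> exp_decay (f i)) \<Longrightarrow> exp_decay (\<lambda>x. \<Sum>i\<in>I. f i x)"
  by (induction I rule: infinite_finite_induct) (auto intro: exp_decay_zero exp_decay_add)

lemma exp_decay_integrable:
  fixes f :: "real ^ 'n \<Rightarrow> complex"
  assumes "exp_decay f" "f \<in> borel_measurable borel"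
  shows "integrable lborel f"
proof -
  obtain C where "\<And>x. norm (f x) \<le> C * exp (- 1 * norm x)"
    using assms(1) unfolding exp_decay_def by blast
  hence "norm (f x) \<le> norm (C * exp (- norm x))" for x
    using abs_ge_self[of "C * exp (- norm x)"] order_trans by fastforce
  thus ?thesis
    using assms(2) by (intro Bochner_Integration.integrable_bound[OF integrable_mult_right[OF integrable_exp_minus_norm, of C]]) auto
qed

definition gauss :: "real ^ 'n \<Rightarrow> complex" where
  "gauss x = of_real (exp (- (norm x)\<^sup>2 / 2))"

text \<open>Completing the square: nonnegativity of \<open>(norm x - k)\<^sup>2\<close> bounds the
  quadratic exponent by a linear one.\<close>

lemma exp_decay_gauss: "exp_decay gauss"
  unfolding exp_decay_def
proof
  fix k
  have "norm (gauss x) \<le> exp (k\<^sup>2 / 2) * exp (- k * norm x)" for x :: "real ^ 'n"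
  proof -
    have "0 \<le> (norm x - k)\<^sup>2" by simp
    hence "- (norm x)\<^sup>2 / 2 \<le> k\<^sup>2 / 2 + (- k * norm x)" by (simp add: power2_diff field_simps)
    thus ?thesis by (simp add: gauss_def flip: exp_add)
  qed
  thus "\<exists>C. \<forall>x :: real ^ 'n. norm (gauss x) \<le> C * exp (- k * norm x)" by blast
qed

lemma gauss_refl [simp]: "gauss (refl_along \<alpha> x) = gauss x"
  by (simp add: gauss_def)

lemma gauss_has_derivative:
  "(gauss has_derivative (\<lambda>h. - of_real (x \<bullet> h) * gauss x)) (at x)"
  unfolding gauss_def[abs_def] power2_norm_eq_inner
  by (auto intro!: derivative_eq_intros simp: inner_commute algebra_simps)

lemma gauss_regular: "dunkl_regular gauss"
proof (rule dunkl_regularI)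
  show "gauss differentiable at x" for x using gauss_has_derivative differentiableI by blast
  show "\<exists>Q. has_refl_quotient \<alpha> gauss Q" for \<alpha>
    by (rule exI[of _ "\<lambda>x. 0"]) (simp add: has_refl_quotient_def)
qed

lemma refl_quotient_gauss: "\<alpha> \<noteq> 0 \<Longrightarrow> refl_quotient \<alpha> gauss = (\<lambda>x. 0)"
  by (rule refl_quotient_eq) (auto simp: has_refl_quotient_def)

text \<open>The derivative is not known to be continuous, so its measurability and its integral are
  obtained from difference quotients with steps 1/(n + 1).\<close>

lemma directional_derivative_sequence:
  fixes v :: "real ^ 'n \<Rightarrow> complex"
  assumes "(v has_derivative v') (at x)"
  shows "(\<lambda>n. of_nat (Suc n) * (v (x + (1 / real (Suc n)) *\<^sub>R \<xi>) - v x)) \<longlonglongrightarrow> v' \<xi>"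
proof (cases "\<xi> = 0")
  case True
  thus ?thesis using linear_0[OF has_derivative_linear[OF assms]] by simp
next
  case False
  define \<epsilon> where "\<epsilon> n = 1 / real (Suc n)" for n
  have \<epsilon>: "\<epsilon> n > 0" for n by (simp add: \<epsilon>_def)
  have "\<epsilon> \<longlonglongrightarrow> 0" unfolding \<epsilon>_def[abs_def] by (rule LIMSEQ_Suc[OF lim_1_over_n])
  hence "(\<lambda>n. \<epsilon> n *\<^sub>R \<xi>) \<longlonglongrightarrow> 0 *\<^sub>R \<xi>" by (intro tendsto_intros)
  hence "filterlim (\<lambda>n. \<epsilon> n *\<^sub>R \<xi>) (at 0) sequentially"
    using False \<epsilon> by (intro filterlim_atI always_eventually) (simp_all add: less_imp_neq[symmetric])
  hence "(\<lambda>n. norm (v (x + \<epsilon> n *\<^sub>R \<xi>) - v x - v' (\<epsilon> n *\<^sub>R \<xi>)) / norm (\<epsilon> n *\<^sub>R \<xi>)) \<longlonglongrightarrow> 0"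
    by (rule filterlim_compose[OF conjunct2[OF assms[unfolded has_derivative_at]]])
  hence lim: "(\<lambda>n. norm (v (x + \<epsilon> n *\<^sub>R \<xi>) - v x - v' (\<epsilon> n *\<^sub>R \<xi>)) / norm (\<epsilon> n *\<^sub>R \<xi>) * norm \<xi>) \<longlonglongrightarrow> 0"
    by (rule tendsto_mult_left_zero)
  have eq: "norm (v (x + \<epsilon> n *\<^sub>R \<xi>) - v x - v' (\<epsilon> n *\<^sub>R \<xi>)) / norm (\<epsilon> n *\<^sub>R \<xi>) * norm \<xi>
     = norm (of_nat (Suc n) * (v (x + \<epsilon> n *\<^sub>R \<xi>) - v x) - v' \<xi>)" for n
  proof -
    have "of_nat (Suc n) * (v (x + \<epsilon> n *\<^sub>R \<xi>) - v x) - v' \<xi>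
       = of_nat (Suc n) * (v (x + \<epsilon> n *\<^sub>R \<xi>) - v x - v' (\<epsilon> n *\<^sub>R \<xi>))"
    proof -
      have "of_nat (Suc n) * v' (\<epsilon> n *\<^sub>R \<xi>) = v' \<xi>"
        by (simp add: linear_cmul[OF has_derivative_linear[OF assms]] \<epsilon>_def scaleR_conv_of_real[of _ "_ :: complex"] del: of_nat_Suc)
      thus ?thesis by (simp only: right_diff_distrib)
    qed
    thus ?thesis using False by (simp add: norm_mult \<epsilon>_def del: of_nat_Suc)
  qed
  have "(\<lambda>n. of_nat (Suc n) * (v (x + \<epsilon> n *\<^sub>R \<xi>) - v x)) \<longlonglongrightarrow> v' \<xi>"
    using lim unfolding eq by (simp only: tendsto_norm_zero_iff LIM_zero_iff)
  thus ?thesis by (simp only: \<epsilon>_def)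
qed

lemma directional_derivative_measurable:
  fixes v :: "real ^ 'n \<Rightarrow> complex"
  assumes "\<And>x. (v has_derivative v' x) (at x)"
  shows "(\<lambda>x. v' x \<xi>) \<in> borel_measurable borel"
proof (rule borel_measurable_LIMSEQ_metric)
  have "continuous_on UNIV v"
    using assms by (meson continuous_at_imp_continuous_on has_derivative_continuous)
  hence [measurable]: "v \<in> borel_measurable borel" by (rule borel_measurable_continuous_onI)
  show "(\<lambda>x. of_nat (Suc n) * (v (x + (1 / real (Suc n)) *\<^sub>R \<xi>) - v x)) \<in> borel_measurable borel" for n
    by measurable
  show "(\<lambda>n. of_nat (Suc n) * (v (x + (1 / real (Suc n)) *\<^sub>R \<xi>) - v x)) \<longlonglongrightarrow> v' x \<xi>" for x
    by (rule directional_derivative_sequence[OF assms])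
qed

text \<open>By translation invariance every difference quotient integrates to 0; dominated
  convergence carries this over to the derivative.\<close>

lemma integral_directional_derivative:
  fixes v :: "real ^ 'n \<Rightarrow> complex"
  assumes v: "\<And>x. (v has_derivative v' x) (at x)"
    and decay: "exp_decay v" "exp_decay (\<lambda>x. v' x \<xi>)"
  shows "(\<integral>x. v' x \<xi> \<partial>lborel) = 0"
proof -
  have cont: "continuous_on UNIV v"
    using v by (meson continuous_at_imp_continuous_on has_derivative_continuous)
  hence [measurable]: "v \<in> borel_measurable borel" by (rule borel_measurable_continuous_onI)
  have int: "integrable lborel v" by (rule exp_decay_integrable[OF decay(1)]) simp
  obtain C where "\<And>x. norm (v' x \<xi>) \<le> C * exp (- 1 * norm x)"
    using decay(2) unfolding exp_decay_def by blast
  hence C: "norm (v' x \<xi>) \<le> C * exp (- norm x)" for x by simp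
  have C0: "0 \<le> C" using order_trans[OF norm_ge_zero C[of 0]] by simp
  define s where "s n x = of_nat (Suc n) * (v (x + (1 / real (Suc n)) *\<^sub>R \<xi>) - v x)" for n x
  have [measurable]: "s n \<in> borel_measurable borel" for n unfolding s_def by measurable
  have "(\<lambda>n. integral\<^sup>L lborel (s n)) \<longlonglongrightarrow> (\<integral>x. v' x \<xi> \<partial>lborel)"
  proof (rule integral_dominated_convergence)
    show "(\<lambda>x. v' x \<xi>) \<in> borel_measurable lborel"
      using directional_derivative_measurable[OF v] by simp
    show "integrable lborel (\<lambda>x :: real ^ 'n. C * exp (norm \<xi>) * exp (- norm x))"
      by (rule integrable_mult_right[OF integrable_exp_minus_norm])
    show "AE x in lborel. (\<lambda>n. s n x) \<longlonglongrightarrow> v' x \<xi>"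
      unfolding s_def by (intro AE_I2 directional_derivative_sequence v)
    fix n
    show "AE x in lborel. norm (s n x) \<le> C * exp (norm \<xi>) * exp (- norm x)"
    proof (rule AE_I2)
      fix x :: "real ^ 'n"
      define \<epsilon> where "\<epsilon> = 1 / real (Suc n)"
      have \<epsilon>: "0 < \<epsilon>" "\<epsilon> \<le> 1" by (auto simp: \<epsilon>_def)
      let ?D = "C * exp (norm \<xi>) * exp (- norm x)"
      \<comment> \<open>Mean value estimate: the segment has length at most
        \<open>norm \<xi>\<close>, so along it the decay bound worsens by at most the factor
        \<open>exp (norm \<xi>)\<close>.\<close>
      have "norm (v (x + \<epsilon> *\<^sub>R \<xi>) - v (x + 0 *\<^sub>R \<xi>)) \<le> ?D * \<epsilon> - ?D * 0"
      proof (rule differentiable_bound_general[where f' = "\<lambda>t. v' (x + t *\<^sub>R \<xi>) \<xi>" and \<phi>' = "\<lambda>t. ?D"])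
        have "((\<lambda>t. v (x + t *\<^sub>R \<xi>)) has_derivative (\<lambda>s. v' (x + t *\<^sub>R \<xi>) (s *\<^sub>R \<xi>))) (at t)" for t
          by (rule has_derivative_compose[OF _ v]) (auto intro!: derivative_eq_intros)
        thus "((\<lambda>t. v (x + t *\<^sub>R \<xi>)) has_vector_derivative v' (x + t *\<^sub>R \<xi>) \<xi>) (at t)" for t
          unfolding has_vector_derivative_def by (simp add: linear_cmul[OF has_derivative_linear[OF v]])
        show "continuous_on {0..\<epsilon>} (\<lambda>t. v (x + t *\<^sub>R \<xi>))"
          by (rule continuous_on_compose2[OF cont]) (auto intro!: continuous_intros)
        show "((\<lambda>t. ?D * t) has_vector_derivative ?D) (at t)" for t
          by (auto intro!: derivative_eq_intros simp: has_real_derivative_iff_has_vector_derivative[symmetric])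
        fix t assume t: "0 < t" "t < \<epsilon>"
        have "norm x \<le> norm (x + t *\<^sub>R \<xi>) + norm (t *\<^sub>R \<xi>)"
          using norm_triangle_ineq4[of "x + t *\<^sub>R \<xi>" "t *\<^sub>R \<xi>"] by simp
        moreover have "norm (t *\<^sub>R \<xi>) \<le> norm \<xi>" using t \<epsilon> mult_left_le_one_le[of "norm \<xi>" t] by simp
        ultimately have "- norm (x + t *\<^sub>R \<xi>) \<le> norm \<xi> + - norm x" by simp
        hence "C * exp (- norm (x + t *\<^sub>R \<xi>)) \<le> ?D"
          using C0 by (simp add: mult.assoc mult_left_mono flip: exp_add)
        thus "norm (v' (x + t *\<^sub>R \<xi>) \<xi>) \<le> ?D" using C[of "x + t *\<^sub>R \<xi>"] by linarith
      qed (use \<epsilon> in \<open>auto intro!: continuous_intros\<close>)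
      hence b: "norm (v (x + \<epsilon> *\<^sub>R \<xi>) - v x) \<le> ?D * \<epsilon>" by simp
      have "norm (s n x) = norm (v (x + \<epsilon> *\<^sub>R \<xi>) - v x) * real (Suc n)"
        by (simp add: s_def \<epsilon>_def norm_mult del: of_nat_Suc)
      also have "\<dots> \<le> (?D * \<epsilon>) * real (Suc n)" by (rule mult_right_mono[OF b]) simp
      also have "\<dots> = ?D" by (simp add: \<epsilon>_def)
      finally show "norm (s n x) \<le> ?D" .
    qed
  qed simp
  moreover have "integral\<^sup>L lborel (s n) = 0" for n
  proof -
    define c where "c = (1 / real (Suc n)) *\<^sub>R \<xi>"
    have d: "distr lborel borel (\<lambda>x. c + x) = lborel" by (rule lborel_distr_plus)
    have eq: "(\<integral>x. v (c + x) \<partial>lborel) = (\<integral>x. v x \<partial>lborel)"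
      using integral_distr[of "\<lambda>x. c + x" lborel borel v] by (simp add: d)
    have "integrable lborel (\<lambda>x. v (c + x))"
      using integrable_distr_eq[of "\<lambda>x. c + x" lborel borel v] int by (simp add: d)
    hence "(\<integral>x. v (c + x) - v x \<partial>lborel) = 0"
      using int eq by (simp add: Bochner_Integration.integral_diff)
    thus ?thesis unfolding s_def c_def[symmetric] by (simp add: add.commute[of _ c])
  qed
  ultimately show ?thesis by (simp add: LIMSEQ_const_iff)
qed

definition regular_with :: "((real ^ 'n \<Rightarrow> complex) \<Rightarrow> bool) \<Rightarrow> (real ^ 'n \<Rightarrow> complex) \<Rightarrow> bool" where
  "regular_with D f \<longleftrightarrow> dunkl_regular f \<and> D f \<and> (\<forall>\<xi>. D (\<lambda>x. frechet_derivative f (at x) \<xi>)) \<and>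
     (\<forall>\<alpha>. \<alpha> \<noteq> 0 \<longrightarrow> D (refl_quotient \<alpha> f))"

lemma regular_withD:
  assumes "regular_with D f"
  shows "dunkl_regular f" "D f" "D (\<lambda>x. frechet_derivative f (at x) \<xi>)" "\<alpha> \<noteq> 0 \<Longrightarrow> D (refl_quotient \<alpha> f)"
  using assms by (simp_all add: regular_with_def)

lemma regular_with_mult:
  assumes f: "regular_with exp_growth f" and g: "regular_with exp_decay g"
  shows "regular_with exp_decay (\<lambda>x. f x * g x)"
  unfolding regular_with_def
proof (intro conjI allI impI)
  note f = regular_withD[OF f] and g = regular_withD[OF g]
  show "dunkl_regular (\<lambda>x. f x * g x)" by (rule dunkl_regular_mult[OF f(1) g(1)])
  show "exp_decay (\<lambda>x. f x * g x)" by (rule exp_decay_mult[OF f(2) g(2)])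
  fix \<xi>
  have "frechet_derivative (\<lambda>x. f x * g x) (at x) \<xi>
      = f x * frechet_derivative g (at x) \<xi> + frechet_derivative f (at x) \<xi> * g x" for x
    using frechet_derivative_at[OF has_derivative_mult[OF dunkl_regular_derivative[OF f(1)] dunkl_regular_derivative[OF g(1)]], of x]
    by (simp add: fun_eq_iff)
  thus "exp_decay (\<lambda>x. frechet_derivative (\<lambda>x. f x * g x) (at x) \<xi>)"
    by (simp only:) (intro exp_decay_add exp_decay_mult f g)
next
  note f = regular_withD[OF f] and g = regular_withD[OF g]
  fix \<alpha> :: "real ^ 'a" assume \<alpha>: "\<alpha> \<noteq> 0"
  show "exp_decay (refl_quotient \<alpha> (\<lambda>x. f x * g x))"
    unfolding refl_quotient_eq[OF \<alpha> has_refl_quotient_mult[OF dunkl_regular_quotient[OF f(1) \<alpha>] dunkl_regular_quotient[OF g(1) \<alpha>]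
      dunkl_regular_continuous[OF f(1)] dunkl_regular_continuous[OF g(1)]]]
    by (intro exp_decay_add exp_decay_mult exp_growth_refl f g \<alpha>)
qed

lemma regular_with_hpoly:
  assumes "hpoly n f" shows "regular_with exp_growth f"
  unfolding regular_with_def
  by (intro conjI allI impI hpoly_regular[OF assms] exp_growth_hpoly[OF assms]
      exp_growth_hpoly[OF hpoly_frechet_derivative[OF assms]] exp_growth_hpoly[OF hpoly_refl_quotient[OF assms]])

lemma frechet_derivative_gauss: "frechet_derivative gauss (at x) \<xi> = - of_real (\<xi> \<bullet> x) * gauss x"
  unfolding frechet_derivative_at[OF gauss_has_derivative, symmetric] by (simp add: inner_commute)

lemma regular_with_gauss: "regular_with exp_decay gauss"
  unfolding regular_with_def frechet_derivative_gauss
proof (intro conjI allI impI gauss_regular exp_decay_gauss)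
  fix \<xi> :: "real ^ 'a"
  have "exp_growth (\<lambda>x. - of_real (\<xi> \<bullet> x))"
    using exp_growth_inner[of "- \<xi>"] by simp
  thus "exp_decay (\<lambda>x. - of_real (\<xi> \<bullet> x) * gauss x)" by (rule exp_decay_mult[OF _ exp_decay_gauss])
qed (simp add: refl_quotient_gauss exp_decay_zero)

lemma (in dunkl) regular_with_kernel: "regular_with exp_growth (kernel c y)"
  unfolding regular_with_def
proof (intro conjI allI impI kernel_regular)
  let ?L = "norm c * norm y"
  show "exp_growth (kernel c y)"
    unfolding exp_growth_def using kernel_norm[of c y] by (intro exI[of _ 1] exI[of _ ?L]) simp
  show "exp_growth (\<lambda>x. frechet_derivative (kernel c y) (at x) \<xi>)" for \<xi>
    unfolding exp_growth_def using kernel_derivative_norm[of c y _ \<xi>]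
    by (intro exI[of _ "norm \<xi> * ?L"] exI[of _ ?L]) (simp add: mult.assoc)
  show "exp_growth (refl_quotient \<alpha> (kernel c y))" if "\<alpha> \<noteq> 0" for \<alpha>
    unfolding exp_growth_def using kernel_refl_quotient_norm[OF that, of c y]
    by (intro exI[of _ "2 / norm \<alpha> * ?L"] exI[of _ ?L]) (simp only: mult.assoc, simp)
qed

section \<open>The weight and its smooth regularisation\<close>

context dunkl begin

abbreviation W0 :: "real ^ 'n \<Rightarrow> real" where "W0 x \<equiv> (dunkl_weight P \<kappa> x)\<^sup>2"

text \<open>The weight \<open>h\<^sub>\<kappa>\<^sup>2\<close> need not be differentiable across the hyperplanes; \<open>reg_weight e\<close> is the smooth
  invariant weight \<open>\<Prod>(\<langle>\<alpha>, x\<rangle>\<^sup>2 + e)\<close> with exponents \<open>\<kappa>\<^sub>\<alpha>\<close>.\<close>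

definition reg_weight :: "real \<Rightarrow> real ^ 'n \<Rightarrow> real" where
  "reg_weight e x = exp (\<Sum>\<alpha>\<in>P. \<kappa> \<alpha> * ln ((\<alpha> \<bullet> x)\<^sup>2 + e))"

definition growth_rate :: real where "growth_rate = (\<Sum>\<alpha>\<in>P. 2 * \<kappa> \<alpha> * norm \<alpha>)"

lemma reg_weight_refl:
  assumes "\<beta> \<in> R" shows "reg_weight e (refl_along \<beta> x) = reg_weight e x"
proof -
  have "(\<Sum>\<alpha>\<in>P. \<kappa> \<alpha> * ln ((\<alpha> \<bullet> refl_along \<beta> x)\<^sup>2 + e))
     = (\<Sum>\<alpha>\<in>P. \<kappa> (refl_along \<beta> \<alpha>) * ln ((refl_along \<beta> \<alpha> \<bullet> x)\<^sup>2 + e))"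
    using assms by (intro sum.cong) (auto simp: \<kappa>_refl P_in_R refl_along_inner)
  also have "\<dots> = (\<Sum>\<alpha>\<in>P. \<kappa> \<alpha> * ln ((\<alpha> \<bullet> x)\<^sup>2 + e))"
    by (rule sum_P_refl[OF assms]) (simp add: \<kappa>_uminus)
  finally show ?thesis by (simp add: reg_weight_def)
qed

lemma dunkl_weight_refl:
  assumes "\<beta> \<in> R" shows "dunkl_weight P \<kappa> (refl_along \<beta> x) = dunkl_weight P \<kappa> x"
proof -
  define \<phi> where "\<phi> \<alpha> = (if \<kappa> \<alpha> = 0 then 1 else \<bar>\<alpha> \<bullet> x\<bar> powr \<kappa> \<alpha>)" for \<alpha>
  have "dunkl_weight P \<kappa> (refl_along \<beta> x) = (\<Prod>\<alpha>\<in>P. \<phi> (refl_along \<beta> \<alpha>))"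
    unfolding dunkl_weight_def \<phi>_def
    using assms by (intro prod.cong) (auto simp: \<kappa>_refl P_in_R refl_along_inner)
  also have "\<dots> = (\<Prod>\<alpha>\<in>P. \<phi> \<alpha>)"
    by (rule prod_P_refl[OF assms]) (simp add: \<phi>_def \<kappa>_uminus)
  finally show ?thesis by (simp add: dunkl_weight_def \<phi>_def)
qed

lemma reg_weight_pos: "0 < reg_weight e x"
  by (simp add: reg_weight_def)

text \<open>Uniform in e, so it supplies the dominating function for e tending to 0. Each base is at
  most \<open>(1 + norm \<alpha> * norm x)\<^sup>2\<close>, hence at most an exponential.\<close>

lemma reg_weight_bound:
  assumes "0 < e" "e \<le> 1" shows "reg_weight e x \<le> exp (growth_rate * norm x)"
proof -
  have "\<kappa> \<alpha> * ln ((\<alpha> \<bullet> x)\<^sup>2 + e) \<le> 2 * \<kappa> \<alpha> * norm \<alpha> * norm x" if "\<alpha> \<in> P" for \<alpha>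
  proof -
    have "(\<alpha> \<bullet> x)\<^sup>2 \<le> (norm \<alpha> * norm x)\<^sup>2"
      using Cauchy_Schwarz_ineq2[of \<alpha> x] by (metis abs_ge_zero power2_abs power_mono)
    hence "(\<alpha> \<bullet> x)\<^sup>2 + e \<le> (1 + norm \<alpha> * norm x)\<^sup>2"
      using assms mult_nonneg_nonneg[OF norm_ge_zero norm_ge_zero, of \<alpha> x]
      unfolding power2_sum power_one by linarith
    also have "\<dots> \<le> (exp (norm \<alpha> * norm x))\<^sup>2"
      by (intro power_mono) (auto simp: exp_ge_add_one_self)
    also have "\<dots> = exp (2 * (norm \<alpha> * norm x))" by (simp add: exp_double)
    finally have le: "(\<alpha> \<bullet> x)\<^sup>2 + e \<le> exp (2 * (norm \<alpha> * norm x))" .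
    have "0 < (\<alpha> \<bullet> x)\<^sup>2 + e" using assms by (intro add_nonneg_pos) auto
    from ln_le_cancel_iff[OF this exp_gt_zero, THEN iffD2, OF le]
    have "ln ((\<alpha> \<bullet> x)\<^sup>2 + e) \<le> 2 * (norm \<alpha> * norm x)" by simp
    hence "\<kappa> \<alpha> * ln ((\<alpha> \<bullet> x)\<^sup>2 + e) \<le> \<kappa> \<alpha> * (2 * (norm \<alpha> * norm x))"
      by (rule mult_left_mono[OF _ \<kappa>_nonneg[OF P_in_R[OF that]]])
    thus ?thesis by (simp add: mult_ac)
  qed
  thus ?thesis unfolding reg_weight_def growth_rate_def sum_distrib_right by (simp add: sum_mono)
qed

lemma reg_weight_lim: "(\<lambda>n. reg_weight (1 / real (Suc n)) x) \<longlonglongrightarrow> W0 x"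
proof -
  have eq: "reg_weight (1 / real (Suc n)) x = (\<Prod>\<alpha>\<in>P. ((\<alpha> \<bullet> x)\<^sup>2 + 1 / real (Suc n)) powr \<kappa> \<alpha>)" for n
  proof -
    have "0 < (\<alpha> \<bullet> x)\<^sup>2 + 1 / real (Suc n)" for \<alpha> by (rule add_nonneg_pos) auto
    thus ?thesis unfolding reg_weight_def exp_sum[OF finite_P] powr_def
      by (intro prod.cong) (auto simp: less_imp_neq[symmetric])
  qed
  have "(\<lambda>n. ((\<alpha> \<bullet> x)\<^sup>2 + 1 / real (Suc n)) powr \<kappa> \<alpha>) \<longlonglongrightarrow> (if \<kappa> \<alpha> = 0 then 1 else \<bar>\<alpha> \<bullet> x\<bar> powr \<kappa> \<alpha>)\<^sup>2"
    if "\<alpha> \<in> P" for \<alpha>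
  proof (cases "\<kappa> \<alpha> = 0")
    \<comment> \<open>The base is positive for every n, so its power 0 is 1 also on the hyperplane,
      in agreement with the case distinction in \<open>dunkl_weight\<close>.\<close>
    case True
    have "0 < (\<alpha> \<bullet> x)\<^sup>2 + 1 / real (Suc n)" for n by (rule add_nonneg_pos) auto
    thus ?thesis using True by (simp add: less_imp_neq[symmetric] del: of_nat_Suc)
  next
    case False
    hence pos: "0 < \<kappa> \<alpha>" using \<kappa>_nonneg[OF P_in_R[OF that]] by simp
    have "(\<lambda>n. (\<alpha> \<bullet> x)\<^sup>2 + 1 / real (Suc n)) \<longlonglongrightarrow> (\<alpha> \<bullet> x)\<^sup>2 + 0"
      by (intro tendsto_add tendsto_const LIMSEQ_Suc[OF lim_1_over_n])
    hence "(\<lambda>n. ((\<alpha> \<bullet> x)\<^sup>2 + 1 / real (Suc n)) powr \<kappa> \<alpha>) \<longlonglongrightarrow> ((\<alpha> \<bullet> x)\<^sup>2 + 0) powr \<kappa> \<alpha>"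
      using pos by (intro tendsto_powr' tendsto_const) (auto intro!: always_eventually)
    moreover have "((\<alpha> \<bullet> x)\<^sup>2 + 0) powr \<kappa> \<alpha> = (\<bar>\<alpha> \<bullet> x\<bar> powr \<kappa> \<alpha>)\<^sup>2"
      by (simp add: power2_eq_square flip: powr_mult abs_mult)
    ultimately show ?thesis using False by simp
  qed
  hence "(\<lambda>n. \<Prod>\<alpha>\<in>P. ((\<alpha> \<bullet> x)\<^sup>2 + 1 / real (Suc n)) powr \<kappa> \<alpha>)
      \<longlonglongrightarrow> (\<Prod>\<alpha>\<in>P. (if \<kappa> \<alpha> = 0 then 1 else \<bar>\<alpha> \<bullet> x\<bar> powr \<kappa> \<alpha>)\<^sup>2)"
    by (intro tendsto_prod)
  thus ?thesis unfolding eq dunkl_weight_def prod_power_distrib .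
qed

lemma W0_bound: "W0 x \<le> exp (growth_rate * norm x)"
  by (rule LIMSEQ_le_const2[OF reg_weight_lim]) (auto intro!: reg_weight_bound)

lemma exp_growth_W0: "exp_growth (\<lambda>x. of_real (W0 x))"
  unfolding exp_growth_def using W0_bound
  by (intro exI[of _ 1] exI[of _ growth_rate]) (simp del: of_real_power)

lemma exp_growth_reg_weight: "0 < e \<Longrightarrow> e \<le> 1 \<Longrightarrow> exp_growth (\<lambda>x. of_real (reg_weight e x))"
  unfolding exp_growth_def using reg_weight_bound reg_weight_pos
  by (intro exI[of _ 1] exI[of _ growth_rate]) (simp add: less_imp_le)

lemma reg_weight_has_derivative:
  assumes "0 < e"
  shows "(reg_weight e has_derivative
     (\<lambda>h. reg_weight e x * (\<Sum>\<alpha>\<in>P. 2 * \<kappa> \<alpha> * (\<alpha> \<bullet> h) * ((\<alpha> \<bullet> x) / ((\<alpha> \<bullet> x)\<^sup>2 + e))))) (at x)"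
proof -
  have pos: "0 < (\<alpha> \<bullet> x)\<^sup>2 + e" for \<alpha> by (rule add_nonneg_pos) (auto simp: assms)
  have "((\<lambda>x. \<kappa> \<alpha> * ln ((\<alpha> \<bullet> x)\<^sup>2 + e)) has_derivative
      (\<lambda>h. 2 * \<kappa> \<alpha> * (\<alpha> \<bullet> h) * ((\<alpha> \<bullet> x) / ((\<alpha> \<bullet> x)\<^sup>2 + e)))) (at x)" for \<alpha>
    using pos[of \<alpha>] by (auto intro!: derivative_eq_intros simp: field_simps)
  hence "((\<lambda>x. \<Sum>\<alpha>\<in>P. \<kappa> \<alpha> * ln ((\<alpha> \<bullet> x)\<^sup>2 + e)) has_derivative
      (\<lambda>h. \<Sum>\<alpha>\<in>P. 2 * \<kappa> \<alpha> * (\<alpha> \<bullet> h) * ((\<alpha> \<bullet> x) / ((\<alpha> \<bullet> x)\<^sup>2 + e)))) (at x)"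
    by (intro has_derivative_sum)
  from has_derivative_exp[OF this] show ?thesis
    by (simp add: reg_weight_def[abs_def] mult.commute)
qed

lemma borel_measurable_reg_weight: "0 < e \<Longrightarrow> reg_weight e \<in> borel_measurable borel"
  by (intro borel_measurable_continuous_onI continuous_at_imp_continuous_on ballI
      has_derivative_continuous[OF reg_weight_has_derivative])

lemma borel_measurable_W0: "W0 \<in> borel_measurable borel"
  by (rule borel_measurable_LIMSEQ_metric[OF borel_measurable_reg_weight reg_weight_lim]) simp

lemma borel_measurable_of_real_W0 [measurable]: "(\<lambda>x. complex_of_real (W0 x)) \<in> borel_measurable borel"
  using borel_measurable_W0 by measurable

text \<open>Numerator and denominator both change sign; on the hyperplane the point is
  fixed.\<close>

lemma refl_quotient_refl:
  "refl_quotient \<alpha> g (refl_along \<alpha> x) = refl_quotient \<alpha> g x"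
proof (cases "\<alpha> \<bullet> x = 0")
  case True thus ?thesis by (simp add: refl_along_hyperplane)
next
  case False
  have "of_real (\<alpha> \<bullet> x) * refl_quotient \<alpha> g (refl_along \<alpha> x) = of_real (\<alpha> \<bullet> x) * refl_quotient \<alpha> g x"
    using inner_mult_refl_quotient[of \<alpha> "refl_along \<alpha> x" g] inner_mult_refl_quotient[of \<alpha> x g]
    by (auto simp: algebra_simps)
  thus ?thesis using False by simp
qed

lemma continuous_refl_quotient: "dunkl_regular u \<Longrightarrow> \<alpha> \<noteq> 0 \<Longrightarrow> continuous_on UNIV (refl_quotient \<alpha> u)"
  using dunkl_regular_quotient has_refl_quotient_def by blast

text \<open>For the weight \<open>reg_weight e\<close>, integrating by parts and symmetrising under each \<open>r\<^sub>\<alpha>\<close> leaves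
  integrands that stay bounded as \<open>e\<close> tends to 0.\<close>

lemma integral_T_reg_weight:
  assumes u: "regular_with exp_decay u" and e: "0 < e" "e \<le> 1"
  shows "(\<integral>x. (frechet_derivative u (at x) \<xi> + (\<Sum>\<alpha>\<in>P. of_real (\<kappa> \<alpha> * (\<alpha> \<bullet> \<xi>)) * refl_quotient \<alpha> u x
     * of_real ((\<alpha> \<bullet> x)\<^sup>2 / ((\<alpha> \<bullet> x)\<^sup>2 + e)))) * of_real (reg_weight e x) \<partial>lborel) = 0"
proof -
  note u = regular_withD[OF u]
  let ?D = "\<lambda>x. frechet_derivative u (at x) \<xi>" and ?W = "\<lambda>x. complex_of_real (reg_weight e x)"
  define s where "s \<alpha> x = complex_of_real ((\<alpha> \<bullet> x) / ((\<alpha> \<bullet> x)\<^sup>2 + e))" for \<alpha> x :: "real ^ 'n"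
  define v' where "v' x h = u x * of_real (reg_weight e x * (\<Sum>\<alpha>\<in>P. 2 * \<kappa> \<alpha> * (\<alpha> \<bullet> h) * ((\<alpha> \<bullet> x) / ((\<alpha> \<bullet> x)\<^sup>2 + e))))
     + frechet_derivative u (at x) h * ?W x" for x h
  have pos: "0 < (\<alpha> \<bullet> x)\<^sup>2 + e" for \<alpha> x by (rule add_nonneg_pos) (auto simp: e)
  have [measurable]: "u \<in> borel_measurable borel"
    by (rule borel_measurable_continuous_onI[OF dunkl_regular_continuous[OF u(1)]])
  have [measurable]: "?D \<in> borel_measurable borel"
    by (rule directional_derivative_measurable[OF dunkl_regular_derivative[OF u(1)]])
  have [measurable]: "?W \<in> borel_measurable borel"
    using borel_measurable_reg_weight[OF e(1)] by measurable
  have [measurable]: "s \<alpha> \<in> borel_measurable borel" for \<alpha>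
    unfolding s_def using pos by (intro borel_measurable_continuous_onI continuous_intros) (auto simp: less_le)
  have gW: "exp_growth ?W" by (rule exp_growth_reg_weight[OF e])
  have gs: "exp_growth (s \<alpha>)" for \<alpha>
  proof (rule exp_growth_mono)
    show "exp_growth (\<lambda>x. of_real (1 / e) * of_real (\<alpha> \<bullet> x))"
      by (intro exp_growth_mult exp_growth_const exp_growth_inner)
    fix x
    have "\<bar>\<alpha> \<bullet> x\<bar> / ((\<alpha> \<bullet> x)\<^sup>2 + e) \<le> \<bar>\<alpha> \<bullet> x\<bar> / e"
      using pos[of \<alpha> x] e by (intro divide_left_mono) auto
    thus "norm (s \<alpha> x) \<le> norm (complex_of_real (1 / e) * of_real (\<alpha> \<bullet> x))"
      using pos[of \<alpha> x] e unfolding s_def norm_mult norm_of_real by (simp add: abs_divide)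
  qed
  have dDW: "exp_decay (\<lambda>x. ?W x * ?D x)" by (intro exp_decay_mult gW u)
  have duWs: "exp_decay (\<lambda>x. (s \<alpha> x * ?W x) * u x)" for \<alpha> by (intro exp_decay_mult exp_growth_mult gW gs u)
  note iDW = exp_decay_integrable[OF dDW] and iuWs = exp_decay_integrable[OF duWs]
  have v'_eq: "v' x \<xi> = ?W x * ?D x + (\<Sum>\<alpha>\<in>P. of_real (2 * \<kappa> \<alpha> * (\<alpha> \<bullet> \<xi>)) * ((s \<alpha> x * ?W x) * u x))" for x
    unfolding v'_def s_def by (simp add: sum_distrib_left mult_ac)
  have "(\<integral>x. v' x \<xi> \<partial>lborel) = 0"
  proof (rule integral_directional_derivative[where v = "\<lambda>x. u x * ?W x"])
    fix x
    have "((\<lambda>x. ?W x) has_derivative (\<lambda>h. of_real (reg_weight e x * (\<Sum>\<alpha>\<in>P. 2 * \<kappa> \<alpha> * (\<alpha> \<bullet> h) * ((\<alpha> \<bullet> x) / ((\<alpha> \<bullet> x)\<^sup>2 + e)))))) (at x)"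
      by (rule has_derivative_of_real[OF reg_weight_has_derivative[OF e(1)]])
    from has_derivative_mult[OF dunkl_regular_derivative[OF u(1)] this]
    show "((\<lambda>x. u x * ?W x) has_derivative v' x) (at x)"
      unfolding v'_def[abs_def] .
    show "exp_decay (\<lambda>x. u x * ?W x)" using exp_decay_mult[OF gW u(2)] by (simp add: mult.commute)
    show "exp_decay (\<lambda>x. v' x \<xi>)"
      unfolding v'_eq by (intro exp_decay_add dDW exp_decay_sum exp_decay_mult[OF exp_growth_const duWs])
  qed
  hence zero: "(\<integral>x. ?W x * ?D x \<partial>lborel) + (\<Sum>\<alpha>\<in>P. of_real (2 * \<kappa> \<alpha> * (\<alpha> \<bullet> \<xi>)) * (\<integral>x. (s \<alpha> x * ?W x) * u x \<partial>lborel)) = 0"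
    unfolding v'_eq by (simp add: Bochner_Integration.integral_add iDW iuWs Bochner_Integration.integral_sum)
  \<comment> \<open>\<open>s \<alpha>\<close> is odd under the reflection and the weight is
    invariant, so adding the reflected integrand produces the difference of \<open>u\<close>, that
    is \<open>\<alpha> \<bullet> x\<close> times its quotient. The 2 from the logarithmic derivative
    of the weight is consumed here.\<close>
  have half: "2 * (\<integral>x. (s \<alpha> x * ?W x) * u x \<partial>lborel)
      = (\<integral>x. refl_quotient \<alpha> u x * of_real ((\<alpha> \<bullet> x)\<^sup>2 / ((\<alpha> \<bullet> x)\<^sup>2 + e)) * ?W x \<partial>lborel)"
    and iq: "integrable lborel (\<lambda>x. refl_quotient \<alpha> u x * of_real ((\<alpha> \<bullet> x)\<^sup>2 / ((\<alpha> \<bullet> x)\<^sup>2 + e)) * ?W x)"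
    if "\<alpha> \<in> P" for \<alpha>
  proof -
    let ?F = "\<lambda>x. (s \<alpha> x * ?W x) * u x"
    have F: "integrable lborel ?F" by (rule iuWs) measurable
    have Fr: "integrable lborel (\<lambda>x. ?F (refl_along \<alpha> x))" by (rule integrable_refl_along[OF F])
    have eq: "?F x + ?F (refl_along \<alpha> x) = refl_quotient \<alpha> u x * of_real ((\<alpha> \<bullet> x)\<^sup>2 / ((\<alpha> \<bullet> x)\<^sup>2 + e)) * ?W x" for x
    proof -
      have "?F x + ?F (refl_along \<alpha> x) = s \<alpha> x * ?W x * (u x - u (refl_along \<alpha> x))"
      proof -
        have "s \<alpha> (refl_along \<alpha> x) = - s \<alpha> x" by (simp add: s_def)
        thus ?thesis by (simp add: reg_weight_refl P_in_R[OF that] algebra_simps)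
      qed
      also have "\<dots> = s \<alpha> x * of_real (\<alpha> \<bullet> x) * ?W x * refl_quotient \<alpha> u x"
        by (simp flip: inner_mult_refl_quotient)
      also have "s \<alpha> x * of_real (\<alpha> \<bullet> x) = of_real ((\<alpha> \<bullet> x)\<^sup>2 / ((\<alpha> \<bullet> x)\<^sup>2 + e))"
        unfolding s_def of_real_mult[symmetric] by (simp add: power2_eq_square)
      finally show ?thesis by (simp add: mult_ac)
    qed
    have "(\<integral>x. ?F x + ?F (refl_along \<alpha> x) \<partial>lborel) = (\<integral>x. ?F x \<partial>lborel) + (\<integral>x. ?F (refl_along \<alpha> x) \<partial>lborel)"
      by (rule Bochner_Integration.integral_add[OF F Fr])
    also have "(\<integral>x. ?F (refl_along \<alpha> x) \<partial>lborel) = (\<integral>x. ?F x \<partial>lborel)"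
      by (rule integral_refl_along) measurable
    finally show "2 * (\<integral>x. ?F x \<partial>lborel) = (\<integral>x. refl_quotient \<alpha> u x * of_real ((\<alpha> \<bullet> x)\<^sup>2 / ((\<alpha> \<bullet> x)\<^sup>2 + e)) * ?W x \<partial>lborel)"
      unfolding eq by simp
    show "integrable lborel (\<lambda>x. refl_quotient \<alpha> u x * of_real ((\<alpha> \<bullet> x)\<^sup>2 / ((\<alpha> \<bullet> x)\<^sup>2 + e)) * ?W x)"
      using Bochner_Integration.integrable_add[OF F Fr] unfolding eq .
  qed
  have "(\<Sum>\<alpha>\<in>P. of_real (2 * \<kappa> \<alpha> * (\<alpha> \<bullet> \<xi>)) * (\<integral>x. (s \<alpha> x * ?W x) * u x \<partial>lborel))
     = (\<Sum>\<alpha>\<in>P. of_real (\<kappa> \<alpha> * (\<alpha> \<bullet> \<xi>)) *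
         (\<integral>x. refl_quotient \<alpha> u x * of_real ((\<alpha> \<bullet> x)\<^sup>2 / ((\<alpha> \<bullet> x)\<^sup>2 + e)) * ?W x \<partial>lborel))"
  proof (rule sum.cong[OF refl])
    fix \<alpha> assume a: "\<alpha> \<in> P"
    have "of_real (2 * \<kappa> \<alpha> * (\<alpha> \<bullet> \<xi>)) * (\<integral>x. (s \<alpha> x * ?W x) * u x \<partial>lborel)
       = of_real (\<kappa> \<alpha> * (\<alpha> \<bullet> \<xi>)) * (2 * (\<integral>x. (s \<alpha> x * ?W x) * u x \<partial>lborel))"
      by simp
    thus "of_real (2 * \<kappa> \<alpha> * (\<alpha> \<bullet> \<xi>)) * (\<integral>x. (s \<alpha> x * ?W x) * u x \<partial>lborel)
       = of_real (\<kappa> \<alpha> * (\<alpha> \<bullet> \<xi>)) *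
         (\<integral>x. refl_quotient \<alpha> u x * of_real ((\<alpha> \<bullet> x)\<^sup>2 / ((\<alpha> \<bullet> x)\<^sup>2 + e)) * ?W x \<partial>lborel)"
      unfolding half[OF a] .
  qed
  with zero have "(\<integral>x. ?W x * ?D x \<partial>lborel) + (\<Sum>\<alpha>\<in>P. of_real (\<kappa> \<alpha> * (\<alpha> \<bullet> \<xi>)) *
      (\<integral>x. refl_quotient \<alpha> u x * of_real ((\<alpha> \<bullet> x)\<^sup>2 / ((\<alpha> \<bullet> x)\<^sup>2 + e)) * ?W x \<partial>lborel)) = 0"
    by (simp only:)
  moreover have "integrable lborel (\<lambda>x. ?W x * ?D x)" by (rule iDW) measurable
  ultimately have "(\<integral>x. ?W x * ?D x + (\<Sum>\<alpha>\<in>P. of_real (\<kappa> \<alpha> * (\<alpha> \<bullet> \<xi>)) *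
      (refl_quotient \<alpha> u x * of_real ((\<alpha> \<bullet> x)\<^sup>2 / ((\<alpha> \<bullet> x)\<^sup>2 + e)) * ?W x)) \<partial>lborel) = 0"
    using iq by (subst Bochner_Integration.integral_add)
      (auto simp: Bochner_Integration.integral_sum simp del: of_real_divide of_real_power of_real_mult)
  thus ?thesis
    by (simp only: distrib_right sum_distrib_right mult.assoc mult.commute[of _ "frechet_derivative u _ _"])
qed

lemma integral_T_W0:
  assumes u: "regular_with exp_decay u"
  shows "(\<integral>x. T \<xi> u x * of_real (W0 x) \<partial>lborel) = 0"
proof -
  note uu = regular_withD[OF u]
  let ?D = "\<lambda>x. frechet_derivative u (at x) \<xi>"
  let ?e = "\<lambda>n. 1 / real (Suc n)"
  define s where "s n x = (?D x + (\<Sum>\<alpha>\<in>P. of_real (\<kappa> \<alpha> * (\<alpha> \<bullet> \<xi>)) * refl_quotient \<alpha> u x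
     * of_real ((\<alpha> \<bullet> x)\<^sup>2 / ((\<alpha> \<bullet> x)\<^sup>2 + ?e n)))) * of_real (reg_weight (?e n) x)" for n x
  define w where "w x = (norm (?D x) + (\<Sum>\<alpha>\<in>P. \<bar>\<kappa> \<alpha> * (\<alpha> \<bullet> \<xi>)\<bar> * norm (refl_quotient \<alpha> u x))) * exp (growth_rate * norm x)" for x
  have mu [measurable]: "?D \<in> borel_measurable borel"
    by (rule directional_derivative_measurable[OF dunkl_regular_derivative[OF uu(1)]])
  have mq [measurable]: "refl_quotient \<alpha> u \<in> borel_measurable borel" if "\<alpha> \<in> P" for \<alpha>
    by (rule borel_measurable_continuous_onI[OF continuous_refl_quotient[OF uu(1) P_nonzero[OF that]]])
  have mT: "(\<lambda>x. T \<xi> u x) \<in> borel_measurable borel"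
    unfolding dunkl_op_def by measurable
  have gE: "exp_growth (\<lambda>x. of_real (exp (growth_rate * norm x)))"
    unfolding exp_growth_def by (intro exI[of _ 1] exI[of _ growth_rate]) simp
  have wi: "integrable lborel w"
  proof -
    have i: "integrable lborel (\<lambda>x. norm (f x) * exp (growth_rate * norm x))"
      if "exp_decay f" and [measurable]: "f \<in> borel_measurable borel" for f :: "real ^ 'n \<Rightarrow> complex"
    proof -
      have "integrable lborel (\<lambda>x. complex_of_real (exp (growth_rate * norm x)) * f x)"
        by (rule exp_decay_integrable[OF exp_decay_mult[OF gE that(1)]]) measurable
      from integrable_norm[OF this] show ?thesis by (simp add: norm_mult mult.commute)
    qed
    have "integrable lborel (\<lambda>x. norm (?D x) * exp (growth_rate * norm x) +
        (\<Sum>\<alpha>\<in>P. \<bar>\<kappa> \<alpha> * (\<alpha> \<bullet> \<xi>)\<bar> * (norm (refl_quotient \<alpha> u x) * exp (growth_rate * norm x))))"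
      using uu mu mq P_nonzero
      by (intro Bochner_Integration.integrable_add Bochner_Integration.integrable_sum integrable_mult_right i) auto
    thus ?thesis by (simp add: w_def[abs_def] distrib_right sum_distrib_right mult.assoc)
  qed
  have "(\<lambda>n. integral\<^sup>L lborel (s n)) \<longlonglongrightarrow> (\<integral>x. T \<xi> u x * of_real (W0 x) \<partial>lborel)"
  proof (rule integral_dominated_convergence[OF _ _ wi])
    show "(\<lambda>x. T \<xi> u x * complex_of_real (W0 x)) \<in> borel_measurable lborel"
      using mT by measurable
    have [measurable]: "reg_weight (?e n) \<in> borel_measurable borel" for n
      by (rule borel_measurable_reg_weight) simp
    show "s n \<in> borel_measurable lborel" for n
      unfolding s_def by measurable
    show "AE x in lborel. (\<lambda>n. s n x) \<longlonglongrightarrow> T \<xi> u x * of_real (W0 x)"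
    proof (rule AE_I2)
      fix x
      have W: "(\<lambda>n. complex_of_real (reg_weight (?e n) x)) \<longlonglongrightarrow> of_real (W0 x)"
        by (intro tendsto_of_real reg_weight_lim)
      have "(\<lambda>n. of_real (\<kappa> \<alpha> * (\<alpha> \<bullet> \<xi>)) * refl_quotient \<alpha> u x * (of_real ((\<alpha> \<bullet> x)\<^sup>2 / ((\<alpha> \<bullet> x)\<^sup>2 + ?e n)) * of_real (reg_weight (?e n) x)))
          \<longlonglongrightarrow> of_real (\<kappa> \<alpha> * (\<alpha> \<bullet> \<xi>)) * refl_quotient \<alpha> u x * of_real (W0 x)" if "\<alpha> \<in> P" for \<alpha>
      proof (cases "\<alpha> \<bullet> x = 0")
        \<comment> \<open>Here the ratio is 0 for all n instead of tending to 1. The limit is still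
          right: the weight vanishes at x if \<open>\<kappa> \<alpha>\<close> is nonzero, and the
          coefficient vanishes otherwise.\<close>
        case True
        have "dunkl_weight P \<kappa> x = 0" if "\<kappa> \<alpha> \<noteq> 0"
          unfolding dunkl_weight_def using \<open>\<alpha> \<in> P\<close> finite_P True that by (intro prod_zero bexI[of _ \<alpha>]) auto
        thus ?thesis using True by (cases "\<kappa> \<alpha> = 0") auto
      next
        case False
        have "(\<lambda>n. (\<alpha> \<bullet> x)\<^sup>2 / ((\<alpha> \<bullet> x)\<^sup>2 + ?e n)) \<longlonglongrightarrow> (\<alpha> \<bullet> x)\<^sup>2 / ((\<alpha> \<bullet> x)\<^sup>2 + 0)"
          using False by (intro tendsto_divide tendsto_add tendsto_const LIMSEQ_Suc[OF lim_1_over_n]) auto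
        hence "(\<lambda>n. complex_of_real ((\<alpha> \<bullet> x)\<^sup>2 / ((\<alpha> \<bullet> x)\<^sup>2 + ?e n))) \<longlonglongrightarrow> of_real 1"
          using False by (intro tendsto_of_real) simp
        from tendsto_mult[OF tendsto_const tendsto_mult[OF this W]] show ?thesis by simp
      qed
      hence "(\<lambda>n. ?D x * of_real (reg_weight (?e n) x) + (\<Sum>\<alpha>\<in>P. of_real (\<kappa> \<alpha> * (\<alpha> \<bullet> \<xi>)) * refl_quotient \<alpha> u x
            * (of_real ((\<alpha> \<bullet> x)\<^sup>2 / ((\<alpha> \<bullet> x)\<^sup>2 + ?e n)) * of_real (reg_weight (?e n) x))))
          \<longlonglongrightarrow> ?D x * of_real (W0 x) + (\<Sum>\<alpha>\<in>P. of_real (\<kappa> \<alpha> * (\<alpha> \<bullet> \<xi>)) * refl_quotient \<alpha> u x * of_real (W0 x))"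
        by (intro tendsto_add[OF tendsto_mult[OF tendsto_const W] tendsto_sum])
      thus "(\<lambda>n. s n x) \<longlonglongrightarrow> T \<xi> u x * of_real (W0 x)"
        unfolding s_def dunkl_op_def distrib_right sum_distrib_right mult.assoc .
    qed
    fix n
    show "AE x in lborel. norm (s n x) \<le> w x"
    proof (rule AE_I2)
      fix x :: "real ^ 'n"
      have r: "norm (complex_of_real ((\<alpha> \<bullet> x)\<^sup>2 / ((\<alpha> \<bullet> x)\<^sup>2 + ?e n))) \<le> 1" for \<alpha>
      proof -
        have p: "0 < (\<alpha> \<bullet> x)\<^sup>2 + ?e n" by (rule add_nonneg_pos) auto
        hence "\<bar>(\<alpha> \<bullet> x)\<^sup>2 / ((\<alpha> \<bullet> x)\<^sup>2 + ?e n)\<bar> = (\<alpha> \<bullet> x)\<^sup>2 / ((\<alpha> \<bullet> x)\<^sup>2 + ?e n)"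
          by (intro abs_of_nonneg divide_nonneg_pos) auto
        also have "\<dots> \<le> 1" using p by simp
        finally show ?thesis by (simp only: norm_of_real)
      qed
      have "norm (s n x) \<le> (norm (?D x) + (\<Sum>\<alpha>\<in>P. \<bar>\<kappa> \<alpha> * (\<alpha> \<bullet> \<xi>)\<bar> * norm (refl_quotient \<alpha> u x))) * reg_weight (?e n) x"
      proof -
        have "norm (?D x + (\<Sum>\<alpha>\<in>P. of_real (\<kappa> \<alpha> * (\<alpha> \<bullet> \<xi>)) * refl_quotient \<alpha> u x * of_real ((\<alpha> \<bullet> x)\<^sup>2 / ((\<alpha> \<bullet> x)\<^sup>2 + ?e n))))
           \<le> norm (?D x) + (\<Sum>\<alpha>\<in>P. \<bar>\<kappa> \<alpha> * (\<alpha> \<bullet> \<xi>)\<bar> * norm (refl_quotient \<alpha> u x))"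
        proof (intro order_trans[OF norm_triangle_ineq] add_left_mono sum_norm_le)
          fix \<alpha> assume "\<alpha> \<in> P"
          show "norm (of_real (\<kappa> \<alpha> * (\<alpha> \<bullet> \<xi>)) * refl_quotient \<alpha> u x * of_real ((\<alpha> \<bullet> x)\<^sup>2 / ((\<alpha> \<bullet> x)\<^sup>2 + ?e n)))
             \<le> \<bar>\<kappa> \<alpha> * (\<alpha> \<bullet> \<xi>)\<bar> * norm (refl_quotient \<alpha> u x)"
            unfolding norm_mult[of _ "of_real (_ / _)"] norm_mult[of "of_real _" "refl_quotient \<alpha> u x"] norm_of_real[of "\<kappa> \<alpha> * (\<alpha> \<bullet> \<xi>)"]
            by (intro mult_left_le r) auto
        qed
        thus ?thesis unfolding s_def norm_mult[of _ "of_real (reg_weight _ _)"]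
          using reg_weight_pos[of "?e n" x] by (simp add: mult_right_mono less_imp_le)
      qed
      also have "\<dots> \<le> w x"
        unfolding w_def by (intro mult_left_mono reg_weight_bound add_nonneg_nonneg sum_nonneg) auto
      finally show "norm (s n x) \<le> w x" .
    qed
  qed
  moreover have "integral\<^sup>L lborel (s n) = 0" for n
    unfolding s_def by (rule integral_T_reg_weight[OF u]) auto
  ultimately show ?thesis by (simp add: LIMSEQ_const_iff)
qed

section \<open>The Dunkl transform of a polynomial times a Gaussian\<close>

text \<open>The functional I, with -i replaced by a free scale \<open>c\<close>.\<close>

definition pairing :: "complex \<Rightarrow> real ^ 'n \<Rightarrow> (real ^ 'n \<Rightarrow> complex) \<Rightarrow> complex" where
  "pairing c y q = (\<integral>x. q x * (kernel c y x * gauss x) * of_real (W0 x) \<partial>lborel)"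

lemma regular_with_kernel_gauss: "regular_with exp_decay (\<lambda>x. kernel c y x * gauss x)"
  by (rule regular_with_mult[OF regular_with_kernel regular_with_gauss])

lemma integrable_W0:
  assumes "exp_growth q" "exp_decay f" and [measurable]: "q \<in> borel_measurable borel" "f \<in> borel_measurable borel"
  shows "integrable lborel (\<lambda>x. q x * f x * of_real (W0 x))"
proof -
  have "exp_decay (\<lambda>x. of_real (W0 x) * (q x * f x))"
    by (intro exp_decay_mult exp_growth_W0 assms)
  moreover have "(\<lambda>x. of_real (W0 x) * (q x * f x)) \<in> borel_measurable borel" by measurable
  ultimately have "integrable lborel (\<lambda>x. of_real (W0 x) * (q x * f x))" by (rule exp_decay_integrable)
  thus ?thesis by (simp only: mult.commute[of "complex_of_real _"])
qed

lemma hpoly_measurable: "hpoly n q \<Longrightarrow> q \<in> borel_measurable borel"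
  by (rule borel_measurable_continuous_onI[OF dunkl_regular_continuous[OF hpoly_regular]])

lemma pairing_integrable:
  assumes "hpoly n q"
  shows "integrable lborel (\<lambda>x. q x * (kernel c y x * gauss x) * of_real (W0 x))"
  by (intro integrable_W0 exp_growth_hpoly[OF assms] hpoly_measurable[OF assms]
      regular_withD(2)[OF regular_with_kernel_gauss]
      borel_measurable_continuous_onI[OF dunkl_regular_continuous[OF regular_withD(1)[OF regular_with_kernel_gauss]]])

lemma pairing_add:
  assumes "hpoly m p" "hpoly n q"
  shows "pairing c y (\<lambda>x. p x + q x) = pairing c y p + pairing c y q"
  unfolding pairing_def
  by (simp add: distrib_right Bochner_Integration.integral_add pairing_integrable[OF assms(1)] pairing_integrable[OF assms(2)]
      del: of_real_power)

lemma pairing_diff: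
  assumes "hpoly m p" "hpoly n q"
  shows "pairing c y (\<lambda>x. p x - q x) = pairing c y p - pairing c y q"
  unfolding pairing_def
  by (simp add: left_diff_distrib Bochner_Integration.integral_diff pairing_integrable[OF assms(1)] pairing_integrable[OF assms(2)]
      del: of_real_power)

lemma pairing_cmult: "pairing c y (\<lambda>x. k * q x) = k * pairing c y q"
  unfolding pairing_def by (simp add: mult.assoc)

lemma T_kernel_gauss:
  "T \<xi> (\<lambda>x. kernel c y x * gauss x) x = (c * of_real (y \<bullet> \<xi>) - of_real (\<xi> \<bullet> x)) * (kernel c y x * gauss x)"
proof -
  have "refl_quotient \<alpha> gauss x = 0" if "\<alpha> \<in> P" for \<alpha>
    using refl_quotient_gauss[OF P_nonzero[OF that]] by simp
  thus ?thesis
    unfolding T_mult[OF kernel_regular gauss_regular] T_kernel frechet_derivative_gauss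
    by (simp add: algebra_simps)
qed

text \<open>\<open>integral_T_W0\<close> is applied to q times the kernel times the Gaussian. The
  twisted Leibniz rule puts q at reflected points; invariance of the measure, the weight and the
  difference quotient moves it back, and the remaining terms reassemble to \<open>T \<xi>\<close>
  acting on the kernel times the Gaussian.\<close>

lemma pairing_inner_mult:
  assumes q: "hpoly n q"
  shows "pairing c y (\<lambda>x. of_real (\<xi> \<bullet> x) * q x) = pairing c y (T \<xi> q) + c * of_real (y \<bullet> \<xi>) * pairing c y q"
proof -
  define g where "g x = kernel c y x * gauss x" for x
  have rg: "regular_with exp_decay g" unfolding g_def[abs_def] by (rule regular_with_kernel_gauss)
  note g = regular_withD[OF rg]
  note rq = hpoly_regular[OF q]
  let ?D = "\<lambda>x. frechet_derivative g (at x) \<xi>" and ?Q = "\<lambda>\<alpha>. refl_quotient \<alpha> g"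
  have mg: "g \<in> borel_measurable borel"
    by (rule borel_measurable_continuous_onI[OF dunkl_regular_continuous[OF g(1)]])
  have mD: "?D \<in> borel_measurable borel"
    by (rule directional_derivative_measurable[OF dunkl_regular_derivative[OF g(1)]])
  have mQ: "?Q \<alpha> \<in> borel_measurable borel" if "\<alpha> \<in> P" for \<alpha>
    by (rule borel_measurable_continuous_onI[OF continuous_refl_quotient[OF g(1) P_nonzero[OF that]]])
  have iT: "integrable lborel (\<lambda>x. T \<xi> q x * g x * of_real (W0 x))"
    by (intro integrable_W0 exp_growth_hpoly[OF hpoly_T[OF q]] hpoly_measurable[OF hpoly_T[OF q]] g mg)
  have iD: "integrable lborel (\<lambda>x. q x * ?D x * of_real (W0 x))"
    by (intro integrable_W0 exp_growth_hpoly[OF q] hpoly_measurable[OF q] g mD)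
  have iQ: "integrable lborel (\<lambda>x. q x * ?Q \<alpha> x * of_real (W0 x))"
    and iQr: "integrable lborel (\<lambda>x. q (refl_along \<alpha> x) * ?Q \<alpha> x * of_real (W0 x))"
    and Qr: "(\<integral>x. q (refl_along \<alpha> x) * ?Q \<alpha> x * of_real (W0 x) \<partial>lborel) = (\<integral>x. q x * ?Q \<alpha> x * of_real (W0 x) \<partial>lborel)"
    if \<alpha>: "\<alpha> \<in> P" for \<alpha>
  proof -
    show i: "integrable lborel (\<lambda>x. q x * ?Q \<alpha> x * of_real (W0 x))"
      by (intro integrable_W0 exp_growth_hpoly[OF q] hpoly_measurable[OF q] g(4)[OF P_nonzero[OF \<alpha>]] mQ[OF \<alpha>])
    have eq: "q (refl_along \<alpha> x) * ?Q \<alpha> (refl_along \<alpha> x) * of_real (W0 (refl_along \<alpha> x))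
        = q (refl_along \<alpha> x) * ?Q \<alpha> x * of_real (W0 x)" for x
      by (simp add: refl_quotient_refl dunkl_weight_refl[OF P_in_R[OF \<alpha>]])
    show "integrable lborel (\<lambda>x. q (refl_along \<alpha> x) * ?Q \<alpha> x * of_real (W0 x))"
      using integrable_refl_along[OF i, of \<alpha>] unfolding eq .
    show "(\<integral>x. q (refl_along \<alpha> x) * ?Q \<alpha> x * of_real (W0 x) \<partial>lborel) = (\<integral>x. q x * ?Q \<alpha> x * of_real (W0 x) \<partial>lborel)"
    proof -
      have "(\<lambda>x. q x * ?Q \<alpha> x * complex_of_real (W0 x)) \<in> borel_measurable borel"
        using borel_measurable_integrable[OF i] by (simp del: of_real_power)
      from integral_refl_along[OF this, of \<alpha>] show ?thesis unfolding eq .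
    qed
  qed
  have "0 = (\<integral>x. T \<xi> (\<lambda>x. q x * g x) x * of_real (W0 x) \<partial>lborel)"
    by (rule integral_T_W0[OF regular_with_mult[OF regular_with_hpoly[OF q] rg], symmetric])
  also have "\<dots> = (\<integral>x. T \<xi> q x * g x * of_real (W0 x) + (q x * ?D x * of_real (W0 x)
      + (\<Sum>\<alpha>\<in>P. of_real (\<kappa> \<alpha> * (\<alpha> \<bullet> \<xi>)) * (q (refl_along \<alpha> x) * ?Q \<alpha> x * of_real (W0 x)))) \<partial>lborel)"
    by (simp only: T_mult[OF rq g(1)] distrib_right sum_distrib_right mult.assoc add.assoc)
  also have "\<dots> = (\<integral>x. T \<xi> q x * g x * of_real (W0 x) \<partial>lborel) + ((\<integral>x. q x * ?D x * of_real (W0 x) \<partial>lborel)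
      + (\<Sum>\<alpha>\<in>P. of_real (\<kappa> \<alpha> * (\<alpha> \<bullet> \<xi>)) * (\<integral>x. q (refl_along \<alpha> x) * ?Q \<alpha> x * of_real (W0 x) \<partial>lborel)))"
    using iT iD iQr by (simp add: Bochner_Integration.integral_sum del: of_real_power of_real_mult)
  also have "(\<Sum>\<alpha>\<in>P. of_real (\<kappa> \<alpha> * (\<alpha> \<bullet> \<xi>)) * (\<integral>x. q (refl_along \<alpha> x) * ?Q \<alpha> x * of_real (W0 x) \<partial>lborel))
      = (\<Sum>\<alpha>\<in>P. of_real (\<kappa> \<alpha> * (\<alpha> \<bullet> \<xi>)) * (\<integral>x. q x * ?Q \<alpha> x * of_real (W0 x) \<partial>lborel))"
    by (intro sum.cong refl) (simp only: Qr)
  also have "(\<integral>x. q x * ?D x * of_real (W0 x) \<partial>lborel) + \<dots>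
      = (\<integral>x. q x * ?D x * of_real (W0 x) + (\<Sum>\<alpha>\<in>P. of_real (\<kappa> \<alpha> * (\<alpha> \<bullet> \<xi>)) * (q x * ?Q \<alpha> x * of_real (W0 x))) \<partial>lborel)"
    using iD iQ by (simp add: Bochner_Integration.integral_sum del: of_real_power of_real_mult)
  also have "\<dots> = (\<integral>x. q x * T \<xi> g x * of_real (W0 x) \<partial>lborel)"
    by (simp only: dunkl_op_def distrib_left distrib_right sum_distrib_left sum_distrib_right mult_ac)
  also have "\<dots> = (\<integral>x. c * of_real (y \<bullet> \<xi>) * (q x * g x * of_real (W0 x))
       - of_real (\<xi> \<bullet> x) * q x * g x * of_real (W0 x) \<partial>lborel)"
    unfolding g_def T_kernel_gauss by (rule arg_cong[of _ _ "integral\<^sup>L lborel"]) (simp add: fun_eq_iff algebra_simps)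
  also have "\<dots> = c * of_real (y \<bullet> \<xi>) * pairing c y q - pairing c y (\<lambda>x. of_real (\<xi> \<bullet> x) * q x)"
    unfolding pairing_def g_def
    using pairing_integrable[OF q, of c y] pairing_integrable[OF hpoly_inner_mult[OF q, of \<xi>], of c y]
    by (subst Bochner_Integration.integral_diff) (simp_all del: of_real_power)
  finally show ?thesis
    unfolding pairing_def g_def by (simp add: algebra_simps)
qed

section \<open>Gaussian moments of the homogeneous parts and the value I(1)\<close>

lemma kernel_scale_0: "kernel 0 y x = 1"
proof -
  have "(\<lambda>n. 0 ^ n * kernel_part y n x) sums kernel_part y 0 x"
    using powser_sums_zero[of "\<lambda>n. kernel_part y n x"] by (simp only: mult.commute)
  from sums_unique2[OF kernel_sums this] show ?thesis by simp
qed

text \<open>With c = 0 the kernel factor is 1, so everything in the integrand except q is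
  invariant.\<close>

lemma pairing_refl:
  assumes "hpoly n q" "\<alpha> \<in> P"
  shows "pairing 0 y (\<lambda>x. q (refl_along \<alpha> x)) = pairing 0 y q"
proof -
  have "(\<lambda>x. q x * (kernel 0 y x * gauss x) * complex_of_real (W0 x)) \<in> borel_measurable borel"
    using borel_measurable_integrable[OF pairing_integrable[OF assms(1), of 0 y]] by simp
  from integral_refl_along[OF this, of \<alpha>] show ?thesis
    by (simp add: pairing_def kernel_scale_0 dunkl_weight_refl P_in_R[OF assms(2)])
qed

text \<open>Integrate the Euler equation: the terms with \<kappa> cancel by invariance, and
  \<open>pairing_inner_mult\<close> trades the factor \<open>y \<bullet> x\<close> for
  \<open>T y\<close>, which lowers the degree once more. The result is the two-step recursion of
  Gaussian moments.\<close>

lemma pairing_kernel_part_Suc: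
  "of_nat (Suc n) * pairing 0 z (kernel_part y (Suc n)) = (if n = 0 then 0 else of_real (y \<bullet> y) * pairing 0 z (kernel_part y (n - 1)))"
proof -
  let ?e = "kernel_part y (Suc n)"
  note h = hpoly_kernel_part[of "Suc n" y] and h' = hpoly_kernel_part[of n y]
  have hr: "hpoly (Suc n) (\<lambda>x. ?e (refl_along \<alpha> x))" for \<alpha> by (rule hpoly_refl[OF h])
  have psum: "pairing 0 z (\<lambda>x. \<Sum>\<alpha>\<in>P. of_real (\<kappa> \<alpha>) * (?e x - ?e (refl_along \<alpha> x))) = 0"
  proof -
    have "pairing 0 z (\<lambda>x. \<Sum>\<alpha>\<in>S. of_real (\<kappa> \<alpha>) * (?e x - ?e (refl_along \<alpha> x))) = 0"
      if "finite S" "S \<subseteq> P" for S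
      using that
    proof (induction S rule: finite_induct)
      case empty show ?case by (simp add: pairing_def)
    next
      case (insert \<alpha> S)
      have hs: "hpoly (Suc n) (\<lambda>x. \<Sum>\<alpha>\<in>S. of_real (\<kappa> \<alpha>) * (?e x - ?e (refl_along \<alpha> x)))"
        by (intro hpoly_sum hpoly_cmult hpoly_diff h hr)
      have hd: "hpoly (Suc n) (\<lambda>x. of_real (\<kappa> \<alpha>) * (?e x - ?e (refl_along \<alpha> x)))"
        by (intro hpoly_cmult hpoly_diff h hr)
      have "pairing 0 z (\<lambda>x. ?e x - ?e (refl_along \<alpha> x)) = 0"
        using insert.prems by (simp only: pairing_diff[OF h hr] pairing_refl[OF h] insert_subset diff_self)
      hence z0: "pairing 0 z (\<lambda>x. of_real (\<kappa> \<alpha>) * (?e x - ?e (refl_along \<alpha> x))) = 0"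
        by (simp only: pairing_cmult) simp
      have IH: "pairing 0 z (\<lambda>x. \<Sum>\<alpha>\<in>S. of_real (\<kappa> \<alpha>) * (?e x - ?e (refl_along \<alpha> x))) = 0"
        using insert.prems by (intro insert.IH) simp
      show ?case
        unfolding sum.insert[OF insert.hyps] pairing_add[OF hd hs] z0 IH by simp
    qed
    thus ?thesis using finite_P by blast
  qed
  have hs: "hpoly (Suc n) (\<lambda>x. \<Sum>\<alpha>\<in>P. of_real (\<kappa> \<alpha>) * (?e x - ?e (refl_along \<alpha> x)))"
    by (intro hpoly_sum hpoly_cmult hpoly_diff h hr)
  have "of_nat (Suc n) * pairing 0 z ?e
     = pairing 0 z (\<lambda>x. of_nat (Suc n) * ?e x + (\<Sum>\<alpha>\<in>P. of_real (\<kappa> \<alpha>) * (?e x - ?e (refl_along \<alpha> x))))"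
    by (simp only: pairing_add[OF hpoly_cmult[OF h] hs] psum pairing_cmult add_0_right)
  also have "\<dots> = pairing 0 z (\<lambda>x. of_real (y \<bullet> x) * kernel_part y n x)"
    by (simp only: kernel_part_Suc)
  also have "\<dots> = pairing 0 z (T y (kernel_part y n))"
    by (simp only: pairing_inner_mult[OF h']) simp
  also have "\<dots> = (if n = 0 then 0 else of_real (y \<bullet> y) * pairing 0 z (kernel_part y (n - 1)))"
    unfolding T_kernel_part by (simp add: pairing_cmult pairing_def[of _ _ "\<lambda>x. 0"])
  finally show ?thesis .
qed

definition total_mass :: complex where
  "total_mass = (\<integral>x. gauss x * of_real (W0 x) \<partial>lborel)"

lemma pairing_0: "pairing 0 z q = (\<integral>x. q x * gauss x * of_real (W0 x) \<partial>lborel)"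
  by (simp add: pairing_def kernel_scale_0)

lemma pairing_kernel_part_odd: "pairing 0 z (kernel_part y (2 * k + 1)) = 0"
proof (induction k)
  case 0 thus ?case using pairing_kernel_part_Suc[of 0 z y] by (simp del: kernel_part.simps)
next
  case (Suc k)
  have "of_nat (Suc (2 * k + 2)) * pairing 0 z (kernel_part y (Suc (2 * k + 2))) = 0"
    using pairing_kernel_part_Suc[of "2 * k + 2" z y] Suc by (simp del: kernel_part.simps of_nat_Suc)
  thus ?case by (simp del: kernel_part.simps of_nat_Suc)
qed

lemma pairing_kernel_part_even:
  "pairing 0 z (kernel_part y (2 * k)) = of_real (((norm y)\<^sup>2 / 2) ^ k / fact k) * total_mass"
proof (induction k)
  case 0 thus ?case by (simp add: pairing_0 total_mass_def)
next
  case (Suc k)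
  have "of_nat (2 * Suc k) * pairing 0 z (kernel_part y (2 * Suc k)) = of_real ((norm y)\<^sup>2) * pairing 0 z (kernel_part y (2 * k))"
    using pairing_kernel_part_Suc[of "2 * k + 1" z y]
    by (simp add: power2_norm_eq_inner del: kernel_part.simps of_nat_Suc of_real_power)
  also have "\<dots> = of_nat (2 * Suc k) * (of_real (((norm y)\<^sup>2 / 2) ^ Suc k / fact (Suc k)) * total_mass)"
  proof -
    have "real (2 * Suc k) = 2 * real (Suc k)" by simp
    hence "2 * N * (N ^ k / fact k) = real (2 * Suc k) * (N ^ Suc k / fact (Suc k))" for N :: real
      by (simp del: of_nat_Suc)
    from this[of "(norm y)\<^sup>2 / 2"]
    have "(norm y)\<^sup>2 * (((norm y)\<^sup>2 / 2) ^ k / fact k) = real (2 * Suc k) * (((norm y)\<^sup>2 / 2) ^ Suc k / fact (Suc k))"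
      by (simp del: of_nat_Suc power_Suc fact_Suc of_nat_mult)
    from arg_cong[OF this, of complex_of_real]
    have "of_real ((norm y)\<^sup>2) * complex_of_real (((norm y)\<^sup>2 / 2) ^ k / fact k)
      = of_nat (2 * Suc k) * of_real (((norm y)\<^sup>2 / 2) ^ Suc k / fact (Suc k))"
      by (simp only: of_real_mult of_real_of_nat_eq)
    thus ?thesis unfolding Suc mult.assoc[symmetric] by (rule arg_cong)
  qed
  finally have eq: "of_nat (2 * Suc k) * pairing 0 z (kernel_part y (2 * Suc k))
      = of_nat (2 * Suc k) * (of_real (((norm y)\<^sup>2 / 2) ^ Suc k / fact (Suc k)) * total_mass)" .
  have nz: "of_nat (2 * Suc k) \<noteq> (0 :: complex)" by (simp only: of_nat_eq_0_iff) simp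
  from eq show ?case unfolding mult_left_cancel[OF nz] .
qed

text \<open>The partial sums of the kernel are dominated by \<open>exp (L * norm x)\<close>, which
  stays integrable against the Gaussian and the weight.\<close>

lemma pairing_1_sums: "(\<lambda>n. c ^ n * pairing 0 z (kernel_part y n)) sums pairing c y (\<lambda>x. 1)"
proof -
  define L where "L = norm c * norm y"
  define s where "s N x = (\<Sum>n<N. c ^ n * kernel_part y n x) * gauss x * of_real (W0 x)" for N x
  define w where "w x = norm (complex_of_real (exp (L * norm x)) * gauss x * of_real (W0 x))" for x :: "real ^ 'n"
  have [measurable]: "kernel_part y n \<in> borel_measurable borel" for n
    by (rule hpoly_measurable[OF hpoly_kernel_part])
  have mg [measurable]: "gauss \<in> borel_measurable borel"
    by (rule borel_measurable_continuous_onI[OF dunkl_regular_continuous[OF gauss_regular]])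
  have mk [measurable]: "kernel c y \<in> borel_measurable borel"
    by (rule borel_measurable_continuous_onI[OF dunkl_regular_continuous[OF kernel_regular]])
  have "(\<lambda>N. integral\<^sup>L lborel (s N)) \<longlonglongrightarrow> (\<integral>x. kernel c y x * gauss x * of_real (W0 x) \<partial>lborel)"
  proof (rule integral_dominated_convergence)
    show "(\<lambda>x. kernel c y x * gauss x * complex_of_real (W0 x)) \<in> borel_measurable lborel"
      by measurable
    show "s N \<in> borel_measurable lborel" for N unfolding s_def by measurable
    have "exp_growth (\<lambda>x. complex_of_real (exp (L * norm x)))"
      unfolding exp_growth_def by (intro exI[of _ 1] exI[of _ L]) simp
    thus "integrable lborel w"
      unfolding w_def by (intro integrable_norm integrable_W0 exp_decay_gauss mg) measurable
    show "AE x in lborel. (\<lambda>N. s N x) \<longlonglongrightarrow> kernel c y x * gauss x * of_real (W0 x)"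
      unfolding s_def using kernel_sums[of c y]
      by (intro AE_I2 tendsto_mult tendsto_const) (simp add: sums_def)
    fix N
    show "AE x in lborel. norm (s N x) \<le> w x"
    proof (rule AE_I2)
      fix x :: "real ^ 'n"
      have "norm (\<Sum>n<N. c ^ n * kernel_part y n x) \<le> (\<Sum>n<N. (L * norm x) ^ n / fact n)"
        unfolding L_def
        by (intro sum_norm_le series_norm_bound[OF bpoly_kernel_term kernel_scale_nonneg])
      also have "\<dots> \<le> (\<Sum>n. (L * norm x) ^ n / fact n)"
        by (intro sum_le_suminf sums_summable[OF exp_real_sums]) (auto simp: L_def)
      also have "\<dots> = exp (L * norm x)" using exp_real_sums by (simp add: sums_iff)
      finally show "norm (s N x) \<le> w x"
        unfolding s_def w_def norm_mult by (intro mult_right_mono) auto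
    qed
  qed
  moreover have "integral\<^sup>L lborel (s N) = (\<Sum>n<N. c ^ n * pairing 0 z (kernel_part y n))" for N
  proof -
    have i: "integrable lborel (\<lambda>x. kernel_part y n x * gauss x * of_real (W0 x))" for n
      by (intro integrable_W0 exp_growth_hpoly[OF hpoly_kernel_part] exp_decay_gauss mg hpoly_measurable[OF hpoly_kernel_part])
    have "integral\<^sup>L lborel (s N) = (\<integral>x. (\<Sum>n<N. c ^ n * (kernel_part y n x * gauss x * of_real (W0 x))) \<partial>lborel)"
      unfolding s_def by (simp only: sum_distrib_right mult.assoc)
    also have "\<dots> = (\<Sum>n<N. c ^ n * pairing 0 z (kernel_part y n))"
      unfolding pairing_0 using i by (subst Bochner_Integration.integral_sum) (simp_all del: of_real_power)
    finally show ?thesis .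
  qed
  ultimately show ?thesis by (simp add: sums_def pairing_def)
qed

text \<open>Only even degrees contribute, and their moments form an exponential series. For c = -
  \<i> the result is the Gaussian in y.\<close>

lemma pairing_1: "pairing c y (\<lambda>x. 1) = exp (c\<^sup>2 * of_real ((norm y)\<^sup>2 / 2)) * total_mass"
proof -
  define N where "N = (norm y)\<^sup>2 / 2"
  let ?z = "c\<^sup>2 * of_real N"
  have s: "(\<lambda>k. ?z ^ k /\<^sub>R fact k * total_mass) sums (exp ?z * total_mass)"
    by (intro sums_mult2 exp_converges)
  have eq: "?z ^ k /\<^sub>R fact k * total_mass = c ^ (2 * k) * pairing 0 0 (kernel_part y (2 * k))" for k
    unfolding pairing_kernel_part_even N_def[symmetric] power_mult power_mult_distrib
    by (simp add: scaleR_conv_of_real divide_inverse)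
  have "c ^ n * pairing 0 0 (kernel_part y n) = 0" if "n \<notin> range (\<lambda>k. 2 * k)" for n
  proof -
    have "odd n" using that by (metis evenE rangeI)
    then obtain k where "n = 2 * k + 1" by (rule oddE)
    thus ?thesis by (simp only: pairing_kernel_part_odd mult_zero_right)
  qed
  moreover have "strict_mono (\<lambda>k :: nat. 2 * k)" by (simp add: strict_mono_def)
  ultimately have "(\<lambda>n. c ^ n * pairing 0 0 (kernel_part y n)) sums (exp ?z * total_mass)"
    using s[unfolded eq] sums_mono_reindex[of "\<lambda>k. 2 * k" "\<lambda>n. c ^ n * pairing 0 0 (kernel_part y n)"] by blast
  from sums_unique2[OF pairing_1_sums this] show ?thesis by (simp only: N_def)
qed

lemma total_mass_eq: "total_mass = of_real (\<integral>x. W0 x * exp (- (norm x)\<^sup>2 / 2) \<partial>lborel)"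
  unfolding total_mass_def gauss_def of_real_mult[symmetric] by (simp only: integral_complex_of_real mult.commute)

text \<open>\<open>inverse\<close> and the Bochner integral both default to 0, so the integral must
  be shown to exist and to be nonzero: the weight vanishes at most on finitely many hyperplanes, a
  null set.\<close>

lemma dunkl_const_total_mass: "of_real (dunkl_const P \<kappa>) * total_mass = 1"
proof -
  let ?f = "\<lambda>x. W0 x * exp (- (norm x)\<^sup>2 / 2)"
  have "integrable lborel (\<lambda>x. (1 :: complex) * gauss x * of_real (W0 x))"
    by (intro integrable_W0 exp_growth_const exp_decay_gauss
        borel_measurable_continuous_onI[OF dunkl_regular_continuous[OF gauss_regular]]) simp
  hence "integrable lborel (\<lambda>x. complex_of_real (?f x))"
    by (simp add: gauss_def mult.commute)
  hence i: "integrable lborel ?f" by (simp only: complex_of_real_integrable_eq)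
  have nz: "integral\<^sup>L lborel ?f \<noteq> 0"
  proof
    assume "integral\<^sup>L lborel ?f = 0"
    hence "AE x in lborel. ?f x = 0"
      using integral_nonneg_eq_0_iff_AE[OF i] by simp
    hence z: "AE x in lborel. dunkl_weight P \<kappa> x = 0" by simp
    have "AE x in lborel. \<alpha> \<bullet> x \<noteq> 0" if "\<alpha> \<in> P" for \<alpha>
    proof -
      have "negligible {x. \<alpha> \<bullet> x = 0}" using P_nonzero[OF that] by (intro negligible_hyperplane) simp
      hence "{x. \<alpha> \<bullet> x = 0} \<in> null_sets lborel"
        by (simp add: negligible_iff_null_sets null_sets_completion_iff closed_hyperplane borel_closed)
      thus ?thesis by (rule AE_I'[of _ _ "\<lambda>x. \<alpha> \<bullet> x \<noteq> 0"]) auto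
    qed
    hence "AE x in lborel. \<forall>\<alpha>\<in>P. \<alpha> \<bullet> x \<noteq> 0" using finite_P by (simp add: AE_finite_all)
    hence "AE x in lborel. dunkl_weight P \<kappa> x \<noteq> 0"
    proof eventually_elim
      case (elim x)
      thus ?case using finite_P by (auto simp: dunkl_weight_def)
    qed
    from eventually_conj[OF this z] have "AE x in lborel. x \<notin> (UNIV :: (real ^ 'n) set)"
      by (rule eventually_mono) simp
    hence "(UNIV :: (real ^ 'n) set) \<in> null_sets lborel"
      by (subst AE_iff_null_sets) auto
    thus False by (simp add: null_sets_def emeasure_lborel_UNIV)
  qed
  show ?thesis unfolding total_mass_eq dunkl_const_def
    by (simp only: of_real_mult[symmetric] left_inverse[OF nz] of_real_1)
qed

end

section \<open>Homogeneous polynomial functions\<close>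

lemma hpoly_homogeneous: "hpoly n f \<Longrightarrow> f (t *\<^sub>R x) = of_real (t ^ n) * f x"
  by (induction rule: hpoly_induct) (auto simp: algebra_simps)

lemma hpoly_mult:
  assumes "hpoly m f" "hpoly n g" shows "hpoly (m + n) (\<lambda>x. f x * g x)"
  using assms(1)
proof (induction rule: hpoly_induct)
  case (inner_mult m f u)
  from hpoly_inner_mult[OF inner_mult.IH, of u] show ?case by (simp add: mult.assoc)
next
  case (add m f1 f2)
  from hpoly_add[OF add.IH] show ?case by (simp add: distrib_right)
next
  case (cmult m f c)
  from hpoly_cmult[OF cmult.IH, of c] show ?case by (simp add: mult.assoc)
qed (use hpoly_cmult[OF assms(2)] in simp)

inductive graded :: "(real ^ 'n \<Rightarrow> complex) \<Rightarrow> bool" where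
  hpoly: "hpoly n f \<Longrightarrow> graded f"
| add: "graded f \<Longrightarrow> graded g \<Longrightarrow> graded (\<lambda>x. f x + g x)"

lemma graded_mult:
  assumes "graded f" "graded g" shows "graded (\<lambda>x. f x * g x)"
  using assms(1)
proof (induction rule: graded.induct)
  case (hpoly m f)
  show ?case using assms(2)
  proof (induction rule: graded.induct)
    case (hpoly n g)
    show ?case by (rule graded.hpoly[OF hpoly_mult]) fact+
  next
    case (add g1 g2)
    from graded.add[OF add.IH] show ?case by (simp add: distrib_left)
  qed
next
  case (add f1 f2)
  from graded.add[OF add.IH] show ?case by (simp add: distrib_right)
qed

lemma graded_real_polynomial:
  "real_polynomial_function f \<Longrightarrow> graded (\<lambda>x :: real ^ 'n. complex_of_real (f x))"
proof (induction rule: real_polynomial_function.induct)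
  case (linear f)
  have lin: "linear f" using linear by (rule bounded_linear.linear)
  have "f x = adjoint f 1 \<bullet> x" for x
    using adjoint_works[OF lin, of x 1] by (simp add: inner_commute)
  hence "(\<lambda>x. complex_of_real (f x)) = (\<lambda>x. of_real (adjoint f 1 \<bullet> x) * 1)" by simp
  thus ?case using graded.hpoly[OF hpoly_inner_mult[OF hpoly_const]] by metis
next
  case (const c)
  show ?case by (rule graded.hpoly[OF hpoly_const])
next
  case (add f g)
  thus ?case using graded.add by simp
next
  case (mult f g)
  thus ?case using graded_mult by simp
qed

text \<open>The decomposition is claimed for all M beyond some N so that two of them can be added at
  a common length.\<close>

lemma graded_components:
  assumes "graded f"
  shows "\<exists>q. (\<forall>k. hpoly k (q k)) \<and> (\<exists>N. \<forall>M\<ge>N. \<forall>x. f x = (\<Sum>k<M. q k x))"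
  using assms
proof (induction rule: graded.induct)
  case (hpoly n f)
  have "f x = (\<Sum>k<M. (if k = n then f else (\<lambda>x. 0)) x)" if "Suc n \<le> M" for M x
  proof -
    have "(\<Sum>k<M. (if k = n then f else (\<lambda>x. 0)) x) = (\<Sum>k<M. if k = n then f x else 0)"
      by (intro sum.cong) auto
    thus ?thesis using that by (simp add: sum.delta)
  qed
  thus ?case using hpoly
    by (intro exI[of _ "\<lambda>k. if k = n then f else (\<lambda>x. 0)"] conjI exI[of _ "Suc n"]) (auto simp: hpoly_zero)
next
  case (add f g)
  then obtain q N q' N' where q: "\<And>k. hpoly k (q k)" "\<And>M x. M \<ge> N \<Longrightarrow> f x = (\<Sum>k<M. q k x)"
    and q': "\<And>k. hpoly k (q' k)" "\<And>M x. M \<ge> N' \<Longrightarrow> g x = (\<Sum>k<M. q' k x)" by metis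
  show ?case
  proof (intro exI[of _ "\<lambda>k x. q k x + q' k x"] conjI exI[of _ "max N N'"] allI impI)
    show "hpoly k (\<lambda>x. q k x + q' k x)" for k by (rule hpoly_add[OF q(1) q'(1)])
    fix M x assume "max N N' \<le> M"
    hence "N \<le> M" "N' \<le> M" by auto
    thus "f x + g x = (\<Sum>k<M. q k x + q' k x)" by (simp only: sum.distrib q(2) q'(2))
  qed
qed

text \<open>A polynomial function is a finite sum of homogeneous parts. On each line through the
  origin, p is a polynomial in t with only the power m, so p coincides with its part of degree
  m.\<close>

lemma homogeneous_polynomial_hpoly:
  assumes "homogeneous_polynomial m p" shows "hpoly m p"
proof -
  have pp: "polynomial_function p" and hom: "\<And>t x. p (t *\<^sub>R x) = of_real (t ^ m) * p x"
    using assms unfolding homogeneous_polynomial_def by auto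
  have Re: "real_polynomial_function (\<lambda>x. Re (p x))" and Im: "real_polynomial_function (\<lambda>x. Im (p x))"
    using pp bounded_linear_Re bounded_linear_Im unfolding polynomial_function_def o_def by blast+
  have "graded (\<lambda>x. of_real (Re (p x)) + \<i> * of_real (Im (p x)))"
    by (intro graded.add graded_mult graded_real_polynomial Re Im graded.hpoly[OF hpoly_const])
  hence "graded p" by (simp add: complex_eq[symmetric])
  then obtain q N where q: "\<And>k. hpoly k (q k)" and N: "\<And>M x. M \<ge> N \<Longrightarrow> p x = (\<Sum>k<M. q k x)"
    using graded_components by metis
  have "p x = q m x" for x
  proof -
    define M where "M = max N m"
    \<comment> \<open>Coefficients, as a polynomial in t, of the expansion of
      \<open>p (t *\<^sub>R x)\<close> minus \<open>t ^ m * p x\<close>; every real t is a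
      root.\<close>
    define c where "c k = q k x - (if k = m then p x else 0)" for k
    have zero: "(\<Sum>k\<le>M. c k * of_real t ^ k) = 0" for t :: real
    proof -
      have 1: "(\<Sum>k\<le>M. q k x * of_real t ^ k) = of_real (t ^ m) * p x"
        using N[of "Suc M" "t *\<^sub>R x"] by (simp add: hom hpoly_homogeneous[OF q] M_def lessThan_Suc_atMost mult.commute)
      have 2: "(\<Sum>k\<le>M. (if k = m then p x else 0) * of_real t ^ k) = of_real (t ^ m) * p x"
      proof -
        have "(\<Sum>k\<le>M. (if k = m then p x else 0) * of_real t ^ k) = (\<Sum>k\<le>M. if k = m then p x * of_real t ^ m else 0)"
          by (intro sum.cong) auto
        thus ?thesis by (simp add: M_def sum.delta)
      qed
      show ?thesis
        unfolding c_def left_diff_distrib sum_subtractf 1 2 by simp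
    qed
    have "c m = 0"
    proof (rule ccontr)
      assume "c m \<noteq> 0"
      hence "finite {z. (\<Sum>k\<le>M. c k * z ^ k) = 0}"
        by (rule polyfun_roots_finite) (simp add: M_def)
      moreover have "range complex_of_real \<subseteq> {z. (\<Sum>k\<le>M. c k * z ^ k) = 0}" using zero by auto
      ultimately have "finite (range complex_of_real)" by (rule rev_finite_subset)
      hence "finite (UNIV :: real set)" by (rule finite_imageD) (simp add: inj_on_def)
      thus False using infinite_UNIV_char_0 by blast
    qed
    thus ?thesis by (simp add: c_def)
  qed
  thus ?thesis using q[of m] by (metis ext)
qed

section \<open>The Dunkl Laplacian\<close>

context dunkl begin

abbreviation Lap :: "(real ^ 'n \<Rightarrow> complex) \<Rightarrow> real ^ 'n \<Rightarrow> complex" where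
  "Lap \<equiv> dunkl_laplacian P \<kappa>"

lemma hpoly_Lap: "hpoly n f \<Longrightarrow> hpoly (n - 1 - 1) (Lap f)"
  unfolding dunkl_laplacian_def[abs_def] by (intro hpoly_sum hpoly_T)

lemma Lap_small:
  assumes "hpoly n f" "n < 2" shows "Lap f = (\<lambda>x. 0)"
proof -
  have "hpoly 0 (T \<xi> f)" for \<xi>
  proof -
    have "n - 1 = 0" using assms(2) by simp
    thus ?thesis using hpoly_T[OF assms(1), of \<xi>] by (simp only:)
  qed
  thus ?thesis unfolding dunkl_laplacian_def[abs_def] by (simp add: T_hpoly_0)
qed

lemma Lap_add:
  assumes "hpoly m f" "hpoly n g"
  shows "Lap (\<lambda>x. f x + g x) = (\<lambda>x. Lap f x + Lap g x)"
  unfolding dunkl_laplacian_def[abs_def]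
  by (simp add: T_add[OF assms[THEN hpoly_regular]] T_add[OF hpoly_regular[OF hpoly_T[OF assms(1)]] hpoly_regular[OF hpoly_T[OF assms(2)]]] sum.distrib)

lemma Lap_cmult: "hpoly n f \<Longrightarrow> Lap (\<lambda>x. c * f x) = (\<lambda>x. c * Lap f x)"
  unfolding dunkl_laplacian_def[abs_def]
  by (simp add: T_cmult hpoly_regular hpoly_T[THEN hpoly_regular] sum_distrib_left)

lemma T_Lap:
  assumes "hpoly n f" shows "T u (Lap f) = Lap (T u f)"
proof -
  have "T u (Lap f) = (\<lambda>x. \<Sum>j\<in>UNIV. T u (T (axis j 1) (T (axis j 1) f)) x)"
    unfolding dunkl_laplacian_def[abs_def] by (rule T_sum[OF hpoly_regular[OF hpoly_T[OF hpoly_T[OF assms]]]])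
  thus ?thesis
    unfolding dunkl_laplacian_def[abs_def] T_commute[OF hpoly_T[OF assms], of u] T_commute[OF assms, of u] .
qed

text \<open>Take both directions equal to \<open>axis j 1\<close> in \<open>T_T_inner_mult\<close>
  and sum over j. At each reflected point the terms become twice \<open>T \<alpha> f\<close> minus
  twice \<open>T \<alpha> f\<close>, since the squared coordinates of \<alpha> add up to
  \<open>\<alpha> \<bullet> \<alpha>\<close>.\<close>

lemma Lap_inner_mult:
  assumes "hpoly n f"
  shows "Lap (\<lambda>x. of_real (u \<bullet> x) * f x) = (\<lambda>x. of_real (u \<bullet> x) * Lap f x + 2 * T u f x)"
proof
  fix x
  let ?b = "\<lambda>j. axis j 1 :: real ^ 'n"
  have b: "v \<bullet> ?b j = v $ j" for v j by (simp add: inner_axis)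
  have expand: "(\<Sum>j\<in>UNIV. of_real (v $ j) * T (?b j) f z) = T v f z" for v z
    by (rule T_expand[OF dunkl_regular_differentiable[OF hpoly_regular[OF assms]], symmetric])
  have "(\<Sum>j\<in>UNIV. of_real (v $ j) * T (?b j) f z + of_real (v $ j) * T (?b j) f z
      - of_real (2 * (v $ j) * (v $ j) / (v \<bullet> v)) * T v f z) = 0" if "v \<noteq> 0" for v z
  proof -
    have "(\<Sum>j\<in>UNIV. complex_of_real (2 * (v $ j) * (v $ j) / (v \<bullet> v))) = of_real (\<Sum>j\<in>UNIV. 2 * (v $ j) * (v $ j) / (v \<bullet> v))"
      by simp
    also have "(\<Sum>j\<in>UNIV. 2 * (v $ j) * (v $ j) / (v \<bullet> v)) = 2 * (v \<bullet> v) / (v \<bullet> v)"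
      by (simp add: inner_vec_def sum_distrib_left sum_divide_distrib mult.assoc)
    also have "\<dots> = 2" using that by simp
    finally have 2: "(\<Sum>j\<in>UNIV. complex_of_real (2 * (v $ j) * (v $ j) / (v \<bullet> v))) = 2" by simp
    show ?thesis
      unfolding sum_subtractf sum.distrib expand sum_distrib_right[symmetric] 2 by simp
  qed
  hence "(\<Sum>\<alpha>\<in>P. of_real (2 * \<kappa> \<alpha> / (\<alpha> \<bullet> \<alpha>) * (\<alpha> \<bullet> u)) * (\<Sum>j\<in>UNIV. of_real (\<alpha> $ j) * T (?b j) f (refl_along \<alpha> x)
      + of_real (\<alpha> $ j) * T (?b j) f (refl_along \<alpha> x) - of_real (2 * (\<alpha> $ j) * (\<alpha> $ j) / (\<alpha> \<bullet> \<alpha>)) * T \<alpha> f (refl_along \<alpha> x))) = 0"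
    using P_nonzero by (intro sum.neutral) simp
  hence z: "(\<Sum>j\<in>UNIV. \<Sum>\<alpha>\<in>P. of_real (2 * \<kappa> \<alpha> / (\<alpha> \<bullet> \<alpha>) * (\<alpha> \<bullet> u)) * (of_real (\<alpha> $ j) * T (?b j) f (refl_along \<alpha> x)
      + of_real (\<alpha> $ j) * T (?b j) f (refl_along \<alpha> x) - of_real (2 * (\<alpha> $ j) * (\<alpha> $ j) / (\<alpha> \<bullet> \<alpha>)) * T \<alpha> f (refl_along \<alpha> x))) = 0"
    unfolding sum_distrib_left by (subst sum.swap)
  have "Lap (\<lambda>x. of_real (u \<bullet> x) * f x) x = (\<Sum>j\<in>UNIV. of_real (u \<bullet> x) * T (?b j) (T (?b j) f) x)
      + (\<Sum>j\<in>UNIV. of_real (u $ j) * T (?b j) f x) + (\<Sum>j\<in>UNIV. of_real (u $ j) * T (?b j) f x)"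
    unfolding dunkl_laplacian_def T_T_inner_mult[OF assms] b sum.distrib z by simp
  thus "Lap (\<lambda>x. of_real (u \<bullet> x) * f x) x = of_real (u \<bullet> x) * Lap f x + 2 * T u f x"
    unfolding expand by (simp add: dunkl_laplacian_def sum_distrib_left)
qed

section \<open>Powers of the Laplacian and its heat operator\<close>

lemma hpoly_Lap_pow: "hpoly n f \<Longrightarrow> hpoly (n - 2 * j) ((Lap ^^ j) f)"
proof (induction j)
  case (Suc j)
  have "n - 2 * Suc j = n - 2 * j - 1 - 1" by simp
  thus ?case using hpoly_Lap[OF Suc.IH[OF Suc.prems]] by simp
qed simp

lemma Lap_pow_zero: "(Lap ^^ j) (\<lambda>x. 0) = (\<lambda>x. 0)"
proof (induction j)
  case (Suc j)
  have "Lap (\<lambda>x. 0) = (\<lambda>x. 0)" by (rule Lap_small[OF hpoly_zero[of 0]]) simp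
  thus ?case using Suc by simp
qed simp

lemma Lap_pow_vanish:
  assumes "hpoly n f" "n < 2 * j" shows "(Lap ^^ j) f = (\<lambda>x. 0)"
proof -
  obtain i where i: "j = Suc i" using assms(2) by (cases j) auto
  show ?thesis
    using assms(2) Lap_small[OF hpoly_Lap_pow[OF assms(1), of i]] by (simp add: i)
qed

lemma Lap_pow_add:
  assumes "hpoly n f" "hpoly n g"
  shows "(Lap ^^ j) (\<lambda>x. f x + g x) = (\<lambda>x. (Lap ^^ j) f x + (Lap ^^ j) g x)"
  by (induction j) (simp_all add: Lap_add[OF hpoly_Lap_pow[OF assms(1)] hpoly_Lap_pow[OF assms(2)]])

lemma Lap_pow_cmult:
  assumes "hpoly n f" shows "(Lap ^^ j) (\<lambda>x. c * f x) = (\<lambda>x. c * (Lap ^^ j) f x)"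
  by (induction j) (simp_all add: Lap_cmult[OF hpoly_Lap_pow[OF assms]])

lemma T_Lap_pow:
  assumes "hpoly n f" shows "T u ((Lap ^^ j) f) = (Lap ^^ j) (T u f)"
  by (induction j) (simp_all add: T_Lap[OF hpoly_Lap_pow[OF assms]])

text \<open>Iterated commutator: each factor of the Laplacian contributes 2 \<open>T u\<close>, and
  \<open>T u\<close> commutes with the Laplacian.\<close>

lemma Lap_pow_inner_mult:
  assumes f: "hpoly n f"
  shows "(Lap ^^ Suc j) (\<lambda>x. of_real (u \<bullet> x) * f x)
     = (\<lambda>x. of_real (u \<bullet> x) * (Lap ^^ Suc j) f x + 2 * of_nat (Suc j) * (Lap ^^ j) (T u f) x)"
proof (induction j)
  case 0
  show ?case using Lap_inner_mult[OF f, of u] by simp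
next
  case (Suc j)
  let ?g = "(Lap ^^ Suc j) f" and ?t = "(Lap ^^ j) (T u f)"
  have g: "hpoly (n - 2 * Suc j) ?g" by (rule hpoly_Lap_pow[OF f])
  have t: "hpoly (n - 1 - 2 * j) ?t" by (rule hpoly_Lap_pow[OF hpoly_T[OF f]])
  have "(Lap ^^ Suc (Suc j)) (\<lambda>x. of_real (u \<bullet> x) * f x) = Lap (\<lambda>x. of_real (u \<bullet> x) * ?g x + 2 * of_nat (Suc j) * ?t x)"
    using Suc by simp
  also have "\<dots> = (\<lambda>x. (of_real (u \<bullet> x) * Lap ?g x + 2 * T u ?g x) + 2 * of_nat (Suc j) * Lap ?t x)"
    by (simp only: Lap_add[OF hpoly_inner_mult[OF g] hpoly_cmult[OF t]] Lap_inner_mult[OF g] Lap_cmult[OF t])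
  also have "T u ?g = Lap ?t" using T_Lap_pow[OF f, of u "Suc j"] by simp
  finally show ?case by (simp add: fun_eq_iff algebra_simps)
qed

definition heat :: "nat \<Rightarrow> (real ^ 'n \<Rightarrow> complex) \<Rightarrow> real ^ 'n \<Rightarrow> complex" where
  "heat m f y = (\<Sum>j = 0..m div 2. (- 1) ^ j / (2 ^ j * fact j) * (Lap ^^ j) f y)"

text \<open>As \<open>\<Delta>\<^sup>j\<close> kills polynomials of degree below \<open>2 j\<close>, the range of summation in \<open>heat\<close> may be enlarged;
  this makes \<open>[e\<^sup>-\<^sup>\<Delta>\<^sup>/\<^sup>2, \<langle>u, x\<rangle>] = -T\<^sub>u e\<^sup>-\<^sup>\<Delta>\<^sup>/\<^sup>2\<close> an identity of finite sums.\<close>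

lemma heat_eq:
  assumes "hpoly m f" "m \<le> N"
  shows "heat m f y = (\<Sum>j<Suc N. (- 1) ^ j / (2 ^ j * fact j) * (Lap ^^ j) f y)"
  unfolding heat_def
proof (rule sum.mono_neutral_left)
  show "\<forall>j\<in>{..<Suc N} - {0..m div 2}. (- 1) ^ j / (2 ^ j * fact j) * (Lap ^^ j) f y = 0"
  proof
    fix j assume "j \<in> {..<Suc N} - {0..m div 2}"
    hence "m < 2 * j" by auto
    thus "(- 1) ^ j / (2 ^ j * fact j) * (Lap ^^ j) f y = 0"
      by (simp add: Lap_pow_vanish[OF assms(1)])
  qed
qed (use assms(2) in auto)

lemma heat_inner_mult:
  assumes f: "hpoly m f"
  shows "heat (Suc m) (\<lambda>x. of_real (u \<bullet> x) * f x) y = of_real (u \<bullet> y) * heat m f y - heat (m - 1) (T u f) y"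
proof -
  define a :: "nat \<Rightarrow> complex" where "a j = (- 1) ^ j / (2 ^ j * fact j)" for j
  \<comment> \<open>The recursion of the coefficients of exp(-t/2); it turns the factor 2(j + 1) of
    the commutator into a sign.\<close>
  have a: "a (Suc j) * (2 * of_nat (Suc j)) = - a j" for j
  proof -
    have nz: "of_nat (Suc j) \<noteq> (0 :: complex)" by (simp del: of_nat_Suc)
    have "a (Suc j) * (2 * of_nat (Suc j)) = - ((-1) ^ j * (2 * of_nat (Suc j))) / (2 * 2 ^ j * (of_nat (Suc j) * fact j))"
      by (simp add: a_def del: of_nat_Suc)
    also have "\<dots> = - a j" using nz by (simp add: a_def del: of_nat_Suc)
    finally show ?thesis .
  qed
  have "heat (Suc m) (\<lambda>x. of_real (u \<bullet> x) * f x) y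
      = (\<Sum>j<Suc (Suc m). a j * (Lap ^^ j) (\<lambda>x. of_real (u \<bullet> x) * f x) y)"
    unfolding a_def by (rule heat_eq[OF hpoly_inner_mult[OF f]]) simp
  also have "\<dots> = a 0 * (of_real (u \<bullet> y) * f y) + (\<Sum>j<Suc m. a (Suc j) * (Lap ^^ Suc j) (\<lambda>x. of_real (u \<bullet> x) * f x) y)"
    by (subst sum.lessThan_Suc_shift) simp
  also have "(\<Sum>j<Suc m. a (Suc j) * (Lap ^^ Suc j) (\<lambda>x. of_real (u \<bullet> x) * f x) y)
      = (\<Sum>j<Suc m. a (Suc j) * (of_real (u \<bullet> y) * (Lap ^^ Suc j) f y)) + (\<Sum>j<Suc m. a (Suc j) * (2 * of_nat (Suc j)) * (Lap ^^ j) (T u f) y)"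
    unfolding Lap_pow_inner_mult[OF f] distrib_left sum.distrib mult.assoc ..
  also have "(\<Sum>j<Suc m. a (Suc j) * (2 * of_nat (Suc j)) * (Lap ^^ j) (T u f) y) = - (\<Sum>j<Suc m. a j * (Lap ^^ j) (T u f) y)"
    unfolding a by (simp add: sum_negf del: sum.lessThan_Suc)
  also have "(\<Sum>j<Suc m. a j * (Lap ^^ j) (T u f) y) = heat (m - 1) (T u f) y"
    unfolding a_def by (rule heat_eq[OF hpoly_T[OF f], symmetric]) simp
  finally have "heat (Suc m) (\<lambda>x. of_real (u \<bullet> x) * f x) y
     = of_real (u \<bullet> y) * (a 0 * f y + (\<Sum>j<Suc m. a (Suc j) * (Lap ^^ Suc j) f y)) - heat (m - 1) (T u f) y"
    by (simp only: distrib_left sum_distrib_left mult.left_commute[of "a _"] add.assoc diff_conv_add_uminus)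
  also have "a 0 * f y + (\<Sum>j<Suc m. a (Suc j) * (Lap ^^ Suc j) f y) = (\<Sum>j<Suc (Suc m). a j * (Lap ^^ j) f y)"
    by (subst (2) sum.lessThan_Suc_shift) simp
  also have "\<dots> = heat m f y"
    unfolding a_def by (rule heat_eq[OF f, symmetric]) simp
  finally show ?thesis .
qed

text \<open>At c = - \<i> both sides obey the same recursion when a linear factor is split off, by
  \<open>pairing_inner_mult\<close> and \<open>heat_inner_mult\<close>.\<close>

lemma pairing_eq_heat:
  "hpoly m f \<Longrightarrow> pairing (- \<i>) y f = (- \<i>) ^ m * heat m f y * pairing (- \<i>) y (\<lambda>x. 1)"
proof (induction m arbitrary: f rule: less_induct)
  case (less m)
  \<comment> \<open>Splitting off a linear factor calls for the formula for \<open>T u f\<close>,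
    which is not among the constituents of the polynomial; lower degrees therefore come from the
    outer strong induction, and the structural one only covers degree m.\<close>
  have "n = m \<Longrightarrow> pairing (- \<i>) y f = (- \<i>) ^ m * heat m f y * pairing (- \<i>) y (\<lambda>x. 1)" if "hpoly n f" for n f
    using that
  proof (induction rule: hpoly_induct)
    case (const c)
    thus ?case using pairing_cmult[of "- \<i>" y c "\<lambda>x. 1"] by (simp add: heat_def)
  next
    case (inner_mult n f u)
    let ?I = "pairing (- \<i>) y (\<lambda>x. 1)"
    have IH: "pairing (- \<i>) y f = (- \<i>) ^ n * heat n f y * ?I"
      using inner_mult by (intro less.IH) auto
    \<comment> \<open>The exponent is raised by two, at the price of the sign, so that this term
      shares its power of \<open>- \<i>\<close> with the one from \<open>IH\<close>.\<close>
    have IHT: "pairing (- \<i>) y (T u f) = - ((- \<i>) ^ Suc n * heat (n - 1) (T u f) y * ?I)"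
    proof (cases n)
      case 0
      have "T u f = (\<lambda>x. 0)" using T_hpoly_0 inner_mult(1) 0 by blast
      thus ?thesis by (simp add: pairing_def heat_def Lap_pow_zero)
    next
      case (Suc k)
      have "pairing (- \<i>) y (T u f) = (- \<i>) ^ k * heat k (T u f) y * ?I"
        using inner_mult hpoly_T[OF inner_mult(1), of u] Suc by (intro less.IH) auto
      thus ?thesis by (simp add: Suc)
    qed
    have "pairing (- \<i>) y (\<lambda>x. of_real (u \<bullet> x) * f x)
       = (- \<i>) ^ Suc n * (of_real (u \<bullet> y) * heat n f y - heat (n - 1) (T u f) y) * ?I"
      unfolding pairing_inner_mult[OF inner_mult(1)] IH IHT by (simp add: algebra_simps inner_commute)
    thus ?case unfolding heat_inner_mult[OF inner_mult(1), symmetric] using inner_mult.prems by simp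
  next
    case (add n f g)
    have "heat m (\<lambda>x. f x + g x) y = heat m f y + heat m g y"
      unfolding heat_def Lap_pow_add[OF add(1,2)] by (simp add: distrib_left sum.distrib)
    thus ?case using add by (simp add: pairing_add[OF add(1,2)] algebra_simps)
  next
    case (cmult n f c)
    have "heat m (\<lambda>x. c * f x) y = c * heat m f y"
      unfolding heat_def Lap_pow_cmult[OF cmult(1)] by (simp add: sum_distrib_left mult.left_commute)
    thus ?case using cmult by (simp add: pairing_cmult)
  qed
  thus ?case using less.prems by blast
qed

lemma dunkl_gauss_integrand_eq:
  "dunkl_gauss_integrand P \<kappa> p y x = p x * (kernel (- \<i>) y x * gauss x) * of_real (W0 x)"
  unfolding dunkl_gauss_integrand_def dunkl_kernel_eq gauss_def by (simp add: mult_ac)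

lemma dunkl_transform_gauss:
  assumes "hpoly m p"
  shows "of_real (dunkl_const P \<kappa>) * (\<integral>x. dunkl_gauss_integrand P \<kappa> p y x \<partial>lborel)
     = (- \<i>) ^ m * of_real (exp (- (norm y)\<^sup>2 / 2)) * heat m p y"
proof -
  have "(- \<i>)\<^sup>2 * of_real ((norm y)\<^sup>2 / 2) = complex_of_real (- (norm y)\<^sup>2 / 2)" by simp
  hence "pairing (- \<i>) y (\<lambda>x. 1) = of_real (exp (- (norm y)\<^sup>2 / 2)) * total_mass"
    unfolding pairing_1 by (simp only: exp_of_real)
  hence "of_real (dunkl_const P \<kappa>) * pairing (- \<i>) y p
     = (- \<i>) ^ m * of_real (exp (- (norm y)\<^sup>2 / 2)) * heat m p y * (of_real (dunkl_const P \<kappa>) * total_mass)"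
    unfolding pairing_eq_heat[OF assms] by (simp only: mult_ac)
  thus ?thesis
    unfolding dunkl_const_total_mass by (simp only: dunkl_gauss_integrand_eq pairing_def mult_1_right)
qed

end

theorem corollary4:
  fixes R P :: "(real ^ 'n) set" and \<kappa> :: "real ^ 'n \<Rightarrow> real"
    and m :: nat and p :: "real ^ 'n \<Rightarrow> complex"
  assumes "reduced_root_system R"
    and "positive_system R P"
    and "multiplicity_function R \<kappa>"
    and "homogeneous_polynomial m p"
  shows "(\<forall>y. integrable lborel (dunkl_gauss_integrand P \<kappa> p y) \<and>
            of_real (dunkl_const P \<kappa>) * (\<integral>x. dunkl_gauss_integrand P \<kappa> p y x \<partial>lborel) =
            (- \<i>) ^ m * of_real (exp (- (norm y)\<^sup>2 / 2)) *
              (\<Sum>j = 0..m div 2. (- 1) ^ j / (2 ^ j * fact j) * (dunkl_laplacian P \<kappa> ^^ j) p y)) \<and>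
         ((\<forall>x. dunkl_laplacian P \<kappa> p x = 0) \<longrightarrow>
          (\<forall>y. of_real (dunkl_const P \<kappa>) * (\<integral>x. dunkl_gauss_integrand P \<kappa> p y x \<partial>lborel) =
               (- \<i>) ^ m * p y * of_real (exp (- (norm y)\<^sup>2 / 2))))"
proof -
  interpret dunkl R P \<kappa> using assms(1-3) by unfold_locales
  have p: "hpoly m p" by (rule homogeneous_polynomial_hpoly[OF assms(4)])
  have "integrable lborel (dunkl_gauss_integrand P \<kappa> p y)" for y
    using pairing_integrable[OF p, of "- \<i>" y] unfolding dunkl_gauss_integrand_eq[symmetric] .
  moreover have "heat m p y = p y" if "\<forall>x. dunkl_laplacian P \<kappa> p x = 0" for y
  proof -
    have "Lap p = (\<lambda>x. 0)" using that by blast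
    \<comment> \<open>Every positive power of the Laplacian annihilates p, so only j = 0 survives in
      \<open>heat\<close>.\<close>
    hence z: "(Lap ^^ j) p y = 0" if "j \<noteq> 0" for j
      using that Lap_pow_zero by (cases j) (auto simp: funpow_swap1)
    have "heat m p y = (\<Sum>j\<in>{0}. (- 1) ^ j / (2 ^ j * fact j) * (Lap ^^ j) p y)"
      unfolding heat_def by (rule sum.mono_neutral_right) (auto simp: z)
    thus ?thesis by simp
  qed
  ultimately show ?thesis
    unfolding heat_def[symmetric] dunkl_transform_gauss[OF p] by (simp add: mult.commute mult.left_commute)
qed

end
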